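(* For every separable purely infinite unital $C^*$-algebra $\mathcal{A}$ there exist a countable group $\Gamma$ and a unitary representation $\pi$ of $\Gamma$ such that $\mathcal{A}$ is $*$-isomorphic to a $C^*$-subalgebra of the Furstenberg--Hamana boundary $\mathcal{B}_\pi$.
   Context: For a unitary representation $\pi:\Gamma\to\mathcal{U}(\mathcal{H}_\pi)$ of a discrete group $\Gamma$, $\Gamma$ acts on $B(\mathcal{H}_\pi)$ by $g\cdot x=\pi(g)x\pi(g^{-1})$. A $\Gamma$-map between operator systems carrying $\Gamma$-actions is a unital completely positive $\Gamma$-equivariant linear map. Furstenberg--Hamana (FH) boundary (also called $\pi$-boundary): on the set $\mathcal{G}$ of all $\Gamma$-maps $\phi:B(\mathcal{H}_\pi)\to B(\mathcal{H}_\pi)$ put the preorder $\phi\le\psi$ iff $\|\phi(x)\|\le\|\psi(x)\|$ for all $x$. Then $\mathcal{G}$ has minimal elements, every minimal element is idempotent, and its image is unique up to bijective completely isometric $\Gamma$-maps. $\mathcal{B}_\pi$ is the image of a minimal $\phi\in\mathcal{G}$, with the Choi--Effros product $a\cdot b=\phi(ab)$ and the restricted $\Gamma$-action; it is a $\Gamma$-$C^*$-algebra. *)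

theory Defs
  imports "HOL-Analysis.Analysis" "HOL-Algebra.Module"
begin

section \<open>Abstract unital C*-algebras\<close>

class unital_cstar_algebra = real_normed_algebra_1 + banach +
  fixes scaleC :: "complex \<Rightarrow> 'a \<Rightarrow> 'a" (infixr \<open>*\<^sub>C\<close> 75)
    and star :: "'a \<Rightarrow> 'a" (\<open>(_\<^sup>\<star>)\<close> [1000] 999)
  assumes scaleR_scaleC: "scaleR r x = complex_of_real r *\<^sub>C x"
    and scaleC_add_right: "c *\<^sub>C (x + y) = c *\<^sub>C x + c *\<^sub>C y"
    and scaleC_add_left: "(c + d) *\<^sub>C x = c *\<^sub>C x + d *\<^sub>C x"
    and scaleC_scaleC: "c *\<^sub>C d *\<^sub>C x = (c * d) *\<^sub>C x"
    and scaleC_one: "1 *\<^sub>C x = x"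
    and scaleC_mult_left: "(c *\<^sub>C x) * y = c *\<^sub>C (x * y)"
    and scaleC_mult_right: "x * (c *\<^sub>C y) = c *\<^sub>C (x * y)"
    and norm_scaleC: "norm (c *\<^sub>C x) = cmod c * norm x"
    and star_star: "(x\<^sup>\<star>)\<^sup>\<star> = x"
    and star_add: "(x + y)\<^sup>\<star> = x\<^sup>\<star> + y\<^sup>\<star>"
    and star_scaleC: "(c *\<^sub>C x)\<^sup>\<star> = cnj c *\<^sub>C x\<^sup>\<star>"
    and star_mult: "(x * y)\<^sup>\<star> = y\<^sup>\<star> * x\<^sup>\<star>"
    and cstar_identity: "norm (x\<^sup>\<star> * x) = (norm x)\<^sup>2"

definition cstar_spectrum :: "'a::unital_cstar_algebra \<Rightarrow> complex set" where
  "cstar_spectrum a = {z. \<not> (\<exists>b. b * (a - z *\<^sub>C 1) = 1 \<and> (a - z *\<^sub>C 1) * b = 1)}"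

definition cstar_positive :: "'a::unital_cstar_algebra \<Rightarrow> bool" where
  "cstar_positive a \<longleftrightarrow> a\<^sup>\<star> = a \<and> cstar_spectrum a \<subseteq> \<real>\<^sub>\<ge>\<^sub>0"

definition closed_two_sided_ideal :: "'a::unital_cstar_algebra set \<Rightarrow> bool" where
  "closed_two_sided_ideal I \<longleftrightarrow> closed I \<and> 0 \<in> I \<and>
     (\<forall>x\<in>I. \<forall>y\<in>I. x + y \<in> I) \<and> (\<forall>c. \<forall>x\<in>I. c *\<^sub>C x \<in> I) \<and>
     (\<forall>x\<in>I. \<forall>a. a * x \<in> I \<and> x * a \<in> I)"

definition character :: "('a::unital_cstar_algebra \<Rightarrow> complex) \<Rightarrow> bool" where
  "character \<omega> \<longleftrightarrow> (\<forall>x y. \<omega> (x + y) = \<omega> x + \<omega> y) \<and> (\<forall>c x. \<omega> (c *\<^sub>C x) = c * \<omega> x) \<and>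
     (\<forall>x y. \<omega> (x * y) = \<omega> x * \<omega> y) \<and> (\<exists>x. \<omega> x \<noteq> 0)"

text \<open>Pure infiniteness in the sense of Kirchberg and Rordam; simplicity is not assumed. For simple
  algebras it agrees with Cuntz's definition.\<close>

definition purely_infinite :: "'a::unital_cstar_algebra itself \<Rightarrow> bool" where
  "purely_infinite _ \<longleftrightarrow> (\<nexists>\<omega> :: 'a \<Rightarrow> complex. character \<omega>) \<and>
     (\<forall>a b :: 'a. cstar_positive a \<and> cstar_positive b \<and> a \<in> closed_two_sided_ideal hull {b} \<longrightarrow>
        (\<exists>r :: nat \<Rightarrow> 'a. (\<lambda>j. (r j)\<^sup>\<star> * b * r j) \<longlonglongrightarrow> a))"


section \<open>Complex Hilbert spaces and their bounded operators\<close>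

definition complex_field :: "complex ring" where
  "complex_field = \<lparr>carrier = UNIV, monoid.mult = (*), one = 1, zero = 0, add = (+)\<rparr>"

text \<open>Hilbert spaces are carrier-based, so that one can quantify over them existentially. The fields
  \<open>mult\<close> and \<open>one\<close> inherited from the module record are not used. The inner product is linear in
  its first argument.\<close>

record 'h hilbert = "(complex, 'h) module" +
  cinner :: "'h \<Rightarrow> 'h \<Rightarrow> complex"

definition hnorm :: "('h, 'm) hilbert_scheme \<Rightarrow> 'h \<Rightarrow> real" where
  "hnorm H x = sqrt (Re (cinner H x x))"

locale hilbert_space = module complex_field H for H :: "('h, 'm) hilbert_scheme" (structure) +
  assumes cinner_add_left: "\<lbrakk>x \<in> carrier H; y \<in> carrier H; z \<in> carrier H\<rbrakk>
        \<Longrightarrow> cinner H (x \<oplus> y) z = cinner H x z + cinner H y z"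
    and cinner_smult_left: "\<lbrakk>x \<in> carrier H; y \<in> carrier H\<rbrakk>
        \<Longrightarrow> cinner H (c \<odot>\<^bsub>H\<^esub> x) y = c * cinner H x y"
    and cinner_commute: "\<lbrakk>x \<in> carrier H; y \<in> carrier H\<rbrakk> \<Longrightarrow> cinner H y x = cnj (cinner H x y)"
    and cinner_pos: "\<lbrakk>x \<in> carrier H; x \<noteq> \<zero>\<rbrakk> \<Longrightarrow> 0 < Re (cinner H x x)"
    and complete: "\<lbrakk>\<And>n. X n \<in> carrier H;
          \<And>e. e > 0 \<Longrightarrow> \<exists>N. \<forall>m\<ge>N. \<forall>n\<ge>N. hnorm H (X m \<ominus> X n) < e\<rbrakk>
        \<Longrightarrow> \<exists>L\<in>carrier H. (\<lambda>n. hnorm H (X n \<ominus> L)) \<longlonglongrightarrow> (0::real)"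

text \<open>Operators are extensional functions, hence determined by their values on the carrier.\<close>

definition bounded_ops :: "('h, 'm) hilbert_scheme \<Rightarrow> ('h \<Rightarrow> 'h) set" where
  "bounded_ops H = {T \<in> carrier H \<rightarrow>\<^sub>E carrier H.
     (\<forall>x\<in>carrier H. \<forall>y\<in>carrier H. T (x \<oplus>\<^bsub>H\<^esub> y) = T x \<oplus>\<^bsub>H\<^esub> T y) \<and>
     (\<forall>c. \<forall>x\<in>carrier H. T (c \<odot>\<^bsub>H\<^esub> x) = c \<odot>\<^bsub>H\<^esub> T x) \<and>
     (\<exists>K. \<forall>x\<in>carrier H. hnorm H (T x) \<le> K * hnorm H x)}"

definition op_norm :: "('h, 'm) hilbert_scheme \<Rightarrow> ('h \<Rightarrow> 'h) \<Rightarrow> real" where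
  "op_norm H T = Inf {K. 0 \<le> K \<and> (\<forall>x\<in>carrier H. hnorm H (T x) \<le> K * hnorm H x)}"

definition op_adj :: "('h, 'm) hilbert_scheme \<Rightarrow> ('h \<Rightarrow> 'h) \<Rightarrow> ('h \<Rightarrow> 'h)" where
  "op_adj H T = (THE S. S \<in> bounded_ops H \<and>
     (\<forall>x\<in>carrier H. \<forall>y\<in>carrier H. cinner H (T x) y = cinner H x (S y)))"

record 'b normed_star_algebra = "(complex, 'b) module" +
  adj :: "'b \<Rightarrow> 'b"
  nrm :: "'b \<Rightarrow> real"

definition op_algebra :: "('h, 'm) hilbert_scheme \<Rightarrow> ('h \<Rightarrow> 'h) normed_star_algebra" where
  "op_algebra H = \<lparr>carrier = bounded_ops H,
     monoid.mult = (\<lambda>S T. compose (carrier H) S T),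
     one = (\<lambda>x\<in>carrier H. x),
     zero = (\<lambda>x\<in>carrier H. \<zero>\<^bsub>H\<^esub>),
     add = (\<lambda>S T. \<lambda>x\<in>carrier H. S x \<oplus>\<^bsub>H\<^esub> T x),
     smult = (\<lambda>c T. \<lambda>x\<in>carrier H. c \<odot>\<^bsub>H\<^esub> T x),
     adj = op_adj H,
     nrm = op_norm H\<rparr>"

definition unitary_group :: "('h, 'm) hilbert_scheme \<Rightarrow> ('h \<Rightarrow> 'h) monoid" where
  "unitary_group H = \<lparr>carrier = {U \<in> bounded_ops H.
        adj (op_algebra H) U \<otimes>\<^bsub>op_algebra H\<^esub> U = \<one>\<^bsub>op_algebra H\<^esub> \<and>
        U \<otimes>\<^bsub>op_algebra H\<^esub> adj (op_algebra H) U = \<one>\<^bsub>op_algebra H\<^esub>},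
     monoid.mult = monoid.mult (op_algebra H),
     one = one (op_algebra H)\<rparr>"


section \<open>\<open>\<Gamma>\<close>-maps and the Furstenberg--Hamana boundary\<close>

text \<open>Positivity of an \<open>n \<times> n\<close> matrix \<open>a\<close> over \<open>B(H)\<close>, as an operator on \<open>H\<^sup>n\<close>; the complex number
  below is the value at \<open>\<xi>\<close> of its quadratic form.\<close>

definition op_matrix_positive ::
    "('h, 'm) hilbert_scheme \<Rightarrow> nat \<Rightarrow> (nat \<Rightarrow> nat \<Rightarrow> 'h \<Rightarrow> 'h) \<Rightarrow> bool" where
  "op_matrix_positive H n a \<longleftrightarrow> (\<forall>\<xi>. (\<forall>i<n. \<xi> i \<in> carrier H) \<longrightarrow>
     (\<Sum>i<n. \<Sum>j<n. cinner H (a i j (\<xi> j)) (\<xi> i)) \<in> \<real>\<^sub>\<ge>\<^sub>0)"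

definition completely_positive ::
    "('h, 'm) hilbert_scheme \<Rightarrow> (('h \<Rightarrow> 'h) \<Rightarrow> ('h \<Rightarrow> 'h)) \<Rightarrow> bool" where
  "completely_positive H \<phi> \<longleftrightarrow> (\<forall>n a. (\<forall>i<n. \<forall>j<n. a i j \<in> bounded_ops H) \<longrightarrow>
     op_matrix_positive H n a \<longrightarrow> op_matrix_positive H n (\<lambda>i j. \<phi> (a i j)))"

definition gamma_act :: "('g, 'k) monoid_scheme \<Rightarrow> ('h, 'm) hilbert_scheme \<Rightarrow>
    ('g \<Rightarrow> 'h \<Rightarrow> 'h) \<Rightarrow> 'g \<Rightarrow> ('h \<Rightarrow> 'h) \<Rightarrow> ('h \<Rightarrow> 'h)" where
  "gamma_act G H \<pi> g x = \<pi> g \<otimes>\<^bsub>op_algebra H\<^esub> x \<otimes>\<^bsub>op_algebra H\<^esub> \<pi> (inv\<^bsub>G\<^esub> g)"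

definition gamma_maps :: "('g, 'k) monoid_scheme \<Rightarrow> ('h, 'm) hilbert_scheme \<Rightarrow>
    ('g \<Rightarrow> 'h \<Rightarrow> 'h) \<Rightarrow> (('h \<Rightarrow> 'h) \<Rightarrow> ('h \<Rightarrow> 'h)) set" where
  "gamma_maps G H \<pi> = {\<phi> \<in> bounded_ops H \<rightarrow>\<^sub>E bounded_ops H.
     (\<forall>x\<in>bounded_ops H. \<forall>y\<in>bounded_ops H.
        \<phi> (x \<oplus>\<^bsub>op_algebra H\<^esub> y) = \<phi> x \<oplus>\<^bsub>op_algebra H\<^esub> \<phi> y) \<and>
     (\<forall>c. \<forall>x\<in>bounded_ops H. \<phi> (c \<odot>\<^bsub>op_algebra H\<^esub> x) = c \<odot>\<^bsub>op_algebra H\<^esub> \<phi> x) \<and>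
     \<phi> \<one>\<^bsub>op_algebra H\<^esub> = \<one>\<^bsub>op_algebra H\<^esub> \<and>
     completely_positive H \<phi> \<and>
     (\<forall>g\<in>carrier G. \<forall>x\<in>bounded_ops H. \<phi> (gamma_act G H \<pi> g x) = gamma_act G H \<pi> g (\<phi> x))}"

definition gamma_map_le :: "('h, 'm) hilbert_scheme \<Rightarrow>
    (('h \<Rightarrow> 'h) \<Rightarrow> ('h \<Rightarrow> 'h)) \<Rightarrow> (('h \<Rightarrow> 'h) \<Rightarrow> ('h \<Rightarrow> 'h)) \<Rightarrow> bool" where
  "gamma_map_le H \<phi> \<psi> \<longleftrightarrow> (\<forall>x\<in>bounded_ops H. op_norm H (\<phi> x) \<le> op_norm H (\<psi> x))"

definition minimal_gamma_map :: "('g, 'k) monoid_scheme \<Rightarrow> ('h, 'm) hilbert_scheme \<Rightarrow>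
    ('g \<Rightarrow> 'h \<Rightarrow> 'h) \<Rightarrow> (('h \<Rightarrow> 'h) \<Rightarrow> ('h \<Rightarrow> 'h)) \<Rightarrow> bool" where
  "minimal_gamma_map G H \<pi> \<phi> \<longleftrightarrow> \<phi> \<in> gamma_maps G H \<pi> \<and>
     (\<forall>\<psi>\<in>gamma_maps G H \<pi>. gamma_map_le H \<psi> \<phi> \<longrightarrow> gamma_map_le H \<phi> \<psi>)"

text \<open>The image of \<open>\<phi>\<close> with the Choi--Effros product; linear structure, unit, involution and norm
  are those of \<open>B(H)\<close>.\<close>

definition choi_effros :: "('h, 'm) hilbert_scheme \<Rightarrow> (('h \<Rightarrow> 'h) \<Rightarrow> ('h \<Rightarrow> 'h)) \<Rightarrow>
    ('h \<Rightarrow> 'h) normed_star_algebra" where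
  "choi_effros H \<phi> = (op_algebra H)\<lparr>carrier := \<phi> ` bounded_ops H,
     monoid.mult := (\<lambda>a b. \<phi> (a \<otimes>\<^bsub>op_algebra H\<^esub> b))\<rparr>"

text \<open>The boundary is determined only up to isomorphism, by a choice of minimal map, so it is a
  predicate on algebras.\<close>

definition is_FH_boundary :: "('g, 'k) monoid_scheme \<Rightarrow> ('h, 'm) hilbert_scheme \<Rightarrow>
    ('g \<Rightarrow> 'h \<Rightarrow> 'h) \<Rightarrow> ('h \<Rightarrow> 'h) normed_star_algebra \<Rightarrow> bool" where
  "is_FH_boundary G H \<pi> B \<longleftrightarrow> (\<exists>\<phi>. minimal_gamma_map G H \<pi> \<phi> \<and> B = choi_effros H \<phi>)"


section \<open>C*-subalgebras and *-isomorphisms\<close>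

text \<open>A C*-subalgebra need not contain the unit.\<close>

definition cstar_subalgebra :: "'b set \<Rightarrow> ('b, 'm) normed_star_algebra_scheme \<Rightarrow> bool" where
  "cstar_subalgebra C B \<longleftrightarrow> C \<subseteq> carrier B \<and> \<zero>\<^bsub>B\<^esub> \<in> C \<and>
     (\<forall>x\<in>C. \<forall>y\<in>C. x \<oplus>\<^bsub>B\<^esub> y \<in> C \<and> x \<otimes>\<^bsub>B\<^esub> y \<in> C) \<and>
     (\<forall>c. \<forall>x\<in>C. c \<odot>\<^bsub>B\<^esub> x \<in> C) \<and>
     (\<forall>x\<in>C. adj B x \<in> C) \<and>
     (\<forall>X. \<forall>L\<in>carrier B. (\<forall>n::nat. X n \<in> C) \<and> (\<lambda>n. nrm B (X n \<ominus>\<^bsub>B\<^esub> L)) \<longlonglongrightarrow> 0 \<longrightarrow> L \<in> C)"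

definition star_isomorphism ::
    "('a::unital_cstar_algebra \<Rightarrow> 'b) \<Rightarrow> 'b set \<Rightarrow> ('b, 'm) normed_star_algebra_scheme \<Rightarrow> bool" where
  "star_isomorphism f C B \<longleftrightarrow> bij_betw f UNIV C \<and>
     (\<forall>x y. f (x + y) = f x \<oplus>\<^bsub>B\<^esub> f y) \<and>
     (\<forall>c x. f (c *\<^sub>C x) = c \<odot>\<^bsub>B\<^esub> f x) \<and>
     (\<forall>x y. f (x * y) = f x \<otimes>\<^bsub>B\<^esub> f y) \<and>
     (\<forall>x. f (x\<^sup>\<star>) = adj B (f x))"

end

theory Submission
  imports Defs
begin

text \<open>
  The boundary can be made as large as possible: there is a countable group of unitaries on
  \<open>\<ell>\<^sup>2\<close> for which the identity is the only \<open>\<Gamma>\<close>-map, so that its boundary is all of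
  \<open>B(\<ell>\<^sup>2)\<close> with the usual product. Every separable unital C*-algebra embeds into \<open>B(\<ell>\<^sup>2)\<close>
  by the Gelfand--Naimark theorem, and the embedding need not preserve the unit.

  \<^bold>\<open>The group.\<close> It is generated by three permutations of the basis that fix \<open>e\<^sub>0\<close> and by countably many
  reflections carrying \<open>e\<^sub>0\<close> to the vectors \<open>e\<^sub>j\<close> and \<open>(e\<^sub>j + z e\<^sub>k)/\<surd>2\<close> with \<open>z \<in> {1, \<i>}\<close>.
  For a \<open>\<Gamma>\<close>-map \<open>\<phi>\<close> the state \<open>m(T) = \<langle>\<phi>(T) e\<^sub>0, e\<^sub>0\<rangle>\<close> is invariant under the permutations, which exchange
  the residue classes of the positive integers modulo 3 paradoxically; hence \<open>m\<close> vanishes on the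
  projection onto the complement of \<open>e\<^sub>0\<close> (\<open>state_coord_proj\<close>). A state with that property is the vector
  state of \<open>e\<^sub>0\<close> (\<open>state_eq\<close>). Equivariance under the reflections moves this identity to the other
  vectors, whose quadratic form values determine an operator (\<open>equivariant_map_eq\<close>).

  \<^bold>\<open>The embedding.\<close> Positivity is treated without spectral theory. The positive cone consists of the
  self-adjoint \<open>h\<close> with \<open>\<parallel>t - h\<parallel> \<le> t\<close> for some \<open>t \<ge> 0\<close>; it is visibly a convex cone, and it is the set of
  squares of self-adjoint elements by an iterative square root (\<open>sqrt_one_minus\<close>). The element
  \<open>w = \<bar>h\<bar> - h\<close> plays the role of the negative part (\<open>negative_part\<close>), and gives the positivity of
  \<open>x\<^sup>\<star>x\<close>. The Hahn--Banach theorem then yields enough positive functionals, and separability combines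
  countably many of them into a faithful one. Its GNS space is identified with a subspace of \<open>\<ell>\<^sup>2\<close>
  by Gram--Schmidt. The resulting representation is bounded below, again by \<open>negative_part\<close>
  (\<open>rep_lower_bound\<close>), so its range is closed.
\<close>

section \<open>The positive cone of a C*-algebra\<close>

lemma scaleR_4: "4 *\<^sub>R x = x + x + x + (x::'a::real_vector)"
  using scaleR_add_left[of 2 2 x] by (simp add: scaleR_2 add.assoc)

lemma star_zero [simp]: "(0::'a::unital_cstar_algebra)\<^sup>\<star> = 0"
  using star_add[of "0::'a" 0] by simp

lemma star_minus: "(- x)\<^sup>\<star> = - (x::'a::unital_cstar_algebra)\<^sup>\<star>"
  using star_add[of x "- x"] by (simp add: eq_neg_iff_add_eq_0 add.commute)

lemma star_diff: "(x - y)\<^sup>\<star> = x\<^sup>\<star> - (y::'a::unital_cstar_algebra)\<^sup>\<star>"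
  using star_add[of x "- y"] by (simp add: star_minus)

lemma star_scaleR: "(r *\<^sub>R x)\<^sup>\<star> = r *\<^sub>R (x::'a::unital_cstar_algebra)\<^sup>\<star>"
  by (simp add: scaleR_scaleC star_scaleC)

lemma star_one [simp]: "(1::'a::unital_cstar_algebra)\<^sup>\<star> = 1"
  by (metis mult.left_neutral mult.right_neutral star_mult star_star)

lemma norm_star [simp]: "norm (x\<^sup>\<star>) = norm (x::'a::unital_cstar_algebra)"
proof -
  have *: "norm y \<le> norm (y\<^sup>\<star>)" for y :: 'a
  proof (cases "y = 0")
    case False
    have "norm y * norm y \<le> norm (y\<^sup>\<star>) * norm y"
      using norm_mult_ineq[of "y\<^sup>\<star>" y] by (simp add: cstar_identity power2_eq_square)
    then show ?thesis using False by simp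
  qed simp
  show ?thesis using *[of x] *[of "x\<^sup>\<star>"] by (simp add: star_star)
qed

lemma bounded_linear_star: "bounded_linear (star :: 'a::unital_cstar_algebra \<Rightarrow> 'a)"
  by (rule bounded_linear_intro[where K = 1]) (auto simp: star_add star_scaleR)

lemma norm_selfadjoint_square:
  "(x::'a::unital_cstar_algebra)\<^sup>\<star> = x \<Longrightarrow> norm (x * x) = (norm x)\<^sup>2"
  by (metis cstar_identity)

lemma selfadjoint_square_eq_0: "(x::'a::unital_cstar_algebra)\<^sup>\<star> = x \<Longrightarrow> x * x = 0 \<Longrightarrow> x = 0"
  using norm_selfadjoint_square[of x] by simp

lemma scaleC_minus_right: "c *\<^sub>C (- x) = - (c *\<^sub>C (x::'a::unital_cstar_algebra))"
  by (metis add.right_inverse add_eq_0_iff scaleC_add_right add_cancel_left_right)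

lemma scaleC_zero_left [simp]: "0 *\<^sub>C (x::'a::unital_cstar_algebra) = 0"
  by (metis add_cancel_right_right scaleC_add_left)

lemma scaleC_minus_left: "(- c) *\<^sub>C x = - (c *\<^sub>C (x::'a::unital_cstar_algebra))"
  by (metis add.right_inverse add_eq_0_iff scaleC_add_left scaleC_zero_left)

text \<open>The fixed point of \<open>y = (z + y\<^sup>2)/2\<close> satisfies \<open>(1 - y)\<^sup>2 = 1 - z\<close>. The iteration from 0
  converges even for \<open>\<parallel>z\<parallel> = 1\<close>, because its increments are dominated by those of the scalar iteration
  \<open>t = (1 + t\<^sup>2)/2\<close>, which increases and is bounded by 1.\<close>
lemma sqrt_one_minus:
  fixes z :: "'a::unital_cstar_algebra"
  assumes z: "z\<^sup>\<star> = z" "norm z \<le> 1"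
  obtains s where "s\<^sup>\<star> = s" "s * s = 1 - z" "norm (1 - s) \<le> 1"
    "\<forall>c. c * z = z * c \<longrightarrow> c * s = s * c"
proof -
  define y where "y = rec_nat (0::'a) (\<lambda>_ y. (1/2) *\<^sub>R (z + y * y))"
  define t where "t = rec_nat (0::real) (\<lambda>_ t. (1 + t * t) / 2)"
  have y0: "y 0 = 0" and yS: "y (Suc n) = (1/2) *\<^sub>R (z + y n * y n)" for n
    by (simp_all add: y_def)
  have t0: "t 0 = 0" and tS: "t (Suc n) = (1 + t n * t n) / 2" for n
    by (simp_all add: t_def)
  have comm: "c * y n = y n * c" if "c * z = z * c" for c n
  proof (induction n)
    case (Suc n)
    have "c * (y n * y n) = (y n * y n) * c" by (metis Suc mult.assoc)
    then show ?case using that by (simp add: yS algebra_simps)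
  qed (simp add: y0)
  have self: "(y n)\<^sup>\<star> = y n" for n
    by (induction n) (simp_all add: y0 yS star_scaleR star_add star_mult z)
  have cz: "y m * z = z * y m" for m using comm[of z m] by simp
  have cy: "y m * y n = y n * y m" for m n using comm[OF cz] .
  have t01: "0 \<le> t n \<and> t n \<le> 1" for n
  proof (induction n)
    case (Suc n)
    then have "t n * t n \<le> 1" by (simp add: mult_le_one)
    then show ?case using Suc by (simp add: tS)
  qed (simp add: t0)
  have ny: "norm (y n) \<le> t n" for n
  proof (induction n)
    case (Suc n)
    have "norm (y n * y n) \<le> t n * t n"
      using norm_mult_ineq[of "y n" "y n"] mult_mono'[OF Suc Suc] by simp
    then have "norm (z + y n * y n) \<le> 1 + t n * t n"
      using norm_triangle_ineq[of z "y n * y n"] z by linarith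
    then show ?case by (simp add: yS tS)
  qed (simp add: y0 t0)
  have dy: "norm (y (Suc n) - y n) \<le> t (Suc n) - t n" for n
  proof (induction n)
    case 0
    show ?case using ny[of 1] by (simp add: y0 t0)
  next
    case (Suc n)
    have "(y (Suc n) + y n) * (y (Suc n) - y n) = (z + y (Suc n) * y (Suc n)) - (z + y n * y n)"
      using cy[of "Suc n" n] by (simp add: algebra_simps)
    then have "y (Suc (Suc n)) - y (Suc n) = (1/2) *\<^sub>R ((y (Suc n) + y n) * (y (Suc n) - y n))"
      by (metis scaleR_diff_right yS)
    then have "norm (y (Suc (Suc n)) - y (Suc n)) \<le> (1/2) * (norm (y (Suc n) + y n) * norm (y (Suc n) - y n))"
      using norm_mult_ineq[of "y (Suc n) + y n" "y (Suc n) - y n"] by simp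
    also have "\<dots> \<le> (1/2) * ((t (Suc n) + t n) * (t (Suc n) - t n))"
    proof -
      have "norm (y (Suc n) + y n) \<le> t (Suc n) + t n"
        using norm_triangle_ineq[of "y (Suc n)" "y n"] ny[of "Suc n"] ny[of n] by linarith
      then show ?thesis using mult_mono'[OF _ Suc] by simp
    qed
    also have "\<dots> = (1 + t (Suc n) * t (Suc n)) / 2 - (1 + t n * t n) / 2"
      by (simp add: field_simps)
    also have "\<dots> = t (Suc (Suc n)) - t (Suc n)" unfolding tS ..
    finally show ?case .
  qed
  have mono: "t m \<le> t (m + k)" for m k
  proof (induction k)
    case (Suc k)
    have "0 \<le> t (Suc (m + k)) - t (m + k)" using dy[of "m + k"] norm_ge_zero order_trans by blast
    then show ?case using Suc by simp
  qed simp
  have dist: "norm (y (m + k) - y m) \<le> t (m + k) - t m" for m k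
  proof (induction k)
    case (Suc k)
    have "norm (y (m + Suc k) - y m) \<le> norm (y (Suc (m + k)) - y (m + k)) + norm (y (m + k) - y m)"
      using norm_triangle_ineq[of "y (Suc (m + k)) - y (m + k)" "y (m + k) - y m"] by simp
    then show ?case using Suc dy[of "m + k"] by simp
  qed simp
  have inc: "incseq t" using mono by (auto simp: incseq_def le_iff_add)
  then have "convergent t"
    using incseq_convergent[OF inc, of 1] t01 unfolding convergent_def by metis
  then have Ct: "Cauchy t" by (rule convergent_Cauchy)
  have "Cauchy y"
  proof (rule CauchyI)
    fix e :: real assume "e > 0"
    then obtain M where M: "\<And>m n. m \<ge> M \<Longrightarrow> n \<ge> M \<Longrightarrow> norm (t m - t n) < e"
      using CauchyD[OF Ct] by blast
    have *: "norm (y n - y m) < e" if "m \<ge> M" "m \<le> n" for m n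
      using dist[of m "n - m"] M[of n m] that by simp
    show "\<exists>M. \<forall>m\<ge>M. \<forall>n\<ge>M. norm (y m - y n) < e"
      by (metis * nle_le norm_minus_commute)
  qed
  then obtain l where l: "y \<longlonglongrightarrow> l" using Cauchy_convergent convergent_def by blast
  have l2: "(\<lambda>n. (1/2) *\<^sub>R (z + y n * y n)) \<longlonglongrightarrow> (1/2) *\<^sub>R (z + l * l)"
    by (intro tendsto_intros l)
  have "(\<lambda>n. y (Suc n)) \<longlonglongrightarrow> l" using l by (simp add: LIMSEQ_Suc)
  then have eq: "l = (1/2) *\<^sub>R (z + l * l)" using l2 unfolding yS by (rule LIMSEQ_unique)
  have "2 *\<^sub>R l = z + l * l" by (subst eq) simp
  then have e2: "(1 - l) * (1 - l) = 1 - z" by (simp add: algebra_simps scaleR_2)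
  have "(\<lambda>n. (y n)\<^sup>\<star>) \<longlonglongrightarrow> l\<^sup>\<star>" by (rule bounded_linear.tendsto[OF bounded_linear_star l])
  then have sl: "l\<^sup>\<star> = l" unfolding self using l LIMSEQ_unique by blast
  have nl: "norm l \<le> 1"
    by (rule Lim_bounded[OF tendsto_norm[OF l], of 0]) (use ny t01 order_trans in blast)
  have cl: "c * (1 - l) = (1 - l) * c" if "c * z = z * c" for c
  proof -
    have "(\<lambda>n. c * y n) \<longlonglongrightarrow> c * l" "(\<lambda>n. y n * c) \<longlonglongrightarrow> l * c"
      by (intro tendsto_intros l)+
    then have "c * l = l * c" unfolding comm[OF that] by (rule LIMSEQ_unique)
    then show ?thesis by (simp add: algebra_simps)
  qed
  show ?thesis
  proof (rule that[OF _ e2])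
    show "(1 - l)\<^sup>\<star> = 1 - l" by (simp add: star_diff sl)
    show "norm (1 - (1 - l)) \<le> 1" using nl by simp
    show "\<forall>c. c * z = z * c \<longrightarrow> c * (1 - l) = (1 - l) * c" using cl by blast
  qed
qed

text \<open>Positive elements, described by the norm alone. The condition for one \<open>t\<close> implies it for all larger ones.\<close>
definition positive_cone :: "'a::unital_cstar_algebra set" where
  "positive_cone = {h. h\<^sup>\<star> = h \<and> (\<exists>t\<ge>0. norm (t *\<^sub>R 1 - h) \<le> t)}"

lemma positive_selfadjoint: "h \<in> positive_cone \<Longrightarrow> h\<^sup>\<star> = h"
  by (simp add: positive_cone_def)

lemma positive_scaleR: "h \<in> positive_cone \<Longrightarrow> r \<ge> 0 \<Longrightarrow> r *\<^sub>R h \<in> positive_cone"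
proof -
  assume h: "h \<in> positive_cone" and r: "r \<ge> 0"
  then obtain t where t: "t \<ge> 0" "norm (t *\<^sub>R 1 - h) \<le> t" by (auto simp: positive_cone_def)
  have "norm ((r * t) *\<^sub>R 1 - r *\<^sub>R h) = r * norm (t *\<^sub>R 1 - h)"
    using r by (metis abs_of_nonneg norm_scaleR scaleR_diff_right scaleR_scaleR)
  then have "norm ((r * t) *\<^sub>R 1 - r *\<^sub>R h) \<le> r * t" using t r by (simp add: mult_left_mono)
  then show ?thesis using h r t by (auto simp: positive_cone_def star_scaleR intro!: exI[of _ "r * t"])
qed

lemma positive_add: 
  assumes "h \<in> positive_cone" "k \<in> positive_cone"
  shows "h + k \<in> positive_cone"
proof -
  from assms obtain s t where st: "s \<ge> 0" "t \<ge> 0" "norm (s *\<^sub>R 1 - h) \<le> s" "norm (t *\<^sub>R 1 - k) \<le> t" 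
    by (auto simp: positive_cone_def)
  have "norm ((s + t) *\<^sub>R 1 - (h + k)) = norm ((s *\<^sub>R 1 - h) + (t *\<^sub>R 1 - k))"
    by (simp add: algebra_simps)
  also have "\<dots> \<le> s + t" using norm_triangle_ineq[of "s *\<^sub>R 1 - h" "t *\<^sub>R 1 - k"] st by linarith
  finally show ?thesis using assms st
    by (auto simp: positive_cone_def star_add intro!: exI[of _ "s + t"])
qed

lemma positive_sqrt:
  fixes h :: "'a::unital_cstar_algebra"
  assumes "h \<in> positive_cone"
  obtains k where "k \<in> positive_cone" "k * k = h" "\<forall>c. c * h = h * c \<longrightarrow> c * k = k * c"
proof -
  from assms obtain t where t0: "t \<ge> 0" "norm (t *\<^sub>R 1 - h) \<le> t" and h: "h\<^sup>\<star> = h"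
    by (auto simp: positive_cone_def)
  define u where "u = t + 1"
  have "norm (u *\<^sub>R 1 - h) = norm ((t *\<^sub>R 1 - h) + 1)" by (simp add: u_def algebra_simps)
  also have "\<dots> \<le> u" using norm_triangle_ineq[of "t *\<^sub>R 1 - h" 1] t0 by (simp add: u_def)
  finally have u: "u > 0" "norm (u *\<^sub>R 1 - h) \<le> u" using t0 by (auto simp: u_def)
  define z where "z = (1/u) *\<^sub>R (u *\<^sub>R 1 - h)"
  have z1: "z = 1 - (1/u) *\<^sub>R h" using u by (simp add: z_def algebra_simps)
  have zs: "z\<^sup>\<star> = z" by (simp add: z1 star_diff star_scaleR h)
  have nz: "norm z \<le> 1" using u by (simp add: z_def)
  obtain s where s: "s\<^sup>\<star> = s" "s * s = 1 - z" "norm (1 - s) \<le> 1"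
    "\<forall>c. c * z = z * c \<longrightarrow> c * s = s * c"
    by (rule sqrt_one_minus[OF zs nz])
  have sp: "s \<in> positive_cone"
  proof -
    have "norm (1 *\<^sub>R 1 - s) \<le> 1" using s(3) by simp
    then show ?thesis unfolding positive_cone_def using s(1)
      by (intro CollectI conjI exI[of _ "1::real"]) simp_all
  qed
  show ?thesis
  proof (rule that[of "sqrt u *\<^sub>R s"])
    show "sqrt u *\<^sub>R s \<in> positive_cone" using sp u by (simp add: positive_scaleR)
    show "sqrt u *\<^sub>R s * sqrt u *\<^sub>R s = h" using u s(2) by (simp add: z1)
    have "c * sqrt u *\<^sub>R s = sqrt u *\<^sub>R s * c" if "c * h = h * c" for c
    proof -
      have "c * z = z * c" using that by (simp add: z1 algebra_simps)
      then show ?thesis using s(4) by simp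
    qed
    then show "\<forall>c. c * h = h * c \<longrightarrow> c * sqrt u *\<^sub>R s = sqrt u *\<^sub>R s * c" by blast
  qed
qed

text \<open>For a self-adjoint contraction \<open>k\<close>, the element \<open>k + \<i>\<surd>(1 - k\<^sup>2)\<close> is unitary, so its
  imaginary part is again a contraction.\<close>
lemma contraction_square:
  fixes k :: "'a::unital_cstar_algebra"
  assumes k: "k\<^sup>\<star> = k" and n: "norm k \<le> 1"
  shows "norm (1 - k * k) \<le> 1" "1 - k * k \<in> positive_cone"
proof -
  have "norm (k * k) \<le> 1" using n by (simp add: norm_selfadjoint_square[OF k] power_le_one)
  then have nkk: "norm (k * k) \<le> 1" .
  have skk: "(k * k)\<^sup>\<star> = k * k" by (simp add: star_mult k)
  obtain s where s: "s\<^sup>\<star> = s" "s * s = 1 - k * k" "norm (1 - s) \<le> 1"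
    "\<forall>c. c * (k * k) = k * k * c \<longrightarrow> c * s = s * c"
    by (rule sqrt_one_minus[OF skk nkk])
  have ks: "k * s = s * k" using s(4) by (simp add: mult.assoc)
  define u where "u = k + \<i> *\<^sub>C s"
  have us: "u\<^sup>\<star> = k - \<i> *\<^sub>C s" by (simp add: u_def star_add star_scaleC s k scaleC_minus_left)
  have "u\<^sup>\<star> * u = k * k + s * s"
  proof -
    define v where "v = \<i> *\<^sub>C s"
    have v2: "v * v = - (s * s)"
      by (simp add: v_def scaleC_mult_left scaleC_mult_right scaleC_scaleC scaleC_minus_left scaleC_one)
    have vk: "k * v = v * k"
      by (simp add: v_def scaleC_mult_left scaleC_mult_right ks)
    have "u\<^sup>\<star> * u = (k - v) * (k + v)" unfolding us by (simp add: u_def v_def)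
    also have "\<dots> = k * k + (k * v - v * k) - v * v" by (simp only: distrib_left left_diff_distrib) simp
    also have "\<dots> = k * k + s * s" by (simp only: v2 vk) simp
    finally show ?thesis .
  qed
  then have "(norm u)\<^sup>2 = 1\<^sup>2" using cstar_identity[of u] s(2) by simp
  then have nu: "norm u = 1" by (metis norm_ge_zero zero_le_one power2_eq_iff_nonneg)
  have "2 *\<^sub>R (\<i> *\<^sub>C s) = u - u\<^sup>\<star>" unfolding us by (simp add: u_def scaleR_2)
  then have "2 * norm s = norm (u - u\<^sup>\<star>)" by (metis norm_scaleR abs_numeral norm_scaleC norm_ii mult_1)
  also have "\<dots> \<le> 2" using norm_triangle_ineq4[of u "u\<^sup>\<star>"] nu by simp
  finally have ns: "norm s \<le> 1" by simp
  have "norm (1 - k * k) = (norm s)\<^sup>2" using norm_selfadjoint_square[OF s(1)] s(2) by simp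
  then show "norm (1 - k * k) \<le> 1" using ns by (simp add: power_le_one)
  have "norm (1 - (1 - k * k)) \<le> 1" using \<open>norm (k * k) \<le> 1\<close> by simp
  then show "1 - k * k \<in> positive_cone" using k
    by (auto simp: positive_cone_def star_diff star_mult intro!: exI[of _ 1])
qed

lemma scaled_square:
  fixes k :: "'a::unital_cstar_algebra"
  assumes k: "k\<^sup>\<star> = k" and t: "(norm k)\<^sup>2 \<le> t"
  shows "norm (t *\<^sub>R 1 - k * k) \<le> t" "t *\<^sub>R 1 - k * k \<in> positive_cone"
proof -
  have "norm (t *\<^sub>R 1 - k * k) \<le> t \<and> t *\<^sub>R 1 - k * k \<in> positive_cone"
  proof (cases "t = 0")
    case True
    then have "k = 0" using t by simp
    then show ?thesis using True by (auto simp: positive_cone_def)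
  next
    case False
    then have t0: "t > 0" using t by (metis less_eq_real_def order_trans zero_le_power2)
    define c where "c = (1 / sqrt t) *\<^sub>R k"
    have "norm k \<le> sqrt t" using t by (simp add: real_le_rsqrt)
    then have c: "c\<^sup>\<star> = c" "norm c \<le> 1" using t0 by (simp_all add: c_def star_scaleR k)
    have eq: "t *\<^sub>R 1 - k * k = t *\<^sub>R (1 - c * c)" using t0 by (simp add: c_def algebra_simps)
    have "norm (t *\<^sub>R (1 - c * c)) \<le> t"
      using contraction_square(1)[OF c] t0 by simp
    moreover have "t *\<^sub>R (1 - c * c) \<in> positive_cone"
      using contraction_square(2)[OF c] t0 by (intro positive_scaleR) auto
    ultimately show ?thesis unfolding eq by blast
  qed
  then show "norm (t *\<^sub>R 1 - k * k) \<le> t" "t *\<^sub>R 1 - k * k \<in> positive_cone" by blast+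
qed

lemma square_positive:
  assumes "k\<^sup>\<star> = k"
  shows "k * k \<in> positive_cone"
proof -
  have "(k * k)\<^sup>\<star> = k * k" by (simp only: star_mult assms)
  moreover have "norm ((norm k)\<^sup>2 *\<^sub>R 1 - k * k) \<le> (norm k)\<^sup>2"
    by (rule scaled_square(1)[OF assms order_refl])
  ultimately show ?thesis unfolding positive_cone_def using zero_le_power2 by blast
qed

lemma positive_upper:
  assumes h: "h \<in> positive_cone" and t: "norm h \<le> t"
  shows "norm (t *\<^sub>R 1 - h) \<le> t" "t *\<^sub>R 1 - h \<in> positive_cone"
proof -
  obtain k where k: "k \<in> positive_cone" "k * k = h" by (rule positive_sqrt[OF h])
  then have ks: "k\<^sup>\<star> = k" by (simp add: positive_selfadjoint)
  have "(norm k)\<^sup>2 \<le> t" using norm_selfadjoint_square[OF ks] k t by simp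
  then show "norm (t *\<^sub>R 1 - h) \<le> t" "t *\<^sub>R 1 - h \<in> positive_cone"
    using scaled_square[OF ks] k by auto
qed

lemma scalar_positive: "t \<ge> 0 \<Longrightarrow> t *\<^sub>R 1 \<in> (positive_cone :: 'a::unital_cstar_algebra set)"
  by (auto simp: positive_cone_def star_scaleR intro!: exI[of _ t])

lemma norm_diff_selfadjoint_positive:
  fixes h :: "'a::unital_cstar_algebra"
  assumes h: "h\<^sup>\<star> = h" and t: "norm h \<le> t"
  shows "t *\<^sub>R 1 - h \<in> positive_cone"
  using assms norm_ge_zero[of h]
  by (auto simp: positive_cone_def star_diff star_scaleR simp del: norm_ge_zero intro!: exI[of _ t])

text \<open>If \<open>0 \<le> b \<le> t\<close> then \<open>\<parallel>b\<parallel> \<le> 2t\<close>; the constant is not optimal.\<close>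
lemma positive_norm_bound:
  fixes b :: "'a::unital_cstar_algebra"
  assumes b: "b \<in> positive_cone" and tb: "t *\<^sub>R 1 - b \<in> positive_cone"
  shows "norm b \<le> 2 * t"
proof -
  have *: "norm b \<le> 2 * t" if t: "t \<ge> 0" and b: "b \<in> positive_cone" and tb: "t *\<^sub>R 1 - b \<in> positive_cone" 
    and n: "norm b = 1" for t and b :: 'a
  proof -
    have "norm (t *\<^sub>R 1 - b) \<le> 1 + t" using norm_triangle_ineq4[of "t *\<^sub>R 1" b] n t by simp
    from positive_upper(1)[OF tb this] have 1: "norm (1 + b) \<le> 1 + t" by (simp add: algebra_simps)
    have 2: "norm (1 - b) \<le> 1" using positive_upper(1)[OF b, of 1] n by simp
    have s: "b\<^sup>\<star> = b" using b by (rule positive_selfadjoint)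
    have "4 *\<^sub>R b = (1 + b) * (1 + b) - (1 - b) * (1 - b)"
      by (simp add: algebra_simps scaleR_4)
    then have "4 * norm b \<le> norm ((1 + b) * (1 + b)) + norm ((1 - b) * (1 - b))"
      by (metis norm_triangle_ineq4 norm_scaleR abs_numeral)
    also have "\<dots> = (norm (1 + b))\<^sup>2 + (norm (1 - b))\<^sup>2"
      using s by (simp add: norm_selfadjoint_square star_add star_diff)
    also have "\<dots> \<le> (1 + t)\<^sup>2 + 1\<^sup>2" using 1 2 by (intro add_mono power_mono) auto
    finally have "3 \<le> (1 + t)\<^sup>2" using n by simp
    moreover have "(1 + t)\<^sup>2 \<le> (3/2)\<^sup>2" if "t < 1/2" using t that by (intro power_mono) auto
    ultimately have "1/2 \<le> t" by (force simp: power2_eq_square)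
    then show ?thesis using n by simp
  qed
  have *: "norm b \<le> 2 * t" if t: "t \<ge> 0" and b: "b \<in> positive_cone" and tb: "t *\<^sub>R 1 - b \<in> positive_cone" 
    for t and b :: 'a
  proof (cases "b = 0")
    case False
    have e: "(t / norm b) *\<^sub>R 1 - (1 / norm b) *\<^sub>R b = (1 / norm b) *\<^sub>R (t *\<^sub>R 1 - b)"
      by (simp add: algebra_simps)
    have "norm ((1 / norm b) *\<^sub>R b) \<le> 2 * (t / norm b)"
      using False t b tb by (intro *) (auto simp: e positive_scaleR)
    then show ?thesis using False by (simp add: field_simps)
  qed (use t in simp)
  show ?thesis
  proof (cases "t \<ge> 0")
    case False
    have "(t *\<^sub>R 1 - b) + (- t) *\<^sub>R 1 \<in> positive_cone"
      using False by (intro positive_add tb scalar_positive) simp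
    then have "norm b \<le> 0" using *[of 0 b] b by simp
    then have "b = 0" by simp
    then have "t *\<^sub>R 1 \<in> (positive_cone :: 'a set)" using tb by simp
    then have "norm ((- t) *\<^sub>R 1 - t *\<^sub>R (1::'a)) \<le> - t"
      using positive_upper(1)[of "t *\<^sub>R (1::'a)" "- t"] False by simp
    then have "norm ((- t - t) *\<^sub>R (1::'a)) \<le> - t" by (simp only: scaleR_left_diff_distrib)
    then show ?thesis using False by simp
  qed (use * b tb in auto)
qed

text \<open>The substitute for the negative part: \<open>w = \<bar>h\<bar> - h\<close> satisfies \<open>w h w \<le> 0\<close>, and it only
  vanishes when \<open>h\<close> is positive.\<close>
lemma negative_part:
  fixes h :: "'a::unital_cstar_algebra"
  assumes h: "h\<^sup>\<star> = h"
  obtains w g where "w\<^sup>\<star> = w" "g\<^sup>\<star> = g" "w * h * w = - (g * g)" "g = 0 \<Longrightarrow> h \<in> positive_cone"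
proof -
  obtain k where k: "k \<in> positive_cone" "k * k = h * h" and kc: "\<forall>c. c * (h * h) = h * h * c \<longrightarrow> c * k = k * c"
    by (rule positive_sqrt[OF square_positive[OF h]])
  obtain r where r: "r \<in> positive_cone" "r * r = k" and rc: "\<forall>c. c * k = k * c \<longrightarrow> c * r = r * c"
    by (rule positive_sqrt[OF k(1)])
  note sa = positive_selfadjoint[OF k(1)] positive_selfadjoint[OF r(1)]
  have hk: "h * k = k * h" using kc by (simp add: mult.assoc)
  have hr: "h * r = r * h" using rc hk by blast
  have kr: "k * r = r * k" using rc by simp
  define w where "w = k - h"
  have ws: "w\<^sup>\<star> = w" by (simp add: w_def star_diff sa h)
  have wr: "w * r = r * w" by (simp add: w_def algebra_simps hr kr)
  have hw: "h * w = - (k * w)" by (simp add: w_def algebra_simps hk k)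
  have kw: "k * w = r * (r * w)" by (simp add: r(2)[symmetric] mult.assoc)
  show ?thesis
  proof (rule that[of w "r * w"])
    show "w\<^sup>\<star> = w" by (rule ws)
    show "(r * w)\<^sup>\<star> = r * w" by (simp add: star_mult ws sa wr)
    have "w * h * w = - (w * (k * w))" by (simp add: mult.assoc hw)
    also have "w * (k * w) = (r * w) * (r * w)" unfolding kw by (metis wr mult.assoc)
    finally show "w * h * w = - ((r * w) * (r * w))" .
    assume "r * w = 0"
    then have "k * w = 0" by (simp add: kw)
    then have "w * w = 0" using hw by (simp add: w_def left_diff_distrib)
    then have "w = 0" using selfadjoint_square_eq_0 ws by blast
    then show "h \<in> positive_cone" using k by (simp add: w_def)
  qed
qed

text \<open>For \<open>\<parallel>x\<parallel> = 1\<close> put \<open>p = xx\<^sup>\<star>\<close> and \<open>q = - x\<^sup>\<star>x\<close>. If \<open>q \<ge> 0\<close> then also \<open>p \<ge> 0\<close>, and \<open>(1 - p) x = x (1 + q)\<close>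
  bounds \<open>q(1 + q)\<^sup>2\<close> by 1. As \<open>q(1 - q)\<^sup>2\<close> is bounded by 1 as well, their difference \<open>4q\<^sup>2\<close> has
  norm at most 2, which contradicts \<open>\<parallel>q\<parallel> = 1\<close>.\<close>
lemma star_mult_self_nonpositive:
  fixes y :: "'a::unital_cstar_algebra"
  assumes q: "- (y\<^sup>\<star> * y) \<in> positive_cone"
  shows "y = 0"
proof (rule ccontr)
  assume "y \<noteq> 0"
  define x where "x = (1 / norm y) *\<^sub>R y"
  define q where "q = - (x\<^sup>\<star> * x)"
  define p where "p = x * x\<^sup>\<star>"
  have nx: "norm x = 1" using \<open>y \<noteq> 0\<close> by (simp add: x_def)
  have "q = (1 / norm y)\<^sup>2 *\<^sub>R (- (y\<^sup>\<star> * y))"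
    by (simp add: q_def x_def star_scaleR power2_eq_square)
  then have qp: "q \<in> positive_cone" by (metis q positive_scaleR zero_le_power2)
  define a b where "a = x + x\<^sup>\<star>" and "b = \<i> *\<^sub>C (x - x\<^sup>\<star>)"
  have ab: "a\<^sup>\<star> = a" "b\<^sup>\<star> = b"
    by (simp_all add: a_def b_def star_add star_star star_scaleC star_diff)
       (metis minus_diff_eq scaleC_minus_left scaleC_minus_right minus_minus)
  have bb: "b * b = - ((x - x\<^sup>\<star>) * (x - x\<^sup>\<star>))"
    by (simp add: b_def scaleC_mult_left scaleC_mult_right scaleC_scaleC scaleC_minus_left scaleC_one)
  have "p = (1/2) *\<^sub>R (a * a + b * b) + q"
    unfolding bb by (simp add: a_def p_def q_def algebra_simps scaleR_2[symmetric] scaleR_add_left[symmetric])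
  then have pp: "p \<in> positive_cone"
    using ab qp by (auto intro!: positive_add positive_scaleR square_positive)
  have np: "norm p = 1" using cstar_identity[of "x\<^sup>\<star>"] nx by (simp add: p_def star_star)
  have nq: "norm q = 1" using cstar_identity[of x] nx by (simp add: q_def)
  have qs: "q\<^sup>\<star> = q" using qp by (rule positive_selfadjoint)
  have p1: "norm (1 - p) \<le> 1" using positive_upper(1)[OF pp, of 1] np by simp
  have q1: "norm (1 - q) \<le> 1" using positive_upper(1)[OF qp, of 1] nq by simp
  have shift: "(1 - p) * x = x * (1 + q)" by (simp add: p_def q_def algebra_simps)
  have "x\<^sup>\<star> * ((1 - p) * ((1 - p) * x)) = - (q * ((1 + q) * (1 + q)))"
  proof -
    have "(1 - p) * ((1 - p) * x) = x * ((1 + q) * (1 + q))"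
      by (metis shift mult.assoc)
    then have "x\<^sup>\<star> * ((1 - p) * ((1 - p) * x)) = (x\<^sup>\<star> * x) * ((1 + q) * (1 + q))"
      by (simp only: mult.assoc)
    also have "x\<^sup>\<star> * x = - q" by (simp add: q_def)
    finally show ?thesis by simp
  qed
  then have A: "norm (q * ((1 + q) * (1 + q))) \<le> 1"
  proof -
    assume e: "x\<^sup>\<star> * ((1 - p) * ((1 - p) * x)) = - (q * ((1 + q) * (1 + q)))"
    have "norm (u * v) \<le> 1" if "norm u \<le> 1" "norm v \<le> 1" for u v :: 'a
      using norm_mult_ineq[of u v] that mult_le_one[of "norm u" "norm v"] by simp
    then have "norm (x\<^sup>\<star> * ((1 - p) * ((1 - p) * x))) \<le> 1" using p1 nx by simp
    then show ?thesis unfolding e by simp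
  qed
  have B: "norm (q * ((1 - q) * (1 - q))) \<le> 1"
  proof -
    have "norm (u * v) \<le> 1" if "norm u \<le> 1" "norm v \<le> 1" for u v :: 'a
      using norm_mult_ineq[of u v] that mult_le_one[of "norm u" "norm v"] by simp
    then show ?thesis using q1 nq by simp
  qed
  have "4 *\<^sub>R (q * q) = q * ((1 + q) * (1 + q)) - q * ((1 - q) * (1 - q))"
    by (simp add: algebra_simps scaleR_4)
  moreover have "norm (q * ((1 + q) * (1 + q)) - q * ((1 - q) * (1 - q))) \<le> 1 + 1"
    by (rule order_trans[OF norm_triangle_ineq4 add_mono[OF A B]])
  ultimately have "norm (4 *\<^sub>R (q * q)) \<le> 1 + 1" by (simp only:)
  then have "4 * norm (q * q) \<le> 1 + 1" by simp
  then show False using norm_selfadjoint_square[OF qs] nq by simp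
qed

lemma star_mult_self_positive: "(x::'a::unital_cstar_algebra)\<^sup>\<star> * x \<in> positive_cone"
proof -
  have "(x\<^sup>\<star> * x)\<^sup>\<star> = x\<^sup>\<star> * x" by (simp add: star_mult star_star)
  then obtain w g where w: "w\<^sup>\<star> = w" "g\<^sup>\<star> = g" "w * (x\<^sup>\<star> * x) * w = - (g * g)" "g = 0 \<Longrightarrow> x\<^sup>\<star> * x \<in> positive_cone"
    using negative_part[of "x\<^sup>\<star> * x"] by metis
  have e: "(x * w)\<^sup>\<star> * (x * w) = - (g * g)" using w by (simp add: star_mult mult.assoc)
  then have "x * w = 0"
    using star_mult_self_nonpositive[of "x * w"] square_positive[OF w(2)] by simp
  then have "g * g = 0" using e by simp
  then show ?thesis using w selfadjoint_square_eq_0 by blast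
qed

section \<open>Sublinear functionals and the Hahn--Banach theorem\<close>

definition sublinear :: "('a::real_vector \<Rightarrow> real) \<Rightarrow> bool" where
  "sublinear p \<longleftrightarrow> (\<forall>x y. p (x + y) \<le> p x + p y) \<and> (\<forall>c x. c \<ge> 0 \<longrightarrow> p (c *\<^sub>R x) = c * p x)"

lemma sublinearI:
  fixes p :: "'a::real_vector \<Rightarrow> real"
  assumes add: "\<And>x y. p (x + y) \<le> p x + p y" and scale: "\<And>c x. c > 0 \<Longrightarrow> p (c *\<^sub>R x) \<le> c * p x"
    and zero: "p 0 = 0"
  shows "sublinear p"
proof -
  have "p (c *\<^sub>R x) = c * p x" if "c > 0" for c x
  proof -
    have "p ((1/c) *\<^sub>R (c *\<^sub>R x)) \<le> (1/c) * p (c *\<^sub>R x)" using that by (intro scale) simp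
    then have "c * p x \<le> p (c *\<^sub>R x)" using that by (simp add: field_simps)
    then show ?thesis using scale[OF that, of x] by simp
  qed
  then have "p (c *\<^sub>R x) = c * p x" if "c \<ge> 0" for c x
    using that zero by (cases "c = 0") auto
  then show ?thesis using add by (auto simp: sublinear_def)
qed

context
  fixes p :: "'a::real_vector \<Rightarrow> real"
  assumes p: "sublinear p"
begin

lemma sublinear_add: "p (x + y) \<le> p x + p y"
  and sublinear_scale: "c \<ge> 0 \<Longrightarrow> p (c *\<^sub>R x) = c * p x"
  using p by (auto simp: sublinear_def)

lemma sublinear_zero: "p 0 = 0"
  using sublinear_scale[of 0 0] by simp

lemma sublinear_minus: "- p (- x) \<le> p x"
  using sublinear_add[of x "- x"] sublinear_zero by simp

end

text \<open>The directional modification of \<open>p\<close> along \<open>x\<close>: the largest sublinear minorant of \<open>p\<close> that is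
  linear along \<open>x\<close> with value \<open>p x\<close> at \<open>x\<close>.\<close>
definition slope :: "('a::real_vector \<Rightarrow> real) \<Rightarrow> 'a \<Rightarrow> 'a \<Rightarrow> real" where
  "slope p x y = (INF t\<in>{0..}. p (y + t *\<^sub>R x) - t * p x)"

lemma slope_bdd:
  assumes p: "sublinear p"
  shows "bdd_below ((\<lambda>t. p (y + t *\<^sub>R x) - t * p x) ` {0..})"
proof (rule bdd_belowI2)
  fix t :: real assume "t \<in> {0..}"
  then have "p (t *\<^sub>R x) = t * p x" using sublinear_scale[OF p] by simp
  then show "- p (- y) \<le> p (y + t *\<^sub>R x) - t * p x"
    using sublinear_add[OF p, of "y + t *\<^sub>R x" "- y"] by simp
qed

lemma slope_le:
  assumes p: "sublinear p" and t: "t \<ge> 0"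
  shows "slope p x y \<le> p (y + t *\<^sub>R x) - t * p x"
  unfolding slope_def using slope_bdd[OF p] t by (intro cINF_lower) auto

lemma slope_greatest:
  assumes "\<And>t. t \<ge> 0 \<Longrightarrow> m \<le> p (y + t *\<^sub>R x) - t * p x"
  shows "m \<le> slope p x y"
  unfolding slope_def using assms by (intro cINF_greatest) auto

lemma sublinear_slope:
  assumes p: "sublinear p"
  shows "sublinear (slope p x)"
proof (rule sublinearI)
  fix y z
  have *: "slope p x (y + z) \<le> (p (y + s *\<^sub>R x) - s * p x) + (p (z + t *\<^sub>R x) - t * p x)"
    if "s \<ge> 0" "t \<ge> 0" for s t
  proof -
    have "slope p x (y + z) \<le> p ((y + z) + (s + t) *\<^sub>R x) - (s + t) * p x"
      using that by (intro slope_le p) simp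
    also have "(y + z) + (s + t) *\<^sub>R x = (y + s *\<^sub>R x) + (z + t *\<^sub>R x)" by (simp add: algebra_simps)
    also have "p \<dots> \<le> p (y + s *\<^sub>R x) + p (z + t *\<^sub>R x)" by (rule sublinear_add[OF p])
    finally show ?thesis by (simp add: algebra_simps)
  qed
  have "slope p x (y + z) - (p (y + s *\<^sub>R x) - s * p x) \<le> slope p x z" if "s \<ge> 0" for s
    using *[OF that] by (intro slope_greatest) (simp add: algebra_simps)
  then have "slope p x (y + z) - slope p x z \<le> p (y + s *\<^sub>R x) - s * p x" if "s \<ge> 0" for s
    using that by (simp add: algebra_simps)
  then have "slope p x (y + z) - slope p x z \<le> slope p x y" by (rule slope_greatest)
  then show "slope p x (y + z) \<le> slope p x y + slope p x z" by simp
next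
  fix c :: real and y assume c: "c > 0"
  have "slope p x (c *\<^sub>R y) / c \<le> slope p x y"
  proof (rule slope_greatest)
    fix t :: real assume t: "t \<ge> 0"
    have "slope p x (c *\<^sub>R y) \<le> p (c *\<^sub>R y + (c * t) *\<^sub>R x) - (c * t) * p x"
      using c t by (intro slope_le p) simp
    also have "c *\<^sub>R y + (c * t) *\<^sub>R x = c *\<^sub>R (y + t *\<^sub>R x)" by (simp add: algebra_simps)
    also have "p \<dots> = c * p (y + t *\<^sub>R x)" using c by (intro sublinear_scale p) simp
    finally show "slope p x (c *\<^sub>R y) / c \<le> p (y + t *\<^sub>R x) - t * p x"
      using c by (simp add: field_simps)
  qed
  then show "slope p x (c *\<^sub>R y) \<le> c * slope p x y" using c by (simp add: field_simps)
next
  have "slope p x 0 \<le> 0" using slope_le[OF p, of 0 x 0] sublinear_zero[OF p] by simp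
  moreover have "0 \<le> slope p x 0"
    by (rule slope_greatest) (simp add: sublinear_scale[OF p])
  ultimately show "slope p x 0 = 0" by simp
qed

lemma sublinear_INF_chain:
  assumes C: "C \<noteq> {}" "\<And>q. q \<in> C \<Longrightarrow> sublinear q \<and> q \<le> p"
    and chain: "\<And>q r. q \<in> C \<Longrightarrow> r \<in> C \<Longrightarrow> q \<le> r \<or> r \<le> q"
  defines "m \<equiv> (\<lambda>x. INF q\<in>C. q x)"
  shows "sublinear m" "\<And>q. q \<in> C \<Longrightarrow> m \<le> q"
proof -
  have bdd: "bdd_below ((\<lambda>q. q x) ` C)" for x
  proof (rule bdd_belowI2)
    fix q assume "q \<in> C"
    then show "- p (- x) \<le> q x"
      using sublinear_minus[of q x] C(2)[of q] le_funD[of q p "- x"] by fastforce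
  qed
  have low: "m x \<le> q x" if "q \<in> C" for q x
    unfolding m_def using bdd that by (rule cINF_lower)
  then show "\<And>q. q \<in> C \<Longrightarrow> m \<le> q" by (simp add: le_fun_def)
  have great: "a \<le> m x" if "\<And>q. q \<in> C \<Longrightarrow> a \<le> q x" for a x
    unfolding m_def using C(1) that by (intro cINF_greatest)
  show "sublinear m"
  proof (rule sublinearI)
    fix x y
    have *: "m (x + y) \<le> q x + r y" if qr: "q \<in> C" "r \<in> C" for q r
    proof -
      obtain s where s: "s \<in> C" "s \<le> q" "s \<le> r" using chain[OF qr] qr by blast
      have "m (x + y) \<le> s (x + y)" by (rule low[OF s(1)])
      also have "\<dots> \<le> s x + s y" using C(2)[OF s(1)] by (simp add: sublinear_add)
      also have "\<dots> \<le> q x + r y" by (rule add_mono[OF le_funD[OF s(2)] le_funD[OF s(3)]])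
      finally show ?thesis .
    qed
    have "m (x + y) - q x \<le> m y" if "q \<in> C" for q
      using *[OF that] by (intro great) (simp add: algebra_simps)
    then have "m (x + y) - m y \<le> m x" by (intro great) (simp add: algebra_simps)
    then show "m (x + y) \<le> m x + m y" by simp
  next
    fix c :: real and x assume c: "c > 0"
    have "m (c *\<^sub>R x) / c \<le> m x"
    proof (rule great)
      fix q assume q: "q \<in> C"
      have "m (c *\<^sub>R x) \<le> c * q x"
        using low[OF q, of "c *\<^sub>R x"] C(2)[OF q] c by (simp add: sublinear_scale)
      then show "m (c *\<^sub>R x) / c \<le> q x" using c by (simp add: field_simps)
    qed
    then show "m (c *\<^sub>R x) \<le> c * m x" using c by (simp add: field_simps)
  next
    show "m 0 = 0" using C by (simp add: m_def sublinear_zero cong: INF_cong_simp)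
  qed
qed

text \<open>A minimal sublinear minorant equals all its directional modifications, hence is additive.\<close>
lemma hahn_banach_sublinear:
  fixes p :: "'a::real_vector \<Rightarrow> real"
  assumes p: "sublinear p"
  obtains f where "linear f" "\<And>x. f x \<le> p x"
proof -
  define A where "A = {q. sublinear q \<and> q \<le> p}"
  define P where "P = (\<lambda>q r. r \<le> (q :: 'a \<Rightarrow> real))"
  have "\<exists>m\<in>A. \<forall>q\<in>A. P m q \<longrightarrow> q = m"
  proof (rule predicate_Zorn)
    show "partial_order_on A (relation_of P A)"
      by (auto simp: P_def partial_order_on_def preorder_on_def refl_on_def trans_def antisym_def relation_of_def)
    fix C assume "C \<in> Chains (relation_of P A)"
    then have C: "C \<subseteq> A" "\<And>q r. q \<in> C \<Longrightarrow> r \<in> C \<Longrightarrow> q \<le> r \<or> r \<le> q"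
      by (auto simp: Chains_def relation_of_def P_def)
    show "\<exists>u\<in>A. \<forall>q\<in>C. P q u"
    proof (cases "C = {}")
      case True
      then show ?thesis using p by (auto simp: A_def)
    next
      case False
      have C': "\<And>q. q \<in> C \<Longrightarrow> sublinear q \<and> q \<le> p" using C(1) by (auto simp: A_def)
      note m = sublinear_INF_chain[OF False C' C(2)]
      show ?thesis
      proof (rule bexI)
        show "\<forall>q\<in>C. P q (\<lambda>x. INF q\<in>C. q x)" using m(2) by (auto simp: P_def)
        obtain q where "q \<in> C" using False by blast
        then show "(\<lambda>x. INF q\<in>C. q x) \<in> A" using m C' order_trans unfolding A_def by blast
      qed
    qed
  qed
  then obtain q where q: "q \<in> A" and min: "\<And>r. r \<in> A \<Longrightarrow> r \<le> q \<Longrightarrow> r = q" by (auto simp: P_def)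
  have sq: "sublinear q" "q \<le> p" using q by (auto simp: A_def)
  have "slope q x = q" for x
  proof (rule min)
    have "slope q x y \<le> q y" for y using slope_le[OF sq(1), of 0 x y] by simp
    then show "slope q x \<le> q" by (simp add: le_fun_def)
    then show "slope q x \<in> A" using sq sublinear_slope order_trans unfolding A_def by blast
  qed
  then have "q x + q y \<le> q (x + y)" for x y
    using slope_le[OF sq(1), of 1 x y] by (simp add: algebra_simps)
  then have add: "q (x + y) = q x + q y" for x y
    using sublinear_add[OF sq(1), of x y] by (simp add: antisym)
  have neg: "q (- x) = - q x" for x using add[of x "- x"] sublinear_zero[OF sq(1)] by simp
  have "q (c *\<^sub>R x) = c * q x" for c x
  proof (cases "c \<ge> 0")
    case False
    then have "q ((- c) *\<^sub>R x) = (- c) * q x" by (intro sublinear_scale sq) simp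
    then show ?thesis by (simp add: neg)
  qed (simp add: sublinear_scale sq)
  then have "linear q" using add by (intro linearI) auto
  then show ?thesis using that sq le_funD by metis
qed

lemma hahn_banach_attained:
  fixes p :: "'a::real_vector \<Rightarrow> real"
  assumes p: "sublinear p"
  obtains f where "linear f" "\<And>x. f x \<le> p x" "f b = p b"
proof -
  obtain f where f: "linear f" "\<And>x. f x \<le> slope p b x"
    using hahn_banach_sublinear[OF sublinear_slope[OF p]] by metis
  have le: "f x \<le> p x" for x
    using f(2)[of x] slope_le[OF p, of 0 b x] by simp
  have "f (- b) \<le> - p b"
    using f(2)[of "- b"] slope_le[OF p, of 1 b "- b"] by (simp add: sublinear_zero[OF p])
  then have "f b = p b" using le[of b] linear_neg[OF f(1), of b] by simp
  with f le that show ?thesis by metis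
qed

section \<open>Positive functionals\<close>

text \<open>The order-unit gauge of the real part of \<open>x\<close>.\<close>
definition upper_gauge :: "'a::unital_cstar_algebra \<Rightarrow> real" where
  "upper_gauge x = Inf {t. t *\<^sub>R 1 - (1/2) *\<^sub>R (x + x\<^sup>\<star>) \<in> positive_cone}"

lemma scalar_positiveD: "t *\<^sub>R (1::'a::unital_cstar_algebra) \<in> positive_cone \<Longrightarrow> 0 \<le> t"
  using positive_norm_bound[of "0::'a" t] scalar_positive[of 0] by simp

text \<open>The infimum defining the gauge is over a set bounded below.\<close>
lemma upper_gauge_set_lower:
  assumes "t *\<^sub>R 1 - (1/2) *\<^sub>R (x + x\<^sup>\<star>) \<in> positive_cone"
  shows "- norm (x::'a::unital_cstar_algebra) \<le> t"
proof -
  have "norm (x + x\<^sup>\<star>) \<le> norm x + norm x" using norm_triangle_ineq[of x "x\<^sup>\<star>"] by simp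
  then have "norm x *\<^sub>R 1 - (- ((1/2) *\<^sub>R (x + x\<^sup>\<star>))) \<in> positive_cone"
    by (intro norm_diff_selfadjoint_positive) (simp_all add: star_minus star_scaleR star_add star_star add.commute)
  from positive_add[OF assms this] have "(t + norm x) *\<^sub>R (1::'a) \<in> positive_cone"
    by (simp add: algebra_simps)
  then show ?thesis using scalar_positiveD by fastforce
qed

lemma upper_gauge_le:
  "t *\<^sub>R 1 - (1/2) *\<^sub>R (x + x\<^sup>\<star>) \<in> positive_cone \<Longrightarrow> upper_gauge x \<le> t"
  unfolding upper_gauge_def
  by (rule cInf_lower) (auto intro: bdd_belowI upper_gauge_set_lower)

lemma upper_gauge_norm: 
  "norm x *\<^sub>R 1 - (1/2) *\<^sub>R (x + x\<^sup>\<star>) \<in> (positive_cone::'a::unital_cstar_algebra set)"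
proof (rule norm_diff_selfadjoint_positive)
  have "norm (x + x\<^sup>\<star>) \<le> norm x + norm x" using norm_triangle_ineq[of x "x\<^sup>\<star>"] by simp
  then show "norm ((1 / 2) *\<^sub>R (x + x\<^sup>\<star>)) \<le> norm x" by simp
qed (simp add: star_scaleR star_add star_star add.commute)

lemma upper_gauge_greatest:
  fixes x :: "'a::unital_cstar_algebra"
  assumes "\<And>t. t *\<^sub>R 1 - (1/2) *\<^sub>R (x + x\<^sup>\<star>) \<in> positive_cone \<Longrightarrow> a \<le> t"
  shows "a \<le> upper_gauge x"
  unfolding upper_gauge_def using upper_gauge_norm[of x] assms by (intro cInf_greatest) auto

lemma sublinear_upper_gauge: "sublinear (upper_gauge :: 'a::unital_cstar_algebra \<Rightarrow> real)"
proof (rule sublinearI)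
  fix x y :: 'a
  let ?S = "\<lambda>x t. t *\<^sub>R 1 - (1/2) *\<^sub>R (x + x\<^sup>\<star>) \<in> (positive_cone::'a set)"
  have *: "upper_gauge (x + y) \<le> s + t" if "?S x s" "?S y t" for s t
  proof (rule upper_gauge_le)
    show "?S (x + y) (s + t)" using positive_add[OF that] by (simp add: star_add algebra_simps)
  qed
  have "upper_gauge (x + y) - s \<le> upper_gauge y" if "?S x s" for s
    using *[OF that] by (intro upper_gauge_greatest) (simp add: algebra_simps)
  then have "upper_gauge (x + y) - upper_gauge y \<le> s" if "?S x s" for s
    using that by (simp add: algebra_simps)
  then have "upper_gauge (x + y) - upper_gauge y \<le> upper_gauge x" by (rule upper_gauge_greatest)
  then show "upper_gauge (x + y) \<le> upper_gauge x + upper_gauge y" by simp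
next
  fix c :: real and x :: 'a assume c: "c > 0"
  have "upper_gauge (c *\<^sub>R x) / c \<le> upper_gauge x"
  proof (rule upper_gauge_greatest)
    fix t assume t: "t *\<^sub>R 1 - (1/2) *\<^sub>R (x + x\<^sup>\<star>) \<in> positive_cone"
    have "upper_gauge (c *\<^sub>R x) \<le> c * t"
    proof (rule upper_gauge_le)
      have "(c * t) *\<^sub>R 1 - (1/2) *\<^sub>R (c *\<^sub>R x + (c *\<^sub>R x)\<^sup>\<star>) = c *\<^sub>R (t *\<^sub>R 1 - (1/2) *\<^sub>R (x + x\<^sup>\<star>))"
        by (simp add: star_scaleR algebra_simps)
      then show "(c * t) *\<^sub>R 1 - (1/2) *\<^sub>R (c *\<^sub>R x + (c *\<^sub>R x)\<^sup>\<star>) \<in> positive_cone"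
        using positive_scaleR[OF t] c by simp
    qed
    then show "upper_gauge (c *\<^sub>R x) / c \<le> t" using c by (simp add: field_simps)
  qed
  then show "upper_gauge (c *\<^sub>R x) \<le> c * upper_gauge x" using c by (simp add: field_simps)
next
  have "upper_gauge (0::'a) \<le> 0" using scalar_positive[of 0, where ?'a = 'a] by (intro upper_gauge_le) simp
  moreover have "0 \<le> upper_gauge (0::'a)" by (rule upper_gauge_greatest) (simp add: scalar_positiveD)
  ultimately show "upper_gauge (0::'a) = 0" by simp
qed

text \<open>Real parts of positive functionals.\<close>
definition positive_real_functional :: "('a::unital_cstar_algebra \<Rightarrow> real) \<Rightarrow> bool" where
  "positive_real_functional f \<longleftrightarrow> linear f \<and> (\<forall>h\<in>positive_cone. 0 \<le> f h) \<and>
     (\<forall>h. h\<^sup>\<star> = h \<longrightarrow> f (\<i> *\<^sub>C h) = 0)"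

lemma exists_positive_functional:
  fixes b :: "'a::unital_cstar_algebra"
  assumes b: "b \<in> positive_cone"
  obtains f where "positive_real_functional f" "\<And>x. \<bar>f x\<bar> \<le> norm x" "norm b \<le> 2 * f b"
proof -
  obtain f where f: "linear f" "\<And>x. f x \<le> upper_gauge x" "f b = upper_gauge b"
    using hahn_banach_attained[OF sublinear_upper_gauge, of b] by metis
  have half: "(1/2) *\<^sub>R (h + h) = h" for h :: 'a by (simp flip: scaleR_2)
  have pos: "0 \<le> f h" if h: "h \<in> positive_cone" for h
  proof -
    have "0 *\<^sub>R 1 - (1/2) *\<^sub>R (- h + (- h)\<^sup>\<star>) = (1/2) *\<^sub>R (h + h)"
      using positive_selfadjoint[OF h] by (simp add: star_minus flip: scaleR_minus_right)
    then have "upper_gauge (- h) \<le> 0"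
      using h half[of h] by (intro upper_gauge_le) simp
    then show ?thesis using f(2)[of "- h"] linear_neg[OF f(1), of h] by simp
  qed
  have im: "f (\<i> *\<^sub>C h) \<le> 0" if h: "h\<^sup>\<star> = h" for h
  proof -
    have "upper_gauge (\<i> *\<^sub>C h) \<le> 0"
      using scalar_positive[of 0, where ?'a = 'a]
      by (intro upper_gauge_le) (simp add: star_scaleC h scaleC_minus_left)
    then show ?thesis using f(2) order_trans by blast
  qed
  have im0: "f (\<i> *\<^sub>C h) = 0" if h: "h\<^sup>\<star> = h" for h
    using im[OF h] im[of "- h"] h linear_neg[OF f(1), of "\<i> *\<^sub>C h"] by (simp add: star_minus scaleC_minus_right)
  have le: "f x \<le> norm x" for x
    using f(2)[of x] upper_gauge_le[OF upper_gauge_norm, of x] by simp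
  have "norm b / 2 \<le> upper_gauge b"
  proof (rule upper_gauge_greatest)
    fix t assume "t *\<^sub>R 1 - (1/2) *\<^sub>R (b + b\<^sup>\<star>) \<in> positive_cone"
    then have "norm b \<le> 2 * t"
      using half[of b] positive_selfadjoint[OF b] positive_norm_bound[OF b, of t] by simp
    then show "norm b / 2 \<le> t" by simp
  qed
  moreover have "\<bar>f x\<bar> \<le> norm x" for x using le[of x] le[of "- x"] linear_neg[OF f(1), of x] by simp
  ultimately show ?thesis using f pos im0 by (intro that[of f]) (auto simp: positive_real_functional_def)
qed

text \<open>For a dense sequence \<open>a\<close>, the functional \<open>f n\<close> attains at least half the norm of
  \<open>(a n)\<^sup>\<star> a n\<close>. The weights \<open>2\<^sup>-\<^sup>n\<close> make their sum converge.\<close>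
lemma exists_faithful_functional:
  assumes sep: "separable_space (euclidean :: 'a::unital_cstar_algebra topology)"
  obtains f :: "'a::unital_cstar_algebra \<Rightarrow> real" where "positive_real_functional f" "\<And>x. \<bar>f x\<bar> \<le> 2 * norm x"
    "\<And>x. x \<noteq> 0 \<Longrightarrow> 0 < f (x\<^sup>\<star> * x)"
proof -
  obtain D :: "'a set" where D: "countable D" "closure D = UNIV"
    using sep by (auto simp: separable_space_def)
  then have ne: "D \<noteq> {}" by auto
  define a where "a = from_nat_into D"
  have ra: "range a = D" unfolding a_def using range_from_nat_into[OF ne D(1)] .
  have "\<forall>n. \<exists>f. positive_real_functional f \<and> (\<forall>x. \<bar>f x\<bar> \<le> norm x) \<and> norm ((a n)\<^sup>\<star> * a n) \<le> 2 * f ((a n)\<^sup>\<star> * a n)"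
    using exists_positive_functional[OF star_mult_self_positive] by metis
  then obtain f where f: "\<And>n. positive_real_functional (f n)" "\<And>n x. \<bar>f n x\<bar> \<le> norm x"
    "\<And>n. norm ((a n)\<^sup>\<star> * a n) \<le> 2 * f n ((a n)\<^sup>\<star> * a n)" by metis
  have lin: "linear (f n)" for n using f(1) by (simp add: positive_real_functional_def)
  define F where "F = (\<lambda>x. \<Sum>n. (1/2)^n * f n x)"
  have geo: "summable (\<lambda>n. (1/2::real)^n * c)" for c by (intro summable_mult2 summable_geometric) simp
  have sumb: "summable (\<lambda>n. (1/2)^n * f n x)" for x
    by (rule summable_comparison_test'[OF geo[of "norm x"], of 0]) (use f(2) in \<open>simp add: abs_mult\<close>)
  have linF: "linear F"
  proof (rule linearI)
    show "F (x + y) = F x + F y" for x y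
      unfolding F_def by (subst suminf_add[OF sumb sumb]) (simp add: linear_add[OF lin] algebra_simps)
    show "F (c *\<^sub>R x) = c *\<^sub>R F x" for c x
      unfolding F_def using suminf_mult[OF sumb, of c x] by (simp add: linear_scale[OF lin] algebra_simps)
  qed
  have posF: "0 \<le> F h" if "h \<in> positive_cone" for h
    unfolding F_def using f(1) that
    by (intro suminf_nonneg sumb) (auto simp: positive_real_functional_def)
  have imF: "F (\<i> *\<^sub>C h) = 0" if "h\<^sup>\<star> = h" for h
    unfolding F_def using f(1) that by (simp add: positive_real_functional_def)
  have le: "F x \<le> 2 * norm x" for x
  proof -
    have "F x \<le> (\<Sum>n. (1/2)^n * norm x)"
      unfolding F_def using f(2) by (intro suminf_le sumb geo mult_left_mono) (auto intro: abs_le_D1)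
    also have "\<dots> = 2 * norm x"
      using suminf_mult2[OF summable_geometric, of "1/2::real" "norm x"] by (simp add: suminf_geometric)
    finally show ?thesis .
  qed
  have bnd: "\<bar>F x\<bar> \<le> 2 * norm x" for x using le[of x] le[of "- x"] linear_neg[OF linF, of x] by simp
  have faith: "0 < F (x\<^sup>\<star> * x)" if "x \<noteq> 0" for x
  proof -
    define N where "N = norm (x\<^sup>\<star> * x)"
    have N: "N > 0" using that by (simp add: N_def cstar_identity)
    \<comment> \<open>near \<open>x\<close>, the functional for \<open>a n\<close> is still positive at \<open>x\<^sup>\<star> x\<close>\<close>
    define U where "U = {y. norm (x\<^sup>\<star> * x - y\<^sup>\<star> * y) < N / 4}"
    have "open U"
    proof -
      have "continuous_on UNIV (\<lambda>y. norm (x\<^sup>\<star> * x - y\<^sup>\<star> * y))"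
        by (intro continuous_intros linear_continuous_on bounded_linear_star)
      then show ?thesis unfolding U_def using open_Collect_less[of "\<lambda>y. norm (x\<^sup>\<star> * x - y\<^sup>\<star> * y)" "\<lambda>_. N / 4"] by simp
    qed
    moreover have "x \<in> U" using N by (simp add: U_def)
    ultimately have "U \<inter> D \<noteq> {}"
      using open_Int_closure_eq_empty[of U D] D(2) by auto
    then obtain n where n: "norm (x\<^sup>\<star> * x - (a n)\<^sup>\<star> * a n) < N / 4" using ra by (auto simp: U_def)
    let ?b = "(a n)\<^sup>\<star> * a n"
    have "\<bar>f n (x\<^sup>\<star> * x - ?b)\<bar> < N / 4" using f(2)[of n "x\<^sup>\<star> * x - ?b"] n by simp
    then have "\<bar>f n (x\<^sup>\<star> * x) - f n ?b\<bar> < N / 4" by (simp add: linear_diff[OF lin])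
    moreover have "N - N / 4 \<le> norm ?b" using n norm_triangle_ineq2[of "x\<^sup>\<star> * x" ?b] by (simp add: N_def)
    ultimately have "0 < f n (x\<^sup>\<star> * x)" using f(3)[of n] N by linarith
    moreover have "0 \<le> (1/2)^m * f m (x\<^sup>\<star> * x)" for m
      using f(1)[of m] star_mult_self_positive[of x] by (simp add: positive_real_functional_def)
    ultimately show ?thesis unfolding F_def
      by (intro suminf_pos2[OF sumb, where i = n]) auto
  qed
  show ?thesis
    using that[of F] linF posF imF bnd faith by (simp add: positive_real_functional_def)
qed

section \<open>The Hilbert space of square-summable sequences\<close>

text \<open>Square-summable sequences, with inner product linear in the first argument. The values of \<open>ip\<close> and
  \<open>l2norm\<close> are meaningful on \<open>l2\<close> only.\<close>
definition l2 :: "(nat \<Rightarrow> complex) set" where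
  "l2 = {x. summable (\<lambda>n. (cmod (x n))\<^sup>2)}"

definition ip :: "(nat \<Rightarrow> complex) \<Rightarrow> (nat \<Rightarrow> complex) \<Rightarrow> complex" where
  "ip x y = (\<Sum>n. x n * cnj (y n))"

definition l2norm :: "(nat \<Rightarrow> complex) \<Rightarrow> real" where
  "l2norm x = sqrt (\<Sum>n. (cmod (x n))\<^sup>2)"

definition unit_vec :: "nat \<Rightarrow> nat \<Rightarrow> complex" where
  "unit_vec j = (\<lambda>n. if n = j then 1 else 0)"

lemma l2_summable: "x \<in> l2 \<Longrightarrow> summable (\<lambda>n. (cmod (x n))\<^sup>2)"
  by (simp add: l2_def)


lemma l2norm_nonneg: "x \<in> l2 \<Longrightarrow> 0 \<le> l2norm x"
  by (simp add: l2norm_def l2_def suminf_nonneg)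

lemma l2norm_square: "x \<in> l2 \<Longrightarrow> (l2norm x)\<^sup>2 = (\<Sum>n. (cmod (x n))\<^sup>2)"
  by (simp add: l2norm_def l2_def suminf_nonneg)

lemma l2_sum_le: "x \<in> l2 \<Longrightarrow> (\<Sum>k<n. (cmod (x k))\<^sup>2) \<le> (l2norm x)\<^sup>2"
  by (simp add: l2norm_square sum_le_suminf l2_summable)

lemma L2_set_le_l2norm: "x \<in> l2 \<Longrightarrow> L2_set (\<lambda>k. cmod (x k)) {..<n} \<le> l2norm x"
  unfolding L2_set_def by (intro real_le_lsqrt l2norm_nonneg l2_sum_le sum_nonneg) auto

lemma component_le_l2norm:
  assumes "x \<in> l2"
  shows "cmod (x k) \<le> l2norm x"
proof -
  have "(cmod (x k))\<^sup>2 \<le> (\<Sum>i<Suc k. (cmod (x i))\<^sup>2)" by (simp add: sum_nonneg)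
  also have "\<dots> \<le> (l2norm x)\<^sup>2" by (rule l2_sum_le[OF assms])
  finally show ?thesis using l2norm_nonneg[OF assms] by (rule power2_le_imp_le)
qed

lemma l2I:
  assumes K: "K \<ge> 0" and le: "\<And>n. (\<Sum>k<n. (cmod (x k))\<^sup>2) \<le> K\<^sup>2"
  shows "x \<in> l2" "l2norm x \<le> K"
proof -
  have s: "summable (\<lambda>n. (cmod (x n))\<^sup>2)"
    by (rule summableI_nonneg_bounded[of _ "K\<^sup>2"]) (use le in auto)
  then show "x \<in> l2" by (simp add: l2_def)
  have "(\<Sum>n. (cmod (x n))\<^sup>2) \<le> K\<^sup>2" by (rule suminf_le_const[OF s le])
  then show "l2norm x \<le> K" unfolding l2norm_def using K by (simp add: real_le_lsqrt)
qed

lemma l2_add: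
  assumes x: "x \<in> l2" and y: "y \<in> l2"
  shows "(\<lambda>n. x n + y n) \<in> l2" "l2norm (\<lambda>n. x n + y n) \<le> l2norm x + l2norm y"
proof -
  have "(\<Sum>k<n. (cmod (x k + y k))\<^sup>2) \<le> (l2norm x + l2norm y)\<^sup>2" for n
  proof -
    have "L2_set (\<lambda>k. cmod (x k + y k)) {..<n} \<le> L2_set (\<lambda>k. cmod (x k) + cmod (y k)) {..<n}"
      by (intro L2_set_mono norm_triangle_ineq) auto
    also have "\<dots> \<le> L2_set (\<lambda>k. cmod (x k)) {..<n} + L2_set (\<lambda>k. cmod (y k)) {..<n}"
      by (rule L2_set_triangle_ineq)
    also have "\<dots> \<le> l2norm x + l2norm y" by (intro add_mono L2_set_le_l2norm x y)
    finally have "(L2_set (\<lambda>k. cmod (x k + y k)) {..<n})\<^sup>2 \<le> (l2norm x + l2norm y)\<^sup>2"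
      by (intro power_mono) auto
    then show ?thesis by (simp add: L2_set_def sum_nonneg)
  qed
  then show "(\<lambda>n. x n + y n) \<in> l2" "l2norm (\<lambda>n. x n + y n) \<le> l2norm x + l2norm y"
    using l2I[of "l2norm x + l2norm y" "\<lambda>n. x n + y n"] l2norm_nonneg x y by auto
qed

lemma l2_scale: "x \<in> l2 \<Longrightarrow> (\<lambda>n. c * x n) \<in> l2"
  by (simp add: l2_def norm_mult power_mult_distrib summable_mult)

lemma l2norm_scale: "x \<in> l2 \<Longrightarrow> l2norm (\<lambda>n. c * x n) = cmod c * l2norm x"
  by (simp add: l2norm_def norm_mult power_mult_distrib suminf_mult l2_summable real_sqrt_mult)

lemma l2_zero: "(\<lambda>n. 0) \<in> l2"
  by (simp add: l2_def)

lemma l2norm_zero [simp]: "l2norm (\<lambda>n. 0) = 0"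
  by (simp add: l2norm_def)

lemma l2_diff: "x \<in> l2 \<Longrightarrow> y \<in> l2 \<Longrightarrow> (\<lambda>n. x n - y n) \<in> l2"
  using l2_add(1)[of x "\<lambda>n. (-1) * y n"] l2_scale[of y "-1"] by simp

lemma l2norm_diff: "x \<in> l2 \<Longrightarrow> y \<in> l2 \<Longrightarrow> l2norm (\<lambda>n. x n - y n) \<le> l2norm x + l2norm y"
  using l2_add(2)[of x "\<lambda>n. (-1) * y n"] l2_scale[of y "-1"] l2norm_scale[of y "-1"] by simp

lemma l2_sum:
  assumes "\<And>m. v m \<in> l2"
  shows "(\<lambda>n. \<Sum>m<(M::nat). c m * v m n) \<in> l2"
proof (induction M)
  case (Suc M)
  then show ?case
    using l2_add(1)[of "\<lambda>n. \<Sum>m<M. c m * v m n" "\<lambda>n. c M * v M n"] l2_scale[OF assms] by simp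
qed (simp add: l2_zero)

lemma ip_abs_summable:
  assumes x: "x \<in> l2" and y: "y \<in> l2"
  shows "summable (\<lambda>n. cmod (x n) * cmod (y n))" "(\<Sum>n. cmod (x n) * cmod (y n)) \<le> l2norm x * l2norm y"
proof -
  have le: "(\<Sum>k<n. cmod (x k) * cmod (y k)) \<le> l2norm x * l2norm y" for n
  proof -
    have "(\<Sum>k<n. cmod (x k) * cmod (y k)) \<le> L2_set (\<lambda>k. cmod (x k)) {..<n} * L2_set (\<lambda>k. cmod (y k)) {..<n}"
      using L2_set_mult_ineq[of "\<lambda>k. cmod (x k)" "\<lambda>k. cmod (y k)" "{..<n}"] by simp
    also have "\<dots> \<le> l2norm x * l2norm y"
      by (intro mult_mono L2_set_le_l2norm x y l2norm_nonneg L2_set_nonneg)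
    finally show ?thesis .
  qed
  show s: "summable (\<lambda>n. cmod (x n) * cmod (y n))"
    by (rule summableI_nonneg_bounded[OF _ le]) simp
  show "(\<Sum>n. cmod (x n) * cmod (y n)) \<le> l2norm x * l2norm y"
    by (rule suminf_le_const[OF s le])
qed

lemma ip_summable:
  assumes "x \<in> l2" "y \<in> l2"
  shows "summable (\<lambda>n. x n * cnj (y n))"
  by (rule summable_norm_cancel) (use ip_abs_summable(1)[OF assms] in \<open>simp add: norm_mult\<close>)

lemma ip_Cauchy_Schwarz:
  assumes "x \<in> l2" "y \<in> l2"
  shows "cmod (ip x y) \<le> l2norm x * l2norm y"
proof -
  have "cmod (ip x y) \<le> (\<Sum>n. cmod (x n) * cmod (y n))"
    unfolding ip_def using summable_norm[of "\<lambda>n. x n * cnj (y n)"] ip_abs_summable(1)[OF assms]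
    by (simp add: norm_mult)
  then show ?thesis using ip_abs_summable(2)[OF assms] by simp
qed

lemma ip_add_left: "\<lbrakk>x \<in> l2; y \<in> l2; z \<in> l2\<rbrakk> \<Longrightarrow> ip (\<lambda>n. x n + y n) z = ip x z + ip y z"
  unfolding ip_def using suminf_add[OF ip_summable[of x z] ip_summable[of y z]] by (simp add: algebra_simps)

lemma ip_scale_left: "\<lbrakk>x \<in> l2; y \<in> l2\<rbrakk> \<Longrightarrow> ip (\<lambda>n. c * x n) y = c * ip x y"
  unfolding ip_def using suminf_mult[OF ip_summable[of x y], of c] by (simp add: algebra_simps)

lemma ip_commute: "\<lbrakk>x \<in> l2; y \<in> l2\<rbrakk> \<Longrightarrow> ip y x = cnj (ip x y)"
proof -
  assume "x \<in> l2" "y \<in> l2"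
  then have "(\<lambda>n. x n * cnj (y n)) sums ip x y"
    unfolding ip_def by (intro summable_sums ip_summable)
  then have "(\<lambda>n. cnj (x n * cnj (y n))) sums cnj (ip x y)" by (simp only: sums_cnj)
  then show ?thesis unfolding ip_def by (simp add: sums_iff mult.commute)
qed

lemma ip_diff_left: "\<lbrakk>x \<in> l2; y \<in> l2; z \<in> l2\<rbrakk> \<Longrightarrow> ip (\<lambda>n. x n - y n) z = ip x z - ip y z"
  using ip_add_left[of x "\<lambda>n. (-1) * y n" z] ip_scale_left[of y z "-1"] l2_scale[of y "-1"] by simp

lemma ip_add_right:
  assumes "x \<in> l2" "y \<in> l2" "z \<in> l2"
  shows "ip z (\<lambda>n. x n + y n) = ip z x + ip z y"
  using assms ip_commute[of "\<lambda>n. x n + y n" z] ip_commute[of x z] ip_commute[of y z]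
  by (simp add: ip_add_left l2_add)

lemma ip_scale_right:
  assumes "x \<in> l2" "y \<in> l2"
  shows "ip y (\<lambda>n. c * x n) = cnj c * ip y x"
  using assms ip_commute[of "\<lambda>n. c * x n" y] ip_commute[of x y] by (simp add: ip_scale_left l2_scale)

lemma ip_diff_right:
  assumes "x \<in> l2" "y \<in> l2" "z \<in> l2"
  shows "ip z (\<lambda>n. x n - y n) = ip z x - ip z y"
  using assms ip_commute[of "\<lambda>n. x n - y n" z] ip_commute[of x z] ip_commute[of y z]
  by (simp add: ip_diff_left l2_diff)

lemma ip_sum_left:
  assumes z: "z \<in> l2" and v: "\<And>m. v m \<in> l2"
  shows "ip (\<lambda>n. \<Sum>m<(M::nat). c m * v m n) z = (\<Sum>m<M. c m * ip (v m) z)"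
proof (induction M)
  case (Suc M)
  then show ?case
    using ip_add_left[of "\<lambda>n. \<Sum>m<M. c m * v m n" "\<lambda>n. c M * v M n" z] l2_sum[of v c M] l2_scale[of "v M" "c M"]
    by (simp add: ip_scale_left v z)
qed (simp add: ip_def)

lemma ip_sum_right:
  assumes z: "z \<in> l2" and v: "\<And>m. v m \<in> l2"
  shows "ip z (\<lambda>n. \<Sum>m<(M::nat). c m * v m n) = (\<Sum>m<M. cnj (c m) * ip z (v m))"
proof -
  have "ip z (\<lambda>n. \<Sum>m<M. c m * v m n) = cnj (ip (\<lambda>n. \<Sum>m<M. c m * v m n) z)"
    by (rule ip_commute[OF l2_sum[OF v] z])
  also have "\<dots> = cnj (\<Sum>m<M. c m * ip (v m) z)" by (simp only: ip_sum_left[OF z v])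
  also have "\<dots> = (\<Sum>m<M. cnj (c m) * ip z (v m))"
    by (simp add: ip_commute[OF v z])
  finally show ?thesis .
qed

lemma ip_self: "x \<in> l2 \<Longrightarrow> ip x x = of_real ((l2norm x)\<^sup>2)"
  unfolding l2norm_square ip_def complex_norm_square[symmetric]
  by (simp add: suminf_of_real l2_summable)

lemma unit_vec_l2: "unit_vec j \<in> l2"
proof -
  have "(\<lambda>n. (cmod (unit_vec j n))\<^sup>2) sums (\<Sum>n\<in>{j}. (cmod (unit_vec j n))\<^sup>2)"
    by (rule sums_finite) (auto simp: unit_vec_def)
  then show ?thesis by (auto simp: l2_def summable_def)
qed

lemma ip_unit_vec: "ip x (unit_vec j) = x j"
proof -
  have "(\<lambda>n. x n * cnj (unit_vec j n)) sums (\<Sum>n\<in>{j}. x n * cnj (unit_vec j n))"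
    by (rule sums_finite) (auto simp: unit_vec_def)
  then show ?thesis by (simp add: ip_def sums_iff unit_vec_def)
qed

lemma ip_unit_vec_left: "ip (unit_vec j) x = cnj (x j)"
proof -
  have "(\<lambda>n. unit_vec j n * cnj (x n)) sums (\<Sum>n\<in>{j}. unit_vec j n * cnj (x n))"
    by (rule sums_finite) (auto simp: unit_vec_def)
  then show ?thesis by (simp add: ip_def sums_iff unit_vec_def)
qed

lemma sum_unit_vec: "(\<lambda>n. \<Sum>m<M. x m * unit_vec m n) = (\<lambda>n. if n < M then x n else 0)"
  by (auto simp: unit_vec_def fun_eq_iff if_distrib cong: if_cong)

lemma l2norm_truncation:
  assumes x: "x \<in> l2"
  shows "(\<lambda>M. l2norm (\<lambda>n. x n - (\<Sum>m<M. x m * unit_vec m n))) \<longlonglongrightarrow> 0"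
proof -
  let ?f = "\<lambda>n. (cmod (x n))\<^sup>2"
  have "l2norm (\<lambda>n. x n - (\<Sum>m<M. x m * unit_vec m n)) = sqrt (suminf ?f - (\<Sum>n<M. ?f n))" for M
  proof -
    have "(\<lambda>n. ?f n - (if n \<in> {..<M} then ?f n else 0)) sums (suminf ?f - (\<Sum>n<M. ?f n))"
      by (intro sums_diff sums_If_finite_set summable_sums l2_summable x) auto
    moreover have "?f n - (if n \<in> {..<M} then ?f n else 0) = (cmod (x n - (\<Sum>m<M. x m * unit_vec m n)))\<^sup>2" for n
      using fun_cong[OF sum_unit_vec[of x M], of n] by simp
    ultimately show ?thesis unfolding l2norm_def by (simp add: sums_iff)
  qed
  moreover have "(\<lambda>M. sqrt (suminf ?f - (\<Sum>n<M. ?f n))) \<longlonglongrightarrow> sqrt (suminf ?f - suminf ?f)"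
    by (intro tendsto_intros summable_LIMSEQ l2_summable x)
  ultimately show ?thesis by simp
qed

lemma l2norm_sum_unit_vec: "l2norm (\<lambda>n. \<Sum>m<M. c m * unit_vec m n) = sqrt (\<Sum>m<M. (cmod (c m))\<^sup>2)"
proof -
  have "(\<lambda>n. (cmod (if n < M then c n else 0))\<^sup>2) sums (\<Sum>n<M. (cmod (if n < M then c n else 0))\<^sup>2)"
    by (rule sums_finite) auto
  then have "suminf (\<lambda>n. (cmod (if n < M then c n else 0))\<^sup>2) = (\<Sum>n<M. (cmod (if n < M then c n else 0))\<^sup>2)"
    by (simp add: sums_iff)
  then show ?thesis unfolding sum_unit_vec l2norm_def by simp
qed

text \<open>A bounded linear functional that vanishes on the standard basis vanishes.\<close>
lemma functional_eq_0:
  assumes x: "x \<in> l2"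
    and add: "\<And>x y. x \<in> l2 \<Longrightarrow> y \<in> l2 \<Longrightarrow> F (\<lambda>n. x n + y n) = F x + (F y :: complex)"
    and scale: "\<And>c x. x \<in> l2 \<Longrightarrow> F (\<lambda>n. c * x n) = c * F x"
    and bound: "\<And>x. x \<in> l2 \<Longrightarrow> cmod (F x) \<le> C * l2norm x"
    and basis: "\<And>m. F (unit_vec m) = 0"
  shows "F x = 0"
proof -
  have fin: "F (\<lambda>n. \<Sum>m<M. c m * unit_vec m n) = 0" for M c
  proof (induction M)
    case 0
    show ?case using bound[OF l2_zero] by simp
  next
    case (Suc M)
    then show ?case
      using add[of "\<lambda>n. \<Sum>m<M. c m * unit_vec m n" "\<lambda>n. c M * unit_vec M n"]
      by (simp add: l2_sum unit_vec_l2 l2_scale scale basis)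
  qed
  have "cmod (F x) \<le> C * l2norm (\<lambda>n. x n - (\<Sum>m<M. x m * unit_vec m n))" for M
  proof -
    let ?t = "\<lambda>n. \<Sum>m<M. x m * unit_vec m n"
    have t: "?t \<in> l2" by (intro l2_sum unit_vec_l2)
    have "F x = F (\<lambda>n. x n - ?t n)" using add[OF l2_diff[OF x t] t] fin[where M = M and c = x] by simp
    then show ?thesis using bound[OF l2_diff[OF x t]] by simp
  qed
  moreover have "(\<lambda>M. C * l2norm (\<lambda>n. x n - (\<Sum>m<M. x m * unit_vec m n))) \<longlonglongrightarrow> C * 0"
    by (intro tendsto_intros l2norm_truncation x)
  ultimately have "cmod (F x) \<le> C * 0" by (intro LIMSEQ_le_const) auto
  then show ?thesis by simp
qed

lemma l2_complete:
  assumes X: "\<And>n. X n \<in> l2"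
    and Cauchy: "\<And>e. e > 0 \<Longrightarrow> \<exists>N. \<forall>m\<ge>N. \<forall>n\<ge>N. l2norm (\<lambda>k. X m k - X n k) < e"
  shows "\<exists>L\<in>l2. (\<lambda>n. l2norm (\<lambda>k. X n k - L k)) \<longlonglongrightarrow> 0"
proof -
  have "\<exists>l. (\<lambda>n. X n k) \<longlonglongrightarrow> l" for k
  proof -
    have "Cauchy (\<lambda>n. X n k)"
    proof (rule CauchyI)
      fix e :: real assume "e > 0"
      then obtain N where N: "\<forall>m\<ge>N. \<forall>n\<ge>N. l2norm (\<lambda>k. X m k - X n k) < e" using Cauchy by blast
      have "norm (X m k - X n k) < e" if "m \<ge> N" "n \<ge> N" for m n
        using component_le_l2norm[OF l2_diff[OF X[of m] X[of n]], of k] N that by fastforce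
      then show "\<exists>M. \<forall>m\<ge>M. \<forall>n\<ge>M. norm (X m k - X n k) < e" by blast
    qed
    then show ?thesis using Cauchy_convergent convergent_def by blast
  qed
  then obtain L where L: "\<And>k. (\<lambda>n. X n k) \<longlonglongrightarrow> L k" by metis
  have close: "\<exists>N. \<forall>n\<ge>N. (\<lambda>k. X n k - L k) \<in> l2 \<and> l2norm (\<lambda>k. X n k - L k) \<le> e" if e: "e > 0" for e
  proof -
    obtain N where N: "\<forall>m\<ge>N. \<forall>n\<ge>N. l2norm (\<lambda>k. X m k - X n k) < e" using Cauchy[OF e] by blast
    have "(\<Sum>k<K. (cmod (X n k - L k))\<^sup>2) \<le> e\<^sup>2" if n: "n \<ge> N" for n K
    proof (rule LIMSEQ_le_const2)
      show "(\<lambda>m. \<Sum>k<K. (cmod (X n k - X m k))\<^sup>2) \<longlonglongrightarrow> (\<Sum>k<K. (cmod (X n k - L k))\<^sup>2)"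
        by (intro tendsto_intros L)
      have "(\<Sum>k<K. (cmod (X n k - X m k))\<^sup>2) \<le> e\<^sup>2" if "m \<ge> N" for m
      proof -
        have "(\<Sum>k<K. (cmod (X n k - X m k))\<^sup>2) \<le> (l2norm (\<lambda>k. X n k - X m k))\<^sup>2"
          using l2_sum_le[OF l2_diff[OF X X]] .
        also have "\<dots> \<le> e\<^sup>2"
          using N n that l2norm_nonneg[OF l2_diff[OF X X]] by (intro power_mono) (auto simp: less_imp_le)
        finally show ?thesis .
      qed
      then show "\<exists>N. \<forall>m\<ge>N. (\<Sum>k<K. (cmod (X n k - X m k))\<^sup>2) \<le> e\<^sup>2"
        by (intro exI[of _ N] allI impI)
    qed
    then have "(\<lambda>k. X n k - L k) \<in> l2 \<and> l2norm (\<lambda>k. X n k - L k) \<le> e" if "n \<ge> N" for n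
      using l2I[of e "\<lambda>k. X n k - L k"] e that by simp
    then show ?thesis by (intro exI[of _ N] allI impI)
  qed
  obtain N where "\<forall>n\<ge>N. (\<lambda>k. X n k - L k) \<in> l2 \<and> l2norm (\<lambda>k. X n k - L k) \<le> 1"
    using close[OF zero_less_one] by (rule exE)
  then have N: "(\<lambda>k. X N k - L k) \<in> l2" by simp
  have L2: "L \<in> l2" using l2_diff[OF X[of N] N] by simp
  have "(\<lambda>n. l2norm (\<lambda>k. X n k - L k)) \<longlonglongrightarrow> 0"
  proof (rule LIMSEQ_I)
    fix e :: real assume "e > 0"
    then have "e / 2 > 0" by simp
    then obtain N where N: "\<forall>n\<ge>N. (\<lambda>k. X n k - L k) \<in> l2 \<and> l2norm (\<lambda>k. X n k - L k) \<le> e / 2"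
      using close[of "e / 2"] by (elim meta_impE exE)
    have "norm (l2norm (\<lambda>k. X n k - L k) - 0) < e" if "n \<ge> N" for n
    proof -
      have "(\<lambda>k. X n k - L k) \<in> l2" "l2norm (\<lambda>k. X n k - L k) \<le> e / 2" using N that by simp_all
      then show ?thesis using l2norm_nonneg[of "\<lambda>k. X n k - L k"] \<open>e > 0\<close> by simp
    qed
    then show "\<exists>no. \<forall>n\<ge>no. norm (l2norm (\<lambda>k. X n k - L k) - 0) < e"
      by (intro exI[of _ N] allI impI)
  qed
  then show ?thesis using L2 by (rule bexI)
qed

text \<open>The multiplicative fields play no role.\<close>
definition l2_hilbert :: "(nat \<Rightarrow> complex) hilbert" where
  "l2_hilbert = \<lparr>carrier = l2, monoid.mult = (\<lambda>x y. x), one = (\<lambda>n. 0), zero = (\<lambda>n. 0),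
     add = (\<lambda>x y n. x n + y n), smult = (\<lambda>c x n. c * x n), cinner = ip\<rparr>"

lemma l2_hilbert_simps [simp]:
  "carrier l2_hilbert = l2" "\<zero>\<^bsub>l2_hilbert\<^esub> = (\<lambda>n. 0)"
  "x \<oplus>\<^bsub>l2_hilbert\<^esub> y = (\<lambda>n. x n + y n)" "c \<odot>\<^bsub>l2_hilbert\<^esub> x = (\<lambda>n. c * x n)"
  "cinner l2_hilbert = ip"
  by (simp_all add: l2_hilbert_def)

lemma hnorm_l2 [simp]: "x \<in> l2 \<Longrightarrow> hnorm l2_hilbert x = l2norm x"
  by (simp add: hnorm_def ip_self l2norm_nonneg)

lemma abelian_group_l2: "abelian_group l2_hilbert"
proof (rule abelian_groupI)
  fix x assume "x \<in> carrier l2_hilbert"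
  then show "\<exists>y\<in>carrier l2_hilbert. y \<oplus>\<^bsub>l2_hilbert\<^esub> x = \<zero>\<^bsub>l2_hilbert\<^esub>"
    using l2_scale[of x "-1"] by (intro bexI[of _ "\<lambda>n. - 1 * x n"]) auto
qed (auto simp: l2_add l2_zero algebra_simps)

lemma l2_minus [simp]:
  assumes "x \<in> l2" "y \<in> l2"
  shows "x \<ominus>\<^bsub>l2_hilbert\<^esub> y = (\<lambda>n. x n - y n)"
proof -
  have "\<ominus>\<^bsub>l2_hilbert\<^esub> y = (\<lambda>n. - 1 * y n)"
    using assms l2_scale[of y "-1"] by (intro abelian_group.minus_equality[OF abelian_group_l2]) auto
  then show ?thesis by (simp add: a_minus_def)
qed

lemma cring_complex_field: "cring complex_field"
proof (rule cringI)
  show "abelian_group complex_field"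
  proof (rule abelian_groupI)
    fix x assume "x \<in> carrier complex_field"
    show "\<exists>y\<in>carrier complex_field. y \<oplus>\<^bsub>complex_field\<^esub> x = \<zero>\<^bsub>complex_field\<^esub>"
      by (intro bexI[of _ "- x"]) (auto simp: complex_field_def)
  qed (auto simp: complex_field_def)
  show "comm_monoid complex_field"
    by unfold_locales (auto simp: complex_field_def)
qed (auto simp: complex_field_def algebra_simps)

lemma hilbert_space_l2: "hilbert_space l2_hilbert"
proof (intro hilbert_space.intro hilbert_space_axioms.intro)
  show "module complex_field l2_hilbert"
    using cring_complex_field abelian_group_l2
    by (intro module.intro module_axioms.intro) (auto simp: complex_field_def l2_scale algebra_simps)
next
  fix x assume x: "x \<in> carrier l2_hilbert" "x \<noteq> \<zero>\<^bsub>l2_hilbert\<^esub>"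
  then obtain k where "x k \<noteq> 0" by auto
  then have "0 < cmod (x k)" by simp
  also have "\<dots> \<le> l2norm x" using x(1) by (simp add: component_le_l2norm)
  finally show "0 < Re (cinner l2_hilbert x x)" using x(1) by (simp add: ip_self)
next
  fix X :: "nat \<Rightarrow> nat \<Rightarrow> complex"
  assume X: "\<And>n. X n \<in> carrier l2_hilbert"
    and C: "\<And>e. e > 0 \<Longrightarrow> \<exists>N. \<forall>m\<ge>N. \<forall>n\<ge>N. hnorm l2_hilbert (X m \<ominus>\<^bsub>l2_hilbert\<^esub> X n) < e"
  have X': "X n \<in> l2" for n using X by simp
  have "\<exists>N. \<forall>m\<ge>N. \<forall>n\<ge>N. l2norm (\<lambda>k. X m k - X n k) < e" if "e > 0" for e
    using C[OF that] X' by (simp add: l2_diff)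
  from l2_complete[OF X' this]
  obtain L where L: "L \<in> l2" "(\<lambda>n. l2norm (\<lambda>k. X n k - L k)) \<longlonglongrightarrow> 0"
    by (rule bexE)
  have "hnorm l2_hilbert (X n \<ominus>\<^bsub>l2_hilbert\<^esub> L) = l2norm (\<lambda>k. X n k - L k)" for n
    using X' L(1) by (simp add: l2_diff)
  then show "\<exists>L\<in>carrier l2_hilbert. (\<lambda>n. hnorm l2_hilbert (X n \<ominus>\<^bsub>l2_hilbert\<^esub> L)) \<longlonglongrightarrow> 0"
    using L by (intro bexI[of _ L]) simp_all
next
  fix x y assume "x \<in> carrier l2_hilbert" "y \<in> carrier l2_hilbert"
  then show "cinner l2_hilbert y x = cnj (cinner l2_hilbert x y)" using ip_commute[of x y] by simp
qed (simp_all add: ip_add_left ip_scale_left)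

section \<open>Bounded operators on square-summable sequences\<close>

abbreviation ops :: "((nat \<Rightarrow> complex) \<Rightarrow> nat \<Rightarrow> complex) set" where
  "ops \<equiv> bounded_ops l2_hilbert"

lemma op_algebra_l2 [simp]:
  "carrier (op_algebra l2_hilbert) = ops"
  "S \<otimes>\<^bsub>op_algebra l2_hilbert\<^esub> T = compose l2 S T"
  "\<one>\<^bsub>op_algebra l2_hilbert\<^esub> = (\<lambda>x\<in>l2. x)"
  "\<zero>\<^bsub>op_algebra l2_hilbert\<^esub> = (\<lambda>x\<in>l2. \<lambda>n. 0)"
  "S \<oplus>\<^bsub>op_algebra l2_hilbert\<^esub> T = (\<lambda>x\<in>l2. \<lambda>n. S x n + T x n)"
  "c \<odot>\<^bsub>op_algebra l2_hilbert\<^esub> T = (\<lambda>x\<in>l2. \<lambda>n. c * T x n)"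
  "adj (op_algebra l2_hilbert) = op_adj l2_hilbert"
  "nrm (op_algebra l2_hilbert) = op_norm l2_hilbert"
  by (simp_all add: op_algebra_def)

lemma opsI:
  assumes in_l2: "\<And>x. x \<in> l2 \<Longrightarrow> T x \<in> l2"
    and add: "\<And>x y. x \<in> l2 \<Longrightarrow> y \<in> l2 \<Longrightarrow> T (\<lambda>n. x n + y n) = (\<lambda>n. T x n + T y n)"
    and scale: "\<And>c x. x \<in> l2 \<Longrightarrow> T (\<lambda>n. c * x n) = (\<lambda>n. c * T x n)"
    and bound: "\<And>x. x \<in> l2 \<Longrightarrow> l2norm (T x) \<le> K * l2norm x"
  shows "restrict T l2 \<in> ops"
  unfolding bounded_ops_def using assms by (auto simp: l2_add l2_scale intro!: exI[of _ K])

lemma op_in: "T \<in> ops \<Longrightarrow> x \<in> l2 \<Longrightarrow> T x \<in> l2"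
  by (auto simp: bounded_ops_def)

lemma op_add: "T \<in> ops \<Longrightarrow> x \<in> l2 \<Longrightarrow> y \<in> l2 \<Longrightarrow> T (\<lambda>n. x n + y n) = (\<lambda>n. T x n + T y n)"
  by (auto simp: bounded_ops_def)

lemma op_scale: "T \<in> ops \<Longrightarrow> x \<in> l2 \<Longrightarrow> T (\<lambda>n. c * x n) = (\<lambda>n. c * T x n)"
  by (auto simp: bounded_ops_def)

lemma op_bound:
  assumes "T \<in> ops"
  obtains K where "K \<ge> 0" "\<And>x. x \<in> l2 \<Longrightarrow> l2norm (T x) \<le> K * l2norm x"
proof -
  obtain K where K: "\<forall>x\<in>l2. hnorm l2_hilbert (T x) \<le> K * hnorm l2_hilbert x"
    using assms by (auto simp: bounded_ops_def)
  have "l2norm (T x) \<le> \<bar>K\<bar> * l2norm x" if x: "x \<in> l2" for x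
  proof -
    have "l2norm (T x) \<le> K * l2norm x" using K x op_in[OF assms x] by force
    also have "\<dots> \<le> \<bar>K\<bar> * l2norm x" using l2norm_nonneg[OF x] by (intro mult_right_mono) auto
    finally show ?thesis .
  qed
  then show ?thesis using that[of "\<bar>K\<bar>"] by auto
qed

lemma op_ext: "S \<in> ops \<Longrightarrow> T \<in> ops \<Longrightarrow> (\<And>x. x \<in> l2 \<Longrightarrow> S x = T x) \<Longrightarrow> S = T"
  unfolding bounded_ops_def by (rule PiE_ext[of S "carrier l2_hilbert" "\<lambda>_. carrier l2_hilbert" T]) simp_all

lemma op_restrict: "T \<in> ops \<Longrightarrow> restrict T l2 = T"
  unfolding bounded_ops_def by (auto simp: PiE_def extensional_restrict)

lemma op_compose: "S \<in> ops \<Longrightarrow> T \<in> ops \<Longrightarrow> compose l2 S T \<in> ops"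
proof -
  assume S: "S \<in> ops" and T: "T \<in> ops"
  obtain K L where K: "K \<ge> 0" "\<And>x. x \<in> l2 \<Longrightarrow> l2norm (S x) \<le> K * l2norm x"
    and L: "L \<ge> 0" "\<And>x. x \<in> l2 \<Longrightarrow> l2norm (T x) \<le> L * l2norm x"
    using op_bound[OF S] op_bound[OF T] by metis
  show ?thesis unfolding compose_def
  proof (rule opsI[where K = "K * L"])
    fix x assume x: "x \<in> l2"
    show "l2norm (S (T x)) \<le> K * L * l2norm x"
      using K(2)[OF op_in[OF T x]] mult_left_mono[OF L(2)[OF x] K(1)] by (simp add: mult.assoc)
  qed (simp_all add: op_in[OF S] op_in[OF T] op_add[OF S] op_add[OF T] op_scale[OF S] op_scale[OF T])
qed

lemma op_one: "(\<lambda>x\<in>l2. x) \<in> ops"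
  by (rule opsI[where K = 1]) auto

lemma op_zero: "(\<lambda>x\<in>l2. \<lambda>n. 0) \<in> ops"
  by (rule opsI[where K = 0]) (auto simp: l2_zero)

lemma op_plus:
  assumes S: "S \<in> ops" and T: "T \<in> ops"
  shows "(\<lambda>x\<in>l2. \<lambda>n. S x n + T x n) \<in> ops"
proof -
  obtain K L where K: "K \<ge> 0" "\<And>x. x \<in> l2 \<Longrightarrow> l2norm (S x) \<le> K * l2norm x"
    and L: "L \<ge> 0" "\<And>x. x \<in> l2 \<Longrightarrow> l2norm (T x) \<le> L * l2norm x"
    using op_bound[OF S] op_bound[OF T] by metis
  show ?thesis
  proof (rule opsI[where K = "K + L"])
    fix x assume x: "x \<in> l2"
    show "l2norm (\<lambda>n. S x n + T x n) \<le> (K + L) * l2norm x"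
      using l2_add(2)[OF op_in[OF S x] op_in[OF T x]] K(2)[OF x] L(2)[OF x] by (simp add: algebra_simps)
  qed (simp_all add: l2_add op_in[OF S] op_in[OF T] op_add[OF S] op_add[OF T] op_scale[OF S] op_scale[OF T] algebra_simps)
qed

lemma op_smult:
  assumes T: "T \<in> ops"
  shows "(\<lambda>x\<in>l2. \<lambda>n. c * T x n) \<in> ops"
proof -
  obtain L where L: "L \<ge> 0" "\<And>x. x \<in> l2 \<Longrightarrow> l2norm (T x) \<le> L * l2norm x"
    using op_bound[OF T] by metis
  show ?thesis
  proof (rule opsI[where K = "cmod c * L"])
    fix x assume x: "x \<in> l2"
    show "l2norm (\<lambda>n. c * T x n) \<le> cmod c * L * l2norm x"
      using l2norm_scale[OF op_in[OF T x], of c] mult_left_mono[OF L(2)[OF x], of "cmod c"] by (simp add: mult.assoc)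
  qed (simp_all add: l2_scale op_in[OF T] op_add[OF T] op_scale[OF T] algebra_simps)
qed

lemma op_sum:
  assumes T: "T \<in> ops" and v: "\<And>m. v m \<in> l2"
  shows "T (\<lambda>n. \<Sum>m<(M::nat). c m * v m n) = (\<lambda>n. \<Sum>m<M. c m * T (v m) n)"
proof (induction M)
  case 0
  show ?case using op_scale[OF T l2_zero, of 0] by simp
next
  case (Suc M)
  then show ?case
    using op_add[OF T l2_sum[of v c M] l2_scale[of "v M" "c M"]] v op_scale[OF T v, where c = "c M"] by simp
qed

lemma op_eq_on_basis:
  assumes S: "S \<in> ops" and T: "T \<in> ops" and eq: "\<And>m. S (unit_vec m) = T (unit_vec m)"
  shows "S = T"
proof (rule op_ext[OF S T], rule ext)
  fix x k assume x: "x \<in> l2"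
  obtain K L where K: "K \<ge> 0" "\<And>x. x \<in> l2 \<Longrightarrow> l2norm (S x) \<le> K * l2norm x"
    and L: "L \<ge> 0" "\<And>x. x \<in> l2 \<Longrightarrow> l2norm (T x) \<le> L * l2norm x"
    using op_bound[OF S] op_bound[OF T] by metis
  have "S x k - T x k = 0"
  proof (rule functional_eq_0[OF x, where C = "K + L"])
    fix x assume x: "x \<in> l2"
    have "cmod (S x k - T x k) \<le> l2norm (S x) + l2norm (T x)"
      using norm_triangle_ineq4[of "S x k" "T x k"] component_le_l2norm[OF op_in[OF S x], of k]
        component_le_l2norm[OF op_in[OF T x], of k] by linarith
    then show "cmod (S x k - T x k) \<le> (K + L) * l2norm x"
      using K(2)[OF x] L(2)[OF x] by (simp add: algebra_simps)
  qed (simp_all add: op_add[OF S] op_add[OF T] op_scale[OF S] op_scale[OF T] algebra_simps eq)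
  then show "S x k = T x k" by simp
qed

text \<open>A form identity between two operators need only be checked on the basis.\<close>
lemma adjoint_on_basis:
  assumes S: "S \<in> ops" and T: "T \<in> ops" and y: "y \<in> l2" and x: "x \<in> l2"
    and eq: "\<And>m. ip (S (unit_vec m)) y = ip (unit_vec m) (T y)"
  shows "ip (S x) y = ip x (T y)"
proof -
  obtain K where K: "K \<ge> 0" "\<And>x. x \<in> l2 \<Longrightarrow> l2norm (S x) \<le> K * l2norm x"
    using op_bound[OF S] by metis
  note Ty = op_in[OF T y]
  have "ip (S x) y - ip x (T y) = 0"
  proof (rule functional_eq_0[OF x, where C = "K * l2norm y + l2norm (T y)"])
    fix x assume x: "x \<in> l2"
    have "cmod (ip (S x) y - ip x (T y)) \<le> l2norm (S x) * l2norm y + l2norm x * l2norm (T y)"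
      using norm_triangle_ineq4[of "ip (S x) y" "ip x (T y)"] ip_Cauchy_Schwarz[OF op_in[OF S x] y]
        ip_Cauchy_Schwarz[OF x Ty] by linarith
    also have "\<dots> \<le> (K * l2norm x) * l2norm y + l2norm x * l2norm (T y)"
      by (intro add_mono mult_right_mono K(2) x l2norm_nonneg y order_refl)
    finally show "cmod (ip (S x) y - ip x (T y)) \<le> (K * l2norm y + l2norm (T y)) * l2norm x"
      by (simp add: algebra_simps)
  qed (use y Ty in \<open>simp_all add: op_add[OF S] op_scale[OF S] op_in[OF S] ip_add_left ip_scale_left eq algebra_simps\<close>)
  then show ?thesis by simp
qed

text \<open>The operator whose \<open>m\<close>-th coordinate is the inner product with \<open>v m\<close>.\<close>
lemma row_operator:
  assumes v: "\<And>m. v m \<in> l2" and K: "K \<ge> 0"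
    and le: "\<And>M c. l2norm (\<lambda>n. \<Sum>m<M. c m * v m n) \<le> K * sqrt (\<Sum>m<M. (cmod (c m))\<^sup>2)"
  shows "(\<lambda>x\<in>l2. \<lambda>m. ip x (v m)) \<in> ops"
    and "\<And>x. x \<in> l2 \<Longrightarrow> l2norm (\<lambda>m. ip x (v m)) \<le> K * l2norm x"
proof -
  have *: "(\<lambda>m. ip x (v m)) \<in> l2 \<and> l2norm (\<lambda>m. ip x (v m)) \<le> K * l2norm x" if x: "x \<in> l2" for x
  proof -
    have "(\<Sum>m<M. (cmod (ip x (v m)))\<^sup>2) \<le> (K * l2norm x)\<^sup>2" for M
    proof -
      define s where "s = (\<Sum>m<M. (cmod (ip x (v m)))\<^sup>2)"
      have s0: "s \<ge> 0" by (simp add: s_def sum_nonneg)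
      have "complex_of_real s = ip x (\<lambda>n. \<Sum>m<M. ip x (v m) * v m n)"
        unfolding ip_sum_right[OF x v] s_def of_real_sum complex_norm_square
        by (rule sum.cong[OF refl mult.commute])
      then have "s = cmod (ip x (\<lambda>n. \<Sum>m<M. ip x (v m) * v m n))" using s0 by (metis norm_of_real abs_of_nonneg)
      also have "\<dots> \<le> l2norm x * (K * sqrt s)"
        unfolding s_def
        by (rule order_trans[OF ip_Cauchy_Schwarz[OF x l2_sum[OF v]] mult_left_mono[OF le l2norm_nonneg[OF x]]])
      finally have "sqrt s * sqrt s \<le> (K * l2norm x) * sqrt s" using s0 by (simp add: algebra_simps)
      then have "sqrt s \<le> K * l2norm x"
        using K l2norm_nonneg[OF x] s0 by (cases "s = 0") (auto intro: mult_right_le_imp_le[of _ "sqrt s"])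
      then have "(sqrt s)\<^sup>2 \<le> (K * l2norm x)\<^sup>2" using s0 by (intro power_mono) auto
      then show ?thesis using s0 by (simp add: s_def)
    qed
    then show ?thesis using l2I[of "K * l2norm x" "\<lambda>m. ip x (v m)"] K l2norm_nonneg[OF x] by auto
  qed
  then show "\<And>x. x \<in> l2 \<Longrightarrow> l2norm (\<lambda>m. ip x (v m)) \<le> K * l2norm x" by blast
  show "(\<lambda>x\<in>l2. \<lambda>m. ip x (v m)) \<in> ops"
    by (rule opsI[where K = K]) (use * v in \<open>auto simp: ip_add_left ip_scale_left\<close>)
qed

text \<open>The adjoint of \<open>T\<close> has the vectors \<open>T e\<^sub>m\<close> as its rows.\<close>
lemma adjoint_exists:
  assumes T: "T \<in> ops"
  obtains S where "S \<in> ops" "\<And>x y. x \<in> l2 \<Longrightarrow> y \<in> l2 \<Longrightarrow> ip (T x) y = ip x (S y)"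
proof -
  obtain K where K: "K \<ge> 0" "\<And>x. x \<in> l2 \<Longrightarrow> l2norm (T x) \<le> K * l2norm x"
    using op_bound[OF T] by metis
  define S where "S = (\<lambda>x\<in>l2. \<lambda>m. ip x (T (unit_vec m)))"
  have Tu: "T (unit_vec m) \<in> l2" for m by (rule op_in[OF T unit_vec_l2])
  have S: "S \<in> ops" unfolding S_def
  proof (rule row_operator(1)[OF Tu K(1)])
    fix M :: nat and c
    have "l2norm (T (\<lambda>n. \<Sum>m<M. c m * unit_vec m n)) \<le> K * l2norm (\<lambda>n. \<Sum>m<M. c m * unit_vec m n)"
      by (intro K(2) l2_sum unit_vec_l2)
    then show "l2norm (\<lambda>n. \<Sum>m<M. c m * T (unit_vec m) n) \<le> K * sqrt (\<Sum>m<M. (cmod (c m))\<^sup>2)"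
      by (simp only: op_sum[OF T unit_vec_l2] l2norm_sum_unit_vec)
  qed
  have "ip (T x) y = ip x (S y)" if "x \<in> l2" "y \<in> l2" for x y
  proof (rule adjoint_on_basis[OF T S that(2,1)])
    show "ip (T (unit_vec m)) y = ip (unit_vec m) (S y)" for m
      using that(2) ip_commute[OF that(2) Tu, of m] by (simp add: ip_unit_vec_left S_def)
  qed
  then show ?thesis by (rule that[OF S])
qed

lemma op_adj_eq:
  assumes S: "S \<in> ops" and adj: "\<And>x y. x \<in> l2 \<Longrightarrow> y \<in> l2 \<Longrightarrow> ip (T x) y = ip x (S y)"
  shows "op_adj l2_hilbert T = S"
  unfolding op_adj_def
proof (rule the_equality)
  show "S \<in> ops \<and> (\<forall>x\<in>carrier l2_hilbert. \<forall>y\<in>carrier l2_hilbert. cinner l2_hilbert (T x) y = cinner l2_hilbert x (S y))"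
    using assms by simp
  fix R assume R: "R \<in> ops \<and> (\<forall>x\<in>carrier l2_hilbert. \<forall>y\<in>carrier l2_hilbert. cinner l2_hilbert (T x) y = cinner l2_hilbert x (R y))"
  show "R = S"
  proof (rule op_ext[OF _ S], use R in blast, rule ext)
    fix y m assume y: "y \<in> l2"
    have "ip (unit_vec m) (R y) = ip (unit_vec m) (S y)"
      using R y adj[OF unit_vec_l2 y, of m] unit_vec_l2[of m] by simp
    then show "R y m = S y m" by (simp add: ip_unit_vec_left)
  qed
qed

lemma op_norm_bound:
  assumes T: "T \<in> ops" and x: "x \<in> l2"
  shows "l2norm (T x) \<le> op_norm l2_hilbert T * l2norm x"
proof -
  let ?S = "{K. 0 \<le> K \<and> (\<forall>x\<in>carrier l2_hilbert. hnorm l2_hilbert (T x) \<le> K * hnorm l2_hilbert x)}"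
  have S: "?S = {K. 0 \<le> K \<and> (\<forall>x\<in>l2. l2norm (T x) \<le> K * l2norm x)}" using op_in[OF T] by auto
  obtain K where "K \<ge> 0" "\<And>x. x \<in> l2 \<Longrightarrow> l2norm (T x) \<le> K * l2norm x" using op_bound[OF T] by metis
  then have ne: "?S \<noteq> {}" unfolding S by blast
  show ?thesis
  proof (cases "l2norm x = 0")
    case True
    then have "l2norm (T x) \<le> 0" using ne x unfolding S by fastforce
    then show ?thesis using True by simp
  next
    case False
    then have x0: "l2norm x > 0" using l2norm_nonneg[OF x] by simp
    have "l2norm (T x) / l2norm x \<le> op_norm l2_hilbert T"
      unfolding op_norm_def using ne
    proof (rule cInf_greatest)
      fix K assume "K \<in> ?S"
      then have "l2norm (T x) \<le> K * l2norm x" using x unfolding S by blast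
      then show "l2norm (T x) / l2norm x \<le> K" using x0 by (simp add: field_simps)
    qed
    then show ?thesis using x0 by (simp add: field_simps)
  qed
qed

lemma abelian_group_ops:
  assumes B: "carrier B = ops" "\<And>S T. S \<oplus>\<^bsub>B\<^esub> T = (\<lambda>x\<in>l2. \<lambda>n. S x n + T x n)" "\<zero>\<^bsub>B\<^esub> = (\<lambda>x\<in>l2. \<lambda>n. 0)"
  shows "abelian_group B"
proof (rule abelian_groupI)
  fix T assume "T \<in> carrier B"
  then have T: "T \<in> ops" by (simp add: B)
  have "(\<lambda>x\<in>l2. \<lambda>n. (\<lambda>x\<in>l2. \<lambda>n. - 1 * T x n) x n + T x n) = (\<lambda>x\<in>l2. \<lambda>n. 0)"
    by (rule restrict_ext) simp
  then show "\<exists>S\<in>carrier B. S \<oplus>\<^bsub>B\<^esub> T = \<zero>\<^bsub>B\<^esub>"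
    unfolding B using op_smult[OF T, of "- 1"] by blast
next
  fix T assume "T \<in> carrier B"
  then have "restrict T l2 = T" by (simp add: B op_restrict)
  then show "\<zero>\<^bsub>B\<^esub> \<oplus>\<^bsub>B\<^esub> T = T" by (simp add: B cong: restrict_cong)
next
  fix S T assume "S \<in> carrier B" "T \<in> carrier B"
  then show "S \<oplus>\<^bsub>B\<^esub> T \<in> carrier B" by (simp add: B op_plus)
qed (auto simp: B op_zero algebra_simps intro!: restrict_ext)

text \<open>Subtraction in any structure with the carrier and addition of \<open>B(\<ell>\<^sup>2)\<close>, such as a Choi--Effros algebra.\<close>
lemma ops_minus:
  assumes B: "carrier B = ops" "\<And>S T. S \<oplus>\<^bsub>B\<^esub> T = (\<lambda>x\<in>l2. \<lambda>n. S x n + T x n)" "\<zero>\<^bsub>B\<^esub> = (\<lambda>x\<in>l2. \<lambda>n. 0)"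
    and S: "S \<in> ops" and T: "T \<in> ops"
  shows "S \<ominus>\<^bsub>B\<^esub> T = (\<lambda>x\<in>l2. \<lambda>n. S x n - T x n)"
proof -
  have "\<ominus>\<^bsub>B\<^esub> T = (\<lambda>x\<in>l2. \<lambda>n. - 1 * T x n)"
  proof (rule abelian_group.minus_equality[OF abelian_group_ops[of B]])
    show "(\<lambda>x\<in>l2. \<lambda>n. - 1 * T x n) \<oplus>\<^bsub>B\<^esub> T = \<zero>\<^bsub>B\<^esub>" unfolding B by (rule restrict_ext) simp
  qed (use B T op_smult[OF T, of "- 1"] in simp_all)
  then show ?thesis by (simp add: a_minus_def B restrict_def fun_eq_iff)
qed

lemma op_minus: "S \<in> ops \<Longrightarrow> T \<in> ops \<Longrightarrow> (\<lambda>x\<in>l2. \<lambda>n. S x n - T x n) \<in> ops"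
  using op_plus[OF _ op_smult[of T "- 1"], of S] by (simp add: restrict_def cong: if_cong)

lemma op_matrix_positive_1:
  "op_matrix_positive l2_hilbert 1 (\<lambda>i j. T) \<longleftrightarrow> (\<forall>x\<in>l2. ip (T x) x \<in> \<real>\<^sub>\<ge>\<^sub>0)"
proof
  assume L: "op_matrix_positive l2_hilbert 1 (\<lambda>i j. T)"
  show "\<forall>x\<in>l2. ip (T x) x \<in> \<real>\<^sub>\<ge>\<^sub>0"
  proof
    fix x assume "x \<in> l2"
    then show "ip (T x) x \<in> \<real>\<^sub>\<ge>\<^sub>0"
      using L[unfolded op_matrix_positive_def, rule_format, of "\<lambda>_. x"] by simp
  qed
qed (simp add: op_matrix_positive_def)

section \<open>Symmetries of square-summable sequences\<close>

text \<open>Self-adjoint unitary operators.\<close>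
definition symmetry :: "((nat \<Rightarrow> complex) \<Rightarrow> nat \<Rightarrow> complex) \<Rightarrow> bool" where
  "symmetry U \<longleftrightarrow> U \<in> ops \<and> (\<forall>x\<in>l2. U (U x) = x) \<and> (\<forall>x\<in>l2. \<forall>y\<in>l2. ip (U x) y = ip x (U y))"

text \<open>Composition with \<open>\<sigma>\<close>, a permutation operator when \<open>\<sigma>\<close> is an involution.\<close>
definition reindex :: "(nat \<Rightarrow> nat) \<Rightarrow> (nat \<Rightarrow> complex) \<Rightarrow> nat \<Rightarrow> complex" where
  "reindex \<sigma> = (\<lambda>x\<in>l2. \<lambda>n. x (\<sigma> n))"

lemma reindex_l2:
  assumes \<sigma>: "\<And>n. \<sigma> (\<sigma> n) = n" and x: "x \<in> l2"
  shows "(\<lambda>n. x (\<sigma> n)) \<in> l2" "l2norm (\<lambda>n. x (\<sigma> n)) \<le> l2norm x"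
proof -
  have inj: "inj_on \<sigma> A" for A by (metis \<sigma> inj_onI)
  have "(\<Sum>k<n. (cmod (x (\<sigma> k)))\<^sup>2) \<le> (l2norm x)\<^sup>2" for n
  proof -
    have "(\<Sum>k<n. (cmod (x (\<sigma> k)))\<^sup>2) = (\<Sum>j\<in>\<sigma> ` {..<n}. (cmod (x j))\<^sup>2)"
      by (simp add: sum.reindex[OF inj])
    also have "\<dots> \<le> (\<Sum>j. (cmod (x j))\<^sup>2)" by (intro sum_le_suminf l2_summable x) auto
    finally show ?thesis by (simp add: l2norm_square x)
  qed
  then show "(\<lambda>n. x (\<sigma> n)) \<in> l2" "l2norm (\<lambda>n. x (\<sigma> n)) \<le> l2norm x"
    using l2I[of "l2norm x" "\<lambda>n. x (\<sigma> n)"] l2norm_nonneg[OF x] by simp_all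
qed

lemma reindex_apply: "x \<in> l2 \<Longrightarrow> reindex \<sigma> x = (\<lambda>n. x (\<sigma> n))"
  by (simp add: reindex_def)

lemma reindex_unit_vec:
  assumes \<sigma>: "\<And>n. \<sigma> (\<sigma> n) = n"
  shows "reindex \<sigma> (unit_vec m) = unit_vec (\<sigma> m)"
proof -
  have "(\<sigma> n = m) = (n = \<sigma> m)" for n using \<sigma> by metis
  then show ?thesis by (simp add: reindex_apply unit_vec_l2) (simp add: unit_vec_def)
qed

lemma symmetry_reindex:
  assumes \<sigma>: "\<And>n. \<sigma> (\<sigma> n) = n"
  shows "symmetry (reindex \<sigma>)"
proof -
  have U: "reindex \<sigma> \<in> ops" unfolding reindex_def
    by (rule opsI[where K = 1]) (simp_all add: reindex_l2[OF \<sigma>])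
  have "ip (reindex \<sigma> x) y = ip x (reindex \<sigma> y)" if xy: "x \<in> l2" "y \<in> l2" for x y
  proof (rule adjoint_on_basis[OF U U xy(2,1)])
    show "ip (reindex \<sigma> (unit_vec m)) y = ip (unit_vec m) (reindex \<sigma> y)" for m
      by (simp add: reindex_unit_vec[OF \<sigma>] ip_unit_vec_left reindex_apply xy)
  qed
  then show ?thesis using U by (simp add: symmetry_def reindex_apply reindex_l2[OF \<sigma>] \<sigma>)
qed

text \<open>For a unit vector \<open>v\<close> with real initial coordinate, the reflection exchanging \<open>v\<close> and the
  initial basis vector.\<close>
definition reflection :: "(nat \<Rightarrow> complex) \<Rightarrow> (nat \<Rightarrow> complex) \<Rightarrow> nat \<Rightarrow> complex" where
  "reflection v = (\<lambda>x\<in>l2. \<lambda>n. x n - (ip x (\<lambda>n. unit_vec 0 n - v n) / (1 - v 0)) * (unit_vec 0 n - v n))"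

lemma symmetry_reflection:
  assumes v: "v \<in> l2" and n: "ip v v = 1" and r: "v 0 \<in> \<real>" and ne: "v 0 \<noteq> 1"
  shows "symmetry (reflection v)" "reflection v (unit_vec 0) = v"
proof -
  define d where "d = (\<lambda>n. unit_vec 0 n - v n)"
  have d: "d \<in> l2" unfolding d_def by (intro l2_diff unit_vec_l2 v)
  define R where "R = (\<lambda>x n. x n - (ip x d / (1 - v 0)) * d n)"
  have R: "reflection v = restrict R l2" by (simp add: reflection_def R_def d_def)
  have v0: "cnj (v 0) = v 0" using r by (rule Reals_cnj_iff[THEN iffD1])
  have dd: "ip d d = 2 * (1 - v 0)"
    unfolding d_def using ip_commute[OF v unit_vec_l2, of 0]
    by (simp add: ip_diff_left ip_diff_right ip_unit_vec l2_diff unit_vec_l2 v n v0)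
      (simp add: unit_vec_def)
  have Rl: "R x \<in> l2" if "x \<in> l2" for x
    unfolding R_def using that by (intro l2_diff l2_scale d)
  have ipR: "ip (R x) y = ip x y - (ip x d / (1 - v 0)) * ip d y" if "x \<in> l2" "y \<in> l2" for x y
    unfolding R_def
    by (simp only: ip_diff_left[OF that(1) l2_scale[OF d] that(2)] ip_scale_left[OF d that(2)])
  have ipR': "ip x (R y) = ip x y - cnj (ip y d / (1 - v 0)) * ip x d" if "x \<in> l2" "y \<in> l2" for x y
    unfolding R_def
    by (simp only: ip_diff_right[OF that(2) l2_scale[OF d] that(1)] ip_scale_right[OF d that(1)])
  have ops: "reflection v \<in> ops" unfolding R
  proof (rule opsI[where K = "1 + l2norm d / cmod (1 - v 0) * l2norm d"])
    fix x assume x: "x \<in> l2"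
    have "l2norm (R x) \<le> l2norm x + cmod (ip x d / (1 - v 0)) * l2norm d"
      unfolding R_def using l2norm_diff[OF x l2_scale[OF d]] l2norm_scale[OF d] by metis
    also have "\<dots> \<le> l2norm x + (l2norm x * l2norm d / cmod (1 - v 0)) * l2norm d"
      unfolding norm_divide
      by (intro add_mono order_refl mult_right_mono divide_right_mono ip_Cauchy_Schwarz x d l2norm_nonneg) auto
    finally show "l2norm (R x) \<le> (1 + l2norm d / cmod (1 - v 0) * l2norm d) * l2norm x"
      by (simp add: algebra_simps)
  next
    fix x y assume "x \<in> l2" "y \<in> l2"
    then show "R (\<lambda>n. x n + y n) = (\<lambda>n. R x n + R y n)"
      by (simp add: R_def ip_add_left d add_divide_distrib algebra_simps)
  next
    fix c x assume "x \<in> l2"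
    then show "R (\<lambda>n. c * x n) = (\<lambda>n. c * R x n)"
      by (simp add: R_def ip_scale_left d algebra_simps)
  qed (rule Rl)
  have "R (R x) = x" if x: "x \<in> l2" for x
  proof -
    have e: "a / u * (2 * u) = 2 * a" if "u \<noteq> 0" for a u :: complex using that by simp
    have nz: "1 - v 0 \<noteq> 0" using ne by simp
    have "ip (R x) d = ip x d - ip x d / (1 - v 0) * (2 * (1 - v 0))" by (simp only: ipR[OF x d] dd)
    then have neg: "ip (R x) d = - ip x d" unfolding e[OF nz] by simp
    have Ra: "R y n = y n - (ip y d / (1 - v 0)) * d n" for y n by (simp add: R_def)
    show ?thesis by (rule ext) (simp add: Ra[of "R x"] neg, simp add: Ra)
  qed
  moreover have "ip (R x) y = ip x (R y)" if "x \<in> l2" "y \<in> l2" for x y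
    using that ip_commute[OF that(2) d] by (simp add: ipR ipR' v0)
  ultimately show "symmetry (reflection v)"
    using ops Rl by (simp add: symmetry_def R)
  have "ip (unit_vec 0) d = 1 - v 0" by (simp add: ip_unit_vec_left d_def v0) (simp add: unit_vec_def)
  then show "reflection v (unit_vec 0) = v"
    using ne by (simp add: R unit_vec_l2 R_def) (simp add: d_def)
qed

lemma infinite_swap:
  fixes S T :: "nat set"
  assumes "infinite S" "infinite T" "S \<inter> T = {}"
  shows "\<exists>\<sigma>. (\<forall>n. \<sigma> (\<sigma> n) = n) \<and> (\<forall>n. \<sigma> n \<in> S \<longleftrightarrow> n \<in> T) \<and> (\<forall>n. n \<notin> S \<union> T \<longrightarrow> \<sigma> n = n)"
proof -
  define f where "f = from_nat_into T \<circ> to_nat_on S"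
  have f: "bij_betw f S T"
    unfolding f_def using assms
    by (intro bij_betw_trans[OF to_nat_on_infinite bij_betw_from_nat_into]) auto
  define g where "g = inv_into S f"
  have g: "bij_betw g T S" unfolding g_def by (rule bij_betw_inv_into[OF f])
  have fT: "f n \<in> T" if "n \<in> S" for n using bij_betwE[OF f] that by blast
  have gS: "g n \<in> S" if "n \<in> T" for n using bij_betwE[OF g] that by blast
  have gf: "g (f n) = n" if "n \<in> S" for n unfolding g_def using bij_betw_inv_into_left[OF f that] .
  have fg: "f (g n) = n" if "n \<in> T" for n unfolding g_def using bij_betw_inv_into_right[OF f that] .
  define \<sigma> where "\<sigma> = (\<lambda>n. if n \<in> S then f n else if n \<in> T then g n else n)"
  have disj: "n \<notin> S" if "n \<in> T" for n using that assms(3) by blast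
  have "\<sigma> (\<sigma> n) = n" for n
    using fT[of n] gS[of n] gf[of n] fg[of n] disj[of n] disj[of "f n"] disj[of "g n"] by (auto simp: \<sigma>_def)
  moreover have "\<sigma> n \<in> S \<longleftrightarrow> n \<in> T" for n using fT gS disj by (auto simp: \<sigma>_def)
  moreover have "n \<notin> S \<union> T \<longrightarrow> \<sigma> n = n" for n by (simp add: \<sigma>_def)
  ultimately show ?thesis by blast
qed

text \<open>An involution of the natural numbers exchanging \<open>S\<close> and \<open>T\<close> and fixing all other points; it exists
  when \<open>S\<close> and \<open>T\<close> are infinite and disjoint.\<close>
definition swap_perm :: "nat set \<Rightarrow> nat set \<Rightarrow> nat \<Rightarrow> nat" where
  "swap_perm S T = (SOME \<sigma>. (\<forall>n. \<sigma> (\<sigma> n) = n) \<and> (\<forall>n. \<sigma> n \<in> S \<longleftrightarrow> n \<in> T) \<and> (\<forall>n. n \<notin> S \<union> T \<longrightarrow> \<sigma> n = n))"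

lemma swap_perm:
  assumes "infinite S" "infinite T" "S \<inter> T = {}"
  shows "swap_perm S T (swap_perm S T n) = n" "swap_perm S T n \<in> S \<longleftrightarrow> n \<in> T"
    "n \<notin> S \<Longrightarrow> n \<notin> T \<Longrightarrow> swap_perm S T n = n"
  using someI_ex[OF infinite_swap[OF assms]] unfolding swap_perm_def[symmetric] by blast+

text \<open>The projection onto the coordinates in \<open>S\<close>.\<close>
definition coord_proj :: "nat set \<Rightarrow> (nat \<Rightarrow> complex) \<Rightarrow> nat \<Rightarrow> complex" where
  "coord_proj S = (\<lambda>x\<in>l2. \<lambda>n. if n \<in> S then x n else 0)"

lemma coord_proj_l2:
  assumes x: "x \<in> l2"
  shows "(\<lambda>n. if n \<in> S then x n else 0) \<in> l2" "l2norm (\<lambda>n. if n \<in> S then x n else 0) \<le> l2norm x"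
proof -
  have "(\<Sum>k<n. (cmod (if k \<in> S then x k else 0))\<^sup>2) \<le> (l2norm x)\<^sup>2" for n
  proof -
    have "(\<Sum>k<n. (cmod (if k \<in> S then x k else 0))\<^sup>2) \<le> (\<Sum>k<n. (cmod (x k))\<^sup>2)"
      by (intro sum_mono) auto
    then show ?thesis using l2_sum_le[OF x, of n] by linarith
  qed
  then show "(\<lambda>n. if n \<in> S then x n else 0) \<in> l2" "l2norm (\<lambda>n. if n \<in> S then x n else 0) \<le> l2norm x"
    using l2I[of "l2norm x" "\<lambda>n. if n \<in> S then x n else 0"] l2norm_nonneg[OF x] by simp_all
qed

lemma coord_proj_ops: "coord_proj S \<in> ops"
  unfolding coord_proj_def by (rule opsI[where K = 1]) (auto simp: coord_proj_l2)

lemma coord_proj_apply: "x \<in> l2 \<Longrightarrow> coord_proj S x = (\<lambda>n. if n \<in> S then x n else 0)"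
  by (simp add: coord_proj_def)

lemma coord_proj_Un:
  "S \<inter> T = {} \<Longrightarrow> coord_proj (S \<union> T) = (\<lambda>x\<in>l2. \<lambda>n. coord_proj S x n + coord_proj T x n)"
  by (auto simp: coord_proj_def fun_eq_iff)

lemma coord_proj_UNIV: "coord_proj UNIV = (\<lambda>x\<in>l2. x)"
  by (simp add: coord_proj_def)

lemma ip_coord_proj: 
  assumes x: "x \<in> l2"
  shows "ip (coord_proj S x) x = of_real ((l2norm (coord_proj S x))\<^sup>2)"
proof -
  have "ip (coord_proj S x) x = ip (coord_proj S x) (coord_proj S x)"
    unfolding ip_def by (rule suminf_cong) (simp add: coord_proj_apply x)
  then show ?thesis by (simp add: ip_self op_in[OF coord_proj_ops x])
qed

text \<open>For \<open>j \<noteq> k\<close> and \<open>\<bar>z\<bar> = 1\<close> these are unit vectors. Together with the basis vectors they determine an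
  operator through its quadratic form.\<close>
definition pair_vec :: "nat \<Rightarrow> nat \<Rightarrow> complex \<Rightarrow> nat \<Rightarrow> complex" where
  "pair_vec j k z = (\<lambda>n. of_real (1 / sqrt 2) * (unit_vec j n + z * unit_vec k n))"

lemma pair_vec_l2: "pair_vec j k z \<in> l2"
  unfolding pair_vec_def by (intro l2_scale l2_add unit_vec_l2)

text \<open>The factor 2 clears the normalization of the vector.\<close>
lemma quadratic_form_pair_vec:
  assumes T: "T \<in> ops"
  shows "2 * ip (T (pair_vec j k z)) (pair_vec j k z) =
    T (unit_vec j) j + cnj z * T (unit_vec j) k + z * T (unit_vec k) j + z * cnj z * T (unit_vec k) k"
proof -
  let ?w = "\<lambda>n. unit_vec j n + z * unit_vec k n"
  have w: "?w \<in> l2" by (intro l2_add l2_scale unit_vec_l2)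
  define c where "c = complex_of_real (1 / sqrt 2)"
  have c: "2 * (c * cnj c) = 1" unfolding c_def by (simp flip: of_real_mult)
  have p: "pair_vec j k z = (\<lambda>n. c * ?w n)" by (simp add: pair_vec_def c_def)
  have "ip (T (pair_vec j k z)) (pair_vec j k z) = (c * cnj c) * ip (T ?w) ?w"
    unfolding p op_scale[OF T w]
    by (simp only: ip_scale_left[OF op_in[OF T w] l2_scale[OF w]] ip_scale_right[OF w op_in[OF T w]] mult.assoc)
  then have "2 * ip (T (pair_vec j k z)) (pair_vec j k z) = (2 * (c * cnj c)) * ip (T ?w) ?w" by simp
  then have "2 * ip (T (pair_vec j k z)) (pair_vec j k z) = ip (T ?w) ?w" by (simp only: c mult_1)
  also have "T ?w = (\<lambda>n. T (unit_vec j) n + z * T (unit_vec k) n)"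
    by (simp add: op_add[OF T] op_scale[OF T] unit_vec_l2 l2_scale)
  also have "ip \<dots> ?w = T (unit_vec j) j + cnj z * T (unit_vec j) k + z * T (unit_vec k) j + z * cnj z * T (unit_vec k) k"
    by (simp add: ip_add_left ip_add_right ip_scale_left ip_scale_right unit_vec_l2 op_in[OF T] l2_scale l2_add ip_unit_vec algebra_simps)
  finally show ?thesis .
qed

lemma pair_vec_norm:
  assumes "j \<noteq> k" "z * cnj z = 1"
  shows "ip (pair_vec j k z) (pair_vec j k z) = 1"
  using quadratic_form_pair_vec[OF op_one, of j k z] assms
  by (simp add: unit_vec_l2 pair_vec_l2) (simp add: unit_vec_def)

text \<open>The requirement \<open>j < k\<close> keeps the initial coordinate real, as \<open>reflection\<close> demands.\<close>
definition test_vectors :: "(nat \<Rightarrow> complex) set" where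
  "test_vectors = unit_vec ` {0<..} \<union> (\<lambda>(j, k). pair_vec j k 1) ` {(j, k). j < k} \<union>
     (\<lambda>(j, k). pair_vec j k \<i>) ` {(j, k). j < k}"

lemma countable_test_vectors: "countable test_vectors"
  unfolding test_vectors_def by (intro countable_Un countable_image) auto

lemma test_vectors:
  assumes "v \<in> test_vectors"
  shows "v \<in> l2" "ip v v = 1" "v 0 \<in> \<real>" "v 0 \<noteq> 1"
proof -
  have *: "pair_vec j k z 0 \<in> \<real> \<and> pair_vec j k z 0 \<noteq> 1" if "j < k" for j k z
    using that by (auto simp: pair_vec_def unit_vec_def simp flip: of_real_divide) 
  show "v \<in> l2" "ip v v = 1" "v 0 \<in> \<real>" "v 0 \<noteq> 1"
    using assms * by (auto simp: test_vectors_def unit_vec_l2 pair_vec_l2 pair_vec_norm ip_unit_vec) (auto simp: unit_vec_def)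
qed

text \<open>Polarization. The diagonal entry at 0 is assumed separately because the initial basis vector is
  not a test vector.\<close>
lemma op_eq_0_if_quadratic_form_0:
  assumes T: "T \<in> ops" and 0: "T (unit_vec 0) 0 = 0"
    and q: "\<And>v. v \<in> test_vectors \<Longrightarrow> ip (T v) v = 0"
  shows "T = (\<lambda>x\<in>l2. \<lambda>n. 0)"
proof (rule op_eq_on_basis[OF T op_zero])
  have diag: "T (unit_vec j) j = 0" for j
    using q[of "unit_vec j"] 0 by (cases "j = 0") (auto simp: test_vectors_def ip_unit_vec)
  have off: "T (unit_vec j) k = 0 \<and> T (unit_vec k) j = 0" if "j < k" for j k
  proof -
    have "ip (T (pair_vec j k 1)) (pair_vec j k 1) = 0" "ip (T (pair_vec j k \<i>)) (pair_vec j k \<i>) = 0"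
      using that by (auto intro!: q simp: test_vectors_def)
    then have "T (unit_vec j) k + T (unit_vec k) j = 0" "- \<i> * T (unit_vec j) k + \<i> * T (unit_vec k) j = 0"
      using quadratic_form_pair_vec[OF T, of j k 1] quadratic_form_pair_vec[OF T, of j k \<i>] diag by auto
    then show ?thesis by (auto simp: add_eq_0_iff)
  qed
  show "T (unit_vec m) = (\<lambda>x\<in>l2. \<lambda>n. 0) (unit_vec m)" for m
  proof -
    have "T (unit_vec m) k = 0" for k
      using diag[of m] off[of m k] off[of k m] by (cases m k rule: linorder_cases) auto
    then show ?thesis by (simp add: unit_vec_l2 fun_eq_iff)
  qed
qed

section \<open>A group whose only equivariant map is the identity\<close>

text \<open>A residue class modulo 3 among the positive integers; these three classes partition the complement of 0.\<close>
definition residue_class :: "nat \<Rightarrow> nat set" where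
  "residue_class i = {n. 0 < n \<and> n mod 3 = i}"

lemma infinite_residue_class: "i < 3 \<Longrightarrow> infinite (residue_class i)"
proof -
  assume i: "i < 3"
  have "inj (\<lambda>k. 3 * (k + 1) + i)" by (rule injI) simp
  then have "infinite (range (\<lambda>k. 3 * (k + 1) + i))" by (simp add: finite_image_iff)
  moreover have "range (\<lambda>k. 3 * (k + 1) + i) \<subseteq> residue_class i"
  proof
    fix n assume "n \<in> range (\<lambda>k. 3 * (k + 1) + i)"
    then obtain k where "n = 3 * (k + 1) + i" by blast
    then have "0 < n" "n mod 3 = i" using i by presburger+
    then show "n \<in> residue_class i" by (simp add: residue_class_def)
  qed
  ultimately show ?thesis using finite_subset by blast
qed

text \<open>Involutions identifying the class of 0 with the union of the other two, and also all three classes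
  with each other. They fix 0.\<close>
definition paradoxical_swaps :: "(nat \<Rightarrow> nat) set" where
  "paradoxical_swaps = {swap_perm (residue_class 0) (residue_class 1 \<union> residue_class 2),
     swap_perm (residue_class 1) (residue_class 2), swap_perm (residue_class 0) (residue_class 1)}"

text \<open>All generators are self-adjoint unitaries, so the group consists of the words in them. The swaps fix
  the initial basis vector, the reflections carry it to the test vectors.\<close>
definition generators :: "((nat \<Rightarrow> complex) \<Rightarrow> nat \<Rightarrow> complex) set" where
  "generators = reindex ` paradoxical_swaps \<union> reflection ` test_vectors"

lemma countable_generators: "countable generators"
  unfolding generators_def paradoxical_swaps_def
  by (intro countable_Un countable_image countable_test_vectors) auto

lemma residue_class_disjoint: "i \<noteq> j \<Longrightarrow> residue_class i \<inter> residue_class j = {}"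
  by (auto simp: residue_class_def)

lemma residue_swaps:
  "infinite (residue_class 0)" "infinite (residue_class 1 \<union> residue_class 2)"
  "residue_class 0 \<inter> (residue_class 1 \<union> residue_class 2) = {}"
  "infinite (residue_class 1)" "infinite (residue_class 2)"
proof -
  show "infinite (residue_class 0)" "infinite (residue_class 1)" "infinite (residue_class 2)"
    by (rule infinite_residue_class, simp)+
  then show "infinite (residue_class 1 \<union> residue_class 2)" by blast
  show "residue_class 0 \<inter> (residue_class 1 \<union> residue_class 2) = {}" by (auto simp: residue_class_def)
qed

lemma paradoxical_swaps:
  assumes "\<sigma> \<in> paradoxical_swaps"
  shows "\<sigma> (\<sigma> n) = n" "\<sigma> 0 = 0"
  using assms residue_swaps residue_class_disjoint[of 1 2] residue_class_disjoint[of 0 1] unfolding paradoxical_swaps_def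
  by (auto simp: swap_perm(1)) (auto intro!: swap_perm(3) simp: residue_class_def)

lemma generators_symmetry: "U \<in> generators \<Longrightarrow> symmetry U"
  unfolding generators_def using symmetry_reindex paradoxical_swaps(1) symmetry_reflection(1) test_vectors by blast

lemma symmetryD:
  assumes "symmetry U"
  shows "U \<in> ops" "\<And>x. x \<in> l2 \<Longrightarrow> U (U x) = x" "\<And>x y. x \<in> l2 \<Longrightarrow> y \<in> l2 \<Longrightarrow> ip (U x) y = ip x (U y)"
  using assms by (auto simp: symmetry_def)

text \<open>Positivity through the quadratic form; on a complex Hilbert space it includes self-adjointness.\<close>
definition op_positive :: "((nat \<Rightarrow> complex) \<Rightarrow> nat \<Rightarrow> complex) \<Rightarrow> bool" where
  "op_positive T \<longleftrightarrow> (\<forall>x\<in>l2. ip (T x) x \<in> \<real>\<^sub>\<ge>\<^sub>0)"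

text \<open>What is needed of a \<open>\<Gamma>\<close>-map: of complete positivity only positivity, and equivariance only under
  the generators.\<close>
locale equivariant_map =
  fixes \<phi> :: "((nat \<Rightarrow> complex) \<Rightarrow> nat \<Rightarrow> complex) \<Rightarrow> (nat \<Rightarrow> complex) \<Rightarrow> nat \<Rightarrow> complex"
  assumes maps: "T \<in> ops \<Longrightarrow> \<phi> T \<in> ops"
    and additive: "S \<in> ops \<Longrightarrow> T \<in> ops \<Longrightarrow> \<phi> (\<lambda>x\<in>l2. \<lambda>n. S x n + T x n) = (\<lambda>x\<in>l2. \<lambda>n. \<phi> S x n + \<phi> T x n)"
    and homogeneous: "T \<in> ops \<Longrightarrow> \<phi> (\<lambda>x\<in>l2. \<lambda>n. c * T x n) = (\<lambda>x\<in>l2. \<lambda>n. c * \<phi> T x n)"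
    and unital: "\<phi> (\<lambda>x\<in>l2. x) = (\<lambda>x\<in>l2. x)"
    and positive: "T \<in> ops \<Longrightarrow> op_positive T \<Longrightarrow> op_positive (\<phi> T)"
    and equivariant: "U \<in> generators \<Longrightarrow> T \<in> ops \<Longrightarrow>
      \<phi> (compose l2 (compose l2 U T) U) = compose l2 (compose l2 U (\<phi> T)) U"
begin

text \<open>The vector state at the initial basis vector, pulled back along \<open>\<phi>\<close>.\<close>
definition pullback_state :: "((nat \<Rightarrow> complex) \<Rightarrow> nat \<Rightarrow> complex) \<Rightarrow> complex" where
  "pullback_state T = \<phi> T (unit_vec 0) 0"

lemma state_add: "S \<in> ops \<Longrightarrow> T \<in> ops \<Longrightarrow>
    pullback_state (\<lambda>x\<in>l2. \<lambda>n. S x n + T x n) = pullback_state S + pullback_state T"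
  by (simp add: pullback_state_def additive unit_vec_l2)

lemma state_scale: "T \<in> ops \<Longrightarrow> pullback_state (\<lambda>x\<in>l2. \<lambda>n. c * T x n) = c * pullback_state T"
  by (simp add: pullback_state_def homogeneous unit_vec_l2)

lemma state_one: "pullback_state (\<lambda>x\<in>l2. x) = 1"
  by (simp add: pullback_state_def unital unit_vec_l2) (simp add: unit_vec_def)

lemma state_positive: "T \<in> ops \<Longrightarrow> op_positive T \<Longrightarrow> pullback_state T \<in> \<real>\<^sub>\<ge>\<^sub>0"
  using positive[of T] unit_vec_l2[of 0] unfolding op_positive_def pullback_state_def ip_unit_vec[symmetric] by blast

text \<open>Conjugating by a generator moves the vector state.\<close>
lemma state_conjugate:
  assumes U: "U \<in> generators" and T: "T \<in> ops"
  shows "pullback_state (compose l2 (compose l2 U T) U) = ip (\<phi> T (U (unit_vec 0))) (U (unit_vec 0))"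
proof -
  note s = symmetryD[OF generators_symmetry[OF U]]
  have Ue: "U (unit_vec 0) \<in> l2" by (rule op_in[OF s(1) unit_vec_l2])
  have "pullback_state (compose l2 (compose l2 U T) U) = U (\<phi> T (U (unit_vec 0))) 0"
    unfolding pullback_state_def equivariant[OF U T] by (simp add: compose_def unit_vec_l2 Ue)
  also have "\<dots> = ip (U (\<phi> T (U (unit_vec 0)))) (unit_vec 0)" by (simp add: ip_unit_vec)
  also have "\<dots> = ip (\<phi> T (U (unit_vec 0))) (U (unit_vec 0))"
    by (intro s(3) unit_vec_l2 op_in[OF maps[OF T]] Ue)
  finally show ?thesis .
qed

text \<open>Conjugating by the permutation operator carries the projection for \<open>S\<close> to that for \<open>T\<close>.\<close>
lemma state_coord_proj_swap:
  assumes "swap_perm S T \<in> paradoxical_swaps" "infinite S" "infinite T" "S \<inter> T = {}"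
  shows "pullback_state (coord_proj S) = pullback_state (coord_proj T)"
proof -
  let ?\<sigma> = "swap_perm S T"
  note \<sigma> = paradoxical_swaps[OF assms(1)]
  have U: "reindex ?\<sigma> \<in> generators" using assms(1) by (auto simp: generators_def)
  have "compose l2 (compose l2 (reindex ?\<sigma>) (coord_proj S)) (reindex ?\<sigma>) = coord_proj T"
  proof (rule ext)
    fix x
    show "compose l2 (compose l2 (reindex ?\<sigma>) (coord_proj S)) (reindex ?\<sigma>) x = coord_proj T x"
    proof (cases "x \<in> l2")
      case True
      then have "(\<lambda>n. x (?\<sigma> n)) \<in> l2" by (rule reindex_l2(1)[OF \<sigma>(1)])
      then show ?thesis using True
        by (simp add: compose_def reindex_apply coord_proj_apply coord_proj_l2 \<sigma>(1) swap_perm(2)[OF assms(2-4)] cong: if_cong)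
    qed (simp add: compose_def coord_proj_def)
  qed
  then show ?thesis
    using state_conjugate[OF U coord_proj_ops[of S]]
    by (simp add: reindex_unit_vec \<sigma> ip_unit_vec) (simp add: pullback_state_def)
qed

text \<open>With \<open>a = b + c\<close>, \<open>b = c\<close> and \<open>a = b\<close> for the masses of the three residue classes, all vanish.\<close>
lemma state_coord_proj: "pullback_state (coord_proj {0<..}) = 0" "pullback_state (coord_proj {0}) = 1"
proof -
  define m where "m = (\<lambda>S. pullback_state (coord_proj S))"
  have Un: "m (S \<union> T) = m S + m T" if "S \<inter> T = {}" for S T
    by (simp add: m_def coord_proj_Un[OF that] state_add coord_proj_ops)
  have d12: "residue_class 1 \<inter> residue_class 2 = {}" by (simp add: residue_class_disjoint)
  have "m (residue_class 0) = m (residue_class 1 \<union> residue_class 2)"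
    unfolding m_def by (rule state_coord_proj_swap) (use residue_swaps in \<open>auto simp: paradoxical_swaps_def\<close>)
  then have 1: "m (residue_class 0) = m (residue_class 1) + m (residue_class 2)" using Un[OF d12] by simp
  have 2: "m (residue_class 1) = m (residue_class 2)"
    unfolding m_def by (rule state_coord_proj_swap) (use residue_swaps d12 in \<open>auto simp: paradoxical_swaps_def\<close>)
  have 3: "m (residue_class 0) = m (residue_class 1)"
    unfolding m_def by (rule state_coord_proj_swap) (use residue_swaps residue_class_disjoint[of 0 1] in \<open>auto simp: paradoxical_swaps_def\<close>)
  have "{0<..} = residue_class 0 \<union> (residue_class 1 \<union> residue_class 2)"
  proof (rule Set.set_eqI)
    fix n :: nat
    have "n mod 3 = 0 \<or> n mod 3 = 1 \<or> n mod 3 = 2" by linarith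
    then show "n \<in> {0<..} \<longleftrightarrow> n \<in> residue_class 0 \<union> (residue_class 1 \<union> residue_class 2)"
      by (auto simp: residue_class_def)
  qed
  then have "m {0<..} = 0" using Un[OF residue_swaps(3)] Un[OF d12] 1 2 3 by simp
  then show "pullback_state (coord_proj {0<..}) = 0" by (simp add: m_def)
  have "{0} \<union> {0<..} = (UNIV :: nat set)" by auto
  then have "m {0} + m {0<..} = 1"
    using Un[of "{0}" "{0<..}"] state_one by (simp add: m_def coord_proj_UNIV)
  then show "pullback_state (coord_proj {0}) = 1" using \<open>m {0<..} = 0\<close> by (simp add: m_def)
qed

text \<open>Since the complement of the initial projection has mass zero, the state is nearly nonnegative
  at a self-adjoint \<open>T\<close> with vanishing initial entry: \<open>- T\<close> is dominated by \<open>e p + C (1 - p)\<close>, which has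
  mass \<open>e\<close>, for \<open>p\<close> the initial projection.\<close>
lemma state_lower_bound:
  assumes T: "T \<in> ops" and sa: "\<And>x y. x \<in> l2 \<Longrightarrow> y \<in> l2 \<Longrightarrow> ip (T x) y = ip x (T y)"
    and 0: "T (unit_vec 0) 0 = 0" and e: "e > 0"
  shows "Im (pullback_state T) = 0" "- e \<le> Re (pullback_state T)"
proof -
  obtain K where K: "K \<ge> 0" "\<And>x. x \<in> l2 \<Longrightarrow> l2norm (T x) \<le> K * l2norm x"
    using op_bound[OF T] by metis
  \<comment> \<open>from \<open>2 K \<bar>c\<bar> b \<le> e \<bar>c\<bar>\<^sup>2 + (K\<^sup>2 / e) b\<^sup>2\<close>\<close>
  define C where "C = K\<^sup>2 / e + K"
  define E where "E = (\<lambda>x\<in>l2. \<lambda>n. of_real e * coord_proj {0} x n)"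
  define D where "D = (\<lambda>x\<in>l2. \<lambda>n. of_real C * coord_proj {0<..} x n)"
  have E: "E \<in> ops" and D: "D \<in> ops" unfolding E_def D_def by (intro op_smult coord_proj_ops)+
  define ED where "ED = (\<lambda>x\<in>l2. \<lambda>n. E x n + D x n)"
  have ED: "ED \<in> ops" unfolding ED_def by (rule op_plus[OF E D])
  define Q where "Q = (\<lambda>x\<in>l2. \<lambda>n. ED x n + T x n)"
  have Q: "Q \<in> ops" unfolding Q_def by (rule op_plus[OF ED T])
  have "op_positive Q" unfolding op_positive_def
  proof
    fix x assume x: "x \<in> l2"
    define h where "h = coord_proj {0<..} x"
    have h: "h \<in> l2" unfolding h_def by (rule op_in[OF coord_proj_ops x])
    define c where "c = x 0"
    define b where "b = l2norm h"
    have b: "b \<ge> 0" unfolding b_def by (rule l2norm_nonneg[OF h])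
    let ?u = "unit_vec 0"
    note u = unit_vec_l2[of 0]
    have cu: "coord_proj {0} x = (\<lambda>n. c * ?u n)"
      by (auto simp: coord_proj_apply[OF x] c_def unit_vec_def)
    have xd: "x = (\<lambda>n. c * ?u n + h n)"
      by (auto simp: h_def coord_proj_apply[OF x] c_def unit_vec_def)
    note Tu = op_in[OF T u] and Th = op_in[OF T h]
    have Tx: "T x = (\<lambda>n. c * T ?u n + T h n)"
      by (subst xd) (simp add: op_add[OF T l2_scale[OF u] h] op_scale[OF T u])
    have "ip (T x) x = ip (\<lambda>n. c * T ?u n) x + ip (T h) x"
      unfolding Tx by (rule ip_add_left[OF l2_scale[OF Tu] Th x])
    also have "ip (\<lambda>n. c * T ?u n) x = c * ip (T ?u) x" by (rule ip_scale_left[OF Tu x])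
    also have "ip (T ?u) x = ip (T ?u) h"
      by (subst xd) (simp add: ip_add_right[OF l2_scale[OF u] h Tu] ip_scale_right[OF u Tu] ip_unit_vec 0)
    also have "ip (T h) x = cnj c * T h 0 + ip (T h) h"
      by (subst xd) (simp add: ip_add_right[OF l2_scale[OF u] h Th] ip_scale_right[OF u Th] ip_unit_vec)
    finally have "cmod (ip (T x) x) = cmod (c * ip (T ?u) h + (cnj c * T h 0 + ip (T h) h))" by simp
    also have "\<dots> \<le> cmod (c * ip (T ?u) h) + (cmod (cnj c * T h 0) + cmod (ip (T h) h))"
      by (intro order_trans[OF norm_triangle_ineq] add_mono norm_triangle_ineq order_refl)
    also have "\<dots> \<le> cmod c * (K * b) + (cmod c * (K * b) + K * b * b)"
    proof (intro add_mono)
      have "l2norm ?u = 1"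
      proof -
        have "complex_of_real ((l2norm ?u)\<^sup>2) = 1"
          using ip_self[OF u] by (simp add: ip_unit_vec) (simp add: unit_vec_def)
        then have "(l2norm ?u)\<^sup>2 = 1" by (metis of_real_eq_1_iff)
        then show ?thesis using l2norm_nonneg[OF u] by (simp add: power2_eq_1_iff)
      qed
      then have "cmod (ip (T ?u) h) \<le> K * b"
        using ip_Cauchy_Schwarz[OF Tu h] mult_right_mono[OF K(2)[OF u] b] by (simp add: b_def)
      then show "cmod (c * ip (T ?u) h) \<le> cmod c * (K * b)" by (simp add: norm_mult mult_left_mono)
      have "cmod (T h 0) \<le> K * b" using component_le_l2norm[OF Th, of 0] K(2)[OF h] by (simp add: b_def)
      then show "cmod (cnj c * T h 0) \<le> cmod c * (K * b)" by (simp add: norm_mult mult_left_mono)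
      show "cmod (ip (T h) h) \<le> K * b * b"
        using ip_Cauchy_Schwarz[OF Th h] mult_right_mono[OF K(2)[OF h] b] by (simp add: b_def)
    qed
    also have "\<dots> \<le> e * (cmod c)\<^sup>2 + C * b\<^sup>2"
    proof -
      have "0 \<le> (e * cmod c - K * b)\<^sup>2 / e" using e by simp
      also have "\<dots> = e * (cmod c)\<^sup>2 - 2 * (cmod c * (K * b)) + K\<^sup>2 / e * b\<^sup>2"
        using e by (simp add: power2_eq_square field_simps)
      finally show ?thesis by (simp add: C_def power2_eq_square algebra_simps)
    qed
    finally have le: "cmod (ip (T x) x) \<le> e * (cmod c)\<^sup>2 + C * b\<^sup>2" .
    have "ip (T x) x = cnj (ip (T x) x)"
      using sa[OF x x] ip_commute[OF x op_in[OF T x]] by simp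
    then have im: "Im (ip (T x) x) = 0" by (metis complex_cnj_cancel_iff Reals_cnj_iff complex_is_Real_iff)
    have ipE: "ip (E x) x = of_real (e * (cmod c)\<^sup>2)"
    proof -
      have "ip (E x) x = of_real e * ip (coord_proj {0} x) x"
        using x by (simp add: E_def ip_scale_left op_in[OF coord_proj_ops])
      also have "ip (coord_proj {0} x) x = c * cnj c"
        unfolding cu ip_scale_left[OF u x] by (simp add: ip_unit_vec_left c_def)
      finally show ?thesis by (simp only: of_real_mult complex_norm_square)
    qed
    have ipD: "ip (D x) x = of_real (C * b\<^sup>2)"
    proof -
      have "ip (D x) x = of_real C * ip (coord_proj {0<..} x) x"
        using x by (simp add: D_def ip_scale_left op_in[OF coord_proj_ops])
      then show ?thesis by (simp add: ip_coord_proj[OF x] b_def h_def)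
    qed
    have "ip (ED x) x = ip (E x) x + ip (D x) x"
      using x ip_add_left[OF op_in[OF E x] op_in[OF D x] x] by (simp add: ED_def)
    moreover have "ip (Q x) x = ip (ED x) x + ip (T x) x"
      using x ip_add_left[OF op_in[OF ED x] op_in[OF T x] x] by (simp add: Q_def)
    ultimately have "ip (Q x) x = of_real (e * (cmod c)\<^sup>2 + C * b\<^sup>2) + ip (T x) x"
      by (simp add: ipE ipD)
    moreover have "- cmod (ip (T x) x) \<le> Re (ip (T x) x)" using abs_Re_le_cmod[of "ip (T x) x"] by linarith
    ultimately show "ip (Q x) x \<in> \<real>\<^sub>\<ge>\<^sub>0" using le im by (simp add: complex_nonneg_Reals_iff del: of_real_add)
  qed
  then have "pullback_state Q \<in> \<real>\<^sub>\<ge>\<^sub>0" by (rule state_positive[OF Q])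
  moreover have "pullback_state Q = of_real e + pullback_state T"
    unfolding Q_def state_add[OF ED T] unfolding ED_def state_add[OF E D]
    unfolding E_def D_def by (simp add: state_scale coord_proj_ops state_coord_proj)
  ultimately show "Im (pullback_state T) = 0" "- e \<le> Re (pullback_state T)"
    by (simp_all add: complex_nonneg_Reals_iff)
qed

lemma state_selfadjoint_zero:
  assumes T: "T \<in> ops" and sa: "\<And>x y. x \<in> l2 \<Longrightarrow> y \<in> l2 \<Longrightarrow> ip (T x) y = ip x (T y)"
    and 0: "T (unit_vec 0) 0 = 0"
  shows "pullback_state T = 0"
proof -
  define S where "S = (\<lambda>x\<in>l2. \<lambda>n. - 1 * T x n)"
  have S: "S \<in> ops" unfolding S_def by (rule op_smult[OF T])
  have saS: "ip (S x) y = ip x (S y)" if "x \<in> l2" "y \<in> l2" for x y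
    using that sa[OF that] ip_scale_left[OF op_in[OF T that(1)] that(2), of "- 1"]
      ip_scale_right[OF op_in[OF T that(2)] that(1), of "- 1"] by (simp add: S_def)
  have S0: "S (unit_vec 0) 0 = 0" by (simp add: S_def 0 unit_vec_l2)
  have mS: "pullback_state S = - pullback_state T" unfolding S_def state_scale[OF T] by simp
  have le: "Re (pullback_state T) \<ge> - e \<and> Re (pullback_state T) \<le> e" if "e > 0" for e
    using state_lower_bound(2)[OF T sa 0 that] state_lower_bound(2)[OF S saS S0 that] mS by simp
  have "Re (pullback_state T) = 0"
    using le[of "\<bar>Re (pullback_state T)\<bar> / 2"] by (cases "Re (pullback_state T) = 0") auto
  then show ?thesis using state_lower_bound(1)[OF T sa 0, of 1] by (simp add: complex_eq_iff)
qed

lemma state_selfadjoint: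
  assumes T: "T \<in> ops" and sa: "\<And>x y. x \<in> l2 \<Longrightarrow> y \<in> l2 \<Longrightarrow> ip (T x) y = ip x (T y)"
  shows "pullback_state T = T (unit_vec 0) 0"
proof -
  define a where "a = T (unit_vec 0) 0"
  have ra: "cnj a = a"
    using sa[OF unit_vec_l2 unit_vec_l2, of 0 0] by (simp add: a_def ip_unit_vec ip_unit_vec_left)
  define A where "A = (\<lambda>x\<in>l2. \<lambda>n. - a * (\<lambda>x\<in>l2. x) x n)"
  have A: "A \<in> ops" unfolding A_def by (rule op_smult[OF op_one])
  define S where "S = (\<lambda>x\<in>l2. \<lambda>n. T x n + A x n)"
  have S: "S \<in> ops" unfolding S_def by (rule op_plus[OF T A])
  have "pullback_state S = 0"
  proof (rule state_selfadjoint_zero[OF S])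
    fix x y assume xy: "x \<in> l2" "y \<in> l2"
    have "ip (A x) y = ip x (A y)"
      using xy by (simp add: A_def ip_scale_left[of _ _ "- a", simplified] ip_scale_right[of _ _ "- a", simplified] ra)
    then show "ip (S x) y = ip x (S y)"
      using xy sa[OF xy] by (simp add: S_def ip_add_left ip_add_right op_in[OF T] op_in[OF A])
  next
    show "S (unit_vec 0) 0 = 0"
      by (simp add: S_def A_def unit_vec_l2 a_def) (simp add: unit_vec_def)
  qed
  moreover have "pullback_state S = pullback_state T + - a * 1"
    unfolding S_def state_add[OF T A] unfolding A_def state_scale[OF op_one] state_one ..
  ultimately show ?thesis by (simp add: a_def)
qed

lemma state_eq:
  assumes T: "T \<in> ops"
  shows "pullback_state T = T (unit_vec 0) 0"
proof -
  obtain R where R: "R \<in> ops" and adj: "\<And>x y. x \<in> l2 \<Longrightarrow> y \<in> l2 \<Longrightarrow> ip (T x) y = ip x (R y)"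
    using adjoint_exists[OF T] by metis
  have adj': "ip (R x) y = ip x (T y)" if "x \<in> l2" "y \<in> l2" for x y
    using adj[OF that(2,1)] ip_commute[OF op_in[OF T that(2)] that(1)] ip_commute[OF that(2) op_in[OF R that(1)]] by simp
  define A where "A = (\<lambda>x\<in>l2. \<lambda>n. T x n + R x n)"
  define M where "M = (\<lambda>x\<in>l2. \<lambda>n. (- 1) * R x n)"
  define N where "N = (\<lambda>x\<in>l2. \<lambda>n. T x n + M x n)"
  define B where "B = (\<lambda>x\<in>l2. \<lambda>n. \<i> * N x n)"
  have A: "A \<in> ops" unfolding A_def by (rule op_plus[OF T R])
  have M: "M \<in> ops" unfolding M_def by (rule op_smult[OF R])
  have N: "N \<in> ops" unfolding N_def by (rule op_plus[OF T M])
  have B: "B \<in> ops" unfolding B_def by (rule op_smult[OF N])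
  have "ip (A x) y = ip x (A y)" if xy: "x \<in> l2" "y \<in> l2" for x y
    using xy adj[OF xy] adj'[OF xy] by (simp add: A_def ip_add_left ip_add_right op_in[OF T] op_in[OF R])
  then have a: "pullback_state A = A (unit_vec 0) 0" by (rule state_selfadjoint[OF A])
  have N': "N x = (\<lambda>n. T x n - R x n)" if "x \<in> l2" for x using that by (simp add: N_def M_def)
  have "ip (B x) y = ip x (B y)" if xy: "x \<in> l2" "y \<in> l2" for x y
  proof -
    have "ip (N x) y = - ip x (N y)"
      using xy adj[OF xy] adj'[OF xy] by (simp add: N' ip_diff_left ip_diff_right op_in[OF T] op_in[OF R])
    then show ?thesis using xy
      by (simp add: B_def ip_scale_left[OF op_in[OF N xy(1)] xy(2)] ip_scale_right[OF op_in[OF N xy(2)] xy(1)])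
  qed
  then have b: "pullback_state B = B (unit_vec 0) 0" by (rule state_selfadjoint[OF B])
  have "pullback_state A = pullback_state T + pullback_state R" unfolding A_def by (rule state_add[OF T R])
  moreover have "pullback_state B = \<i> * (pullback_state T - pullback_state R)"
    unfolding B_def state_scale[OF N] unfolding N_def state_add[OF T M] unfolding M_def state_scale[OF R] by simp
  ultimately have "pullback_state T + pullback_state R = T (unit_vec 0) 0 + R (unit_vec 0) 0"
    "pullback_state T - pullback_state R = T (unit_vec 0) 0 - R (unit_vec 0) 0"
    using a b by (simp_all add: A_def B_def N' unit_vec_l2)
  then show ?thesis by (simp add: complex_eq_iff)
qed

theorem equivariant_map_eq:
  assumes T: "T \<in> ops"
  shows "\<phi> T = T"
proof -
  define D where "D = (\<lambda>x\<in>l2. \<lambda>n. \<phi> T x n - T x n)"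
  have D: "D \<in> ops" unfolding D_def by (rule op_minus[OF maps[OF T] T])
  have "D = (\<lambda>x\<in>l2. \<lambda>n. 0)"
  proof (rule op_eq_0_if_quadratic_form_0[OF D])
    show "D (unit_vec 0) 0 = 0"
      using state_eq[OF T] by (simp add: D_def unit_vec_l2 pullback_state_def)
    fix v assume v: "v \<in> test_vectors"
    note tv = test_vectors[OF v]
    let ?U = "reflection v"
    have U: "?U \<in> generators" using v by (auto simp: generators_def)
    note s = symmetryD[OF generators_symmetry[OF U]] and e = symmetry_reflection(2)[OF tv]
    let ?C = "compose l2 (compose l2 ?U T) ?U"
    have C: "?C \<in> ops" by (intro op_compose s(1) T)
    have "ip (\<phi> T v) v = pullback_state ?C" using state_conjugate[OF U T] by (simp add: e)
    also have "\<dots> = ?C (unit_vec 0) 0" by (rule state_eq[OF C])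
    also have "\<dots> = ?U (T v) 0" by (simp add: compose_def unit_vec_l2 e tv(1))
    also have "\<dots> = ip (?U (T v)) (unit_vec 0)" by (simp add: ip_unit_vec)
    also have "\<dots> = ip (T v) v" using s(3)[OF op_in[OF T tv(1)] unit_vec_l2, of 0] by (simp add: e)
    finally show "ip (D v) v = 0"
      using tv(1) by (simp add: D_def ip_diff_left op_in[OF T] op_in[OF maps[OF T]])
  qed
  then have "\<phi> T x n - T x n = 0" if "x \<in> l2" for x n
    using fun_cong[of D "\<lambda>x\<in>l2. \<lambda>n. 0" x] that by (simp add: D_def fun_eq_iff)
  then show ?thesis by (intro op_ext[OF maps[OF T] T] ext) simp
qed

end

section \<open>The generated group and its boundary\<close>

text \<open>The product of a word of operators. The inverse and adjoint of a word in the generators is the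
  reversed word.\<close>
definition word_op :: "((nat \<Rightarrow> complex) \<Rightarrow> nat \<Rightarrow> complex) list \<Rightarrow> (nat \<Rightarrow> complex) \<Rightarrow> nat \<Rightarrow> complex" where
  "word_op ws = foldr (compose l2) ws (\<lambda>x\<in>l2. x)"

lemma word_op_Nil: "x \<in> l2 \<Longrightarrow> word_op [] x = x"
  by (simp add: word_op_def)

lemma word_op_Cons: "x \<in> l2 \<Longrightarrow> word_op (U # ws) x = U (word_op ws x)"
  by (simp add: word_op_def compose_def)

lemma word_op_ops: "ws \<in> lists generators \<Longrightarrow> word_op ws \<in> ops"
proof (induction ws)
  case Nil
  show ?case unfolding word_op_def by (simp only: foldr.simps id_apply op_one)
next
  case (Cons U ws)
  then have "U \<in> ops" "word_op ws \<in> ops" using symmetryD(1)[OF generators_symmetry] by auto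
  then show ?case using op_compose[of U "word_op ws"] by (simp add: word_op_def)
qed

lemma word_op_append_apply:
  assumes "ws \<in> lists generators" "vs \<in> lists generators" "x \<in> l2"
  shows "word_op (ws @ vs) x = word_op ws (word_op vs x)"
  using assms(1)
proof (induction ws)
  case Nil
  show ?case using op_in[OF word_op_ops[OF assms(2)] assms(3)] by (simp add: word_op_Nil)
next
  case (Cons U ws)
  then show ?case
    using op_in[OF word_op_ops[OF assms(2)] assms(3)] assms(3) by (simp add: word_op_Cons)
qed

lemma word_op_append:
  assumes "ws \<in> lists generators" "vs \<in> lists generators"
  shows "word_op (ws @ vs) = compose l2 (word_op ws) (word_op vs)"
proof (rule op_ext)
  show "word_op (ws @ vs) \<in> ops" using assms by (intro word_op_ops) simp
  show "compose l2 (word_op ws) (word_op vs) \<in> ops" using assms by (intro op_compose word_op_ops)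
  show "word_op (ws @ vs) x = compose l2 (word_op ws) (word_op vs) x" if "x \<in> l2" for x
    using word_op_append_apply[OF assms that] that by (simp add: compose_def)
qed

lemma word_op_rev_Cons:
  assumes "U \<in> generators" "ws \<in> lists generators" "x \<in> l2"
  shows "word_op (rev (U # ws)) x = word_op (rev ws) (U x)"
proof -
  have "rev ws \<in> lists generators" "[U] \<in> lists generators" using assms by auto
  from word_op_append_apply[OF this assms(3)] show ?thesis
    using assms(3) by (simp add: word_op_Cons word_op_Nil)
qed

lemma word_op_rev_apply:
  "ws \<in> lists generators \<Longrightarrow> x \<in> l2 \<Longrightarrow> word_op ws (word_op (rev ws) x) = x"
proof (induction ws arbitrary: x)
  case Nil
  then show ?case by (simp add: word_op_Nil)
next
  case (Cons U ws)
  then have U: "U \<in> generators" and ws: "ws \<in> lists generators" by auto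
  note s = symmetryD[OF generators_symmetry[OF U]]
  have Ux: "U x \<in> l2" by (rule op_in[OF s(1) Cons.prems(2)])
  have rws: "rev ws \<in> lists generators" using ws by auto
  have "word_op (rev ws) (U x) \<in> l2" by (rule op_in[OF word_op_ops[OF rws] Ux])
  then show ?case
    unfolding word_op_rev_Cons[OF U ws Cons.prems(2)]
    using Cons.IH[OF ws Ux] s(2)[OF Cons.prems(2)] by (simp add: word_op_Cons)
qed

lemma word_op_rev_adjoint:
  "ws \<in> lists generators \<Longrightarrow> x \<in> l2 \<Longrightarrow> y \<in> l2 \<Longrightarrow> ip (word_op ws x) y = ip x (word_op (rev ws) y)"
proof (induction ws arbitrary: x y)
  case Nil
  then show ?case by (simp add: word_op_Nil)
next
  case (Cons U ws)
  then have U: "U \<in> generators" and ws: "ws \<in> lists generators" by auto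
  note s = symmetryD[OF generators_symmetry[OF U]] and x = Cons.prems(2) and y = Cons.prems(3)
  have Uy: "U y \<in> l2" by (rule op_in[OF s(1) y])
  have wx: "word_op ws x \<in> l2" by (rule op_in[OF word_op_ops[OF ws] x])
  show ?case
    unfolding word_op_rev_Cons[OF U ws y] word_op_Cons[OF x] s(3)[OF wx y] by (rule Cons.IH[OF ws x Uy])
qed

text \<open>The group of unitaries generated by the generators.\<close>
definition word_ops :: "((nat \<Rightarrow> complex) \<Rightarrow> nat \<Rightarrow> complex) set" where
  "word_ops = word_op ` lists generators"

lemma countable_word_ops: "countable word_ops"
  unfolding word_ops_def by (intro countable_image countable_lists countable_generators)

lemma word_ops_ops: "T \<in> word_ops \<Longrightarrow> T \<in> ops"
  unfolding word_ops_def using word_op_ops by blast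

lemma word_ops_compose: "S \<in> word_ops \<Longrightarrow> T \<in> word_ops \<Longrightarrow> compose l2 S T \<in> word_ops"
proof -
  assume "S \<in> word_ops" "T \<in> word_ops"
  then obtain ws vs where w: "ws \<in> lists generators" "S = word_op ws" "vs \<in> lists generators" "T = word_op vs"
    unfolding word_ops_def by blast
  then have "ws @ vs \<in> lists generators" by simp
  then show ?thesis unfolding w(2,4) word_op_append[OF w(1,3), symmetric] word_ops_def by (rule imageI)
qed

lemma word_ops_one: "(\<lambda>x\<in>l2. x) \<in> word_ops"
  unfolding word_ops_def by (rule image_eqI[of _ _ "[]"]) (auto simp: word_op_def)

lemma generators_word_ops: "U \<in> generators \<Longrightarrow> U \<in> word_ops"
proof -
  assume U: "U \<in> generators"
  have "word_op [U] = U"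
    by (rule op_ext) (use U word_op_ops symmetryD(1)[OF generators_symmetry[OF U]] in \<open>auto simp: word_op_Cons word_op_Nil\<close>)
  then show ?thesis unfolding word_ops_def using U by (intro image_eqI[of _ _ "[U]"]) auto
qed

lemma word_ops_inverse:
  assumes "T \<in> word_ops"
  obtains S where "S \<in> word_ops" "compose l2 S T = (\<lambda>x\<in>l2. x)" "compose l2 T S = (\<lambda>x\<in>l2. x)" "op_adj l2_hilbert T = S"
proof -
  obtain ws where ws: "ws \<in> lists generators" "T = word_op ws" using assms by (auto simp: word_ops_def)
  then have rws: "rev ws \<in> lists generators" by auto
  show ?thesis
  proof (rule that[of "word_op (rev ws)"])
    show "word_op (rev ws) \<in> word_ops" using rws by (auto simp: word_ops_def)
    show "compose l2 (word_op (rev ws)) T = (\<lambda>x\<in>l2. x)"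
      unfolding ws compose_def using word_op_rev_apply[OF rws] by (intro restrict_ext) simp
    show "compose l2 T (word_op (rev ws)) = (\<lambda>x\<in>l2. x)"
      unfolding ws compose_def using word_op_rev_apply[OF ws(1)] by (intro restrict_ext) simp
    show "op_adj l2_hilbert T = word_op (rev ws)"
      unfolding ws by (rule op_adj_eq[OF word_op_ops[OF rws] word_op_rev_adjoint[OF ws(1)]])
  qed
qed

lemma compose_one_left: "T \<in> ops \<Longrightarrow> compose l2 (\<lambda>x\<in>l2. x) T = T"
  by (rule op_ext[OF op_compose[OF op_one]]) (simp_all add: compose_def op_in)

lemma compose_op_assoc: 
  assumes "R \<in> ops" "S \<in> ops" "T \<in> ops"
  shows "compose l2 (compose l2 R S) T = compose l2 R (compose l2 S T)"
proof (rule op_ext)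
  show "compose l2 (compose l2 R S) T \<in> ops" "compose l2 R (compose l2 S T) \<in> ops"
    by (simp_all add: op_compose assms)
  show "compose l2 (compose l2 R S) T x = compose l2 R (compose l2 S T) x" if "x \<in> l2" for x
    using that op_in[OF assms(3) that] by (simp add: compose_def)
qed

text \<open>The group generated by the generators, transported to the natural numbers.\<close>
definition word_group :: "nat monoid" where
  "word_group = \<lparr>carrier = to_nat_on word_ops ` word_ops,
     monoid.mult = (\<lambda>m n. to_nat_on word_ops (compose l2 (from_nat_into word_ops m) (from_nat_into word_ops n))),
     one = to_nat_on word_ops (\<lambda>x\<in>l2. x)\<rparr>"

abbreviation "word_rep \<equiv> from_nat_into word_ops"

lemma word_rep_code: "T \<in> word_ops \<Longrightarrow> word_rep (to_nat_on word_ops T) = T"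
  by (rule from_nat_into_to_nat_on[OF countable_word_ops])

lemma word_group_simps:
  "carrier word_group = to_nat_on word_ops ` word_ops"
  "m \<otimes>\<^bsub>word_group\<^esub> n = to_nat_on word_ops (compose l2 (word_rep m) (word_rep n))"
  "\<one>\<^bsub>word_group\<^esub> = to_nat_on word_ops (\<lambda>x\<in>l2. x)"
  by (simp_all add: word_group_def)

lemma group_word_group: "group word_group"
proof (rule groupI)
  fix m assume "m \<in> carrier word_group"
  then obtain T where T: "T \<in> word_ops" "m = to_nat_on word_ops T" by (auto simp: word_group_simps)
  then show "\<one>\<^bsub>word_group\<^esub> \<otimes>\<^bsub>word_group\<^esub> m = m"
    by (simp add: word_group_simps word_rep_code word_ops_one compose_one_left word_ops_ops)
  obtain S where S: "S \<in> word_ops" "compose l2 S T = (\<lambda>x\<in>l2. x)" using word_ops_inverse[OF T(1)] by metis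
  then show "\<exists>y\<in>carrier word_group. y \<otimes>\<^bsub>word_group\<^esub> m = \<one>\<^bsub>word_group\<^esub>"
    using T by (intro bexI[of _ "to_nat_on word_ops S"]) (simp_all add: word_group_simps word_rep_code)
qed (auto simp: word_group_simps word_rep_code word_ops_compose word_ops_one compose_op_assoc word_ops_ops)

lemma word_rep_hom: "word_rep \<in> hom word_group (unitary_group l2_hilbert)"
proof (rule homI)
  fix m assume "m \<in> carrier word_group"
  then obtain T where T: "T \<in> word_ops" "m = to_nat_on word_ops T" by (auto simp: word_group_simps)
  obtain S where "S \<in> word_ops" "compose l2 S T = (\<lambda>x\<in>l2. x)" "compose l2 T S = (\<lambda>x\<in>l2. x)" "op_adj l2_hilbert T = S"
    using word_ops_inverse[OF T(1)] by metis
  then show "word_rep m \<in> carrier (unitary_group l2_hilbert)"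
    using T by (simp add: unitary_group_def word_rep_code word_ops_ops)
qed (auto simp: word_group_simps unitary_group_def word_rep_code word_ops_compose)

lemma gamma_act_generator:
  assumes U: "U \<in> generators"
  shows "gamma_act word_group l2_hilbert word_rep (to_nat_on word_ops U) T = compose l2 (compose l2 U T) U"
proof -
  note s = symmetryD[OF generators_symmetry[OF U]] and w = generators_word_ops[OF U]
  have "compose l2 U U = (\<lambda>x\<in>l2. x)" unfolding compose_def using s(2) by (intro restrict_ext)
  then have "to_nat_on word_ops U \<otimes>\<^bsub>word_group\<^esub> to_nat_on word_ops U = \<one>\<^bsub>word_group\<^esub>"
    using w by (simp add: word_group_simps word_rep_code)
  then have "inv\<^bsub>word_group\<^esub> (to_nat_on word_ops U) = to_nat_on word_ops U"
    using w by (intro group.inv_equality[OF group_word_group]) (auto simp: word_group_simps)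
  then show ?thesis using w by (simp add: gamma_act_def word_rep_code)
qed

lemma gamma_maps_word_group: "gamma_maps word_group l2_hilbert word_rep = {\<lambda>T\<in>ops. T}"
proof (intro equalityI subsetI)
  fix \<phi> assume "\<phi> \<in> gamma_maps word_group l2_hilbert word_rep"
  then have \<phi>: "\<phi> \<in> ops \<rightarrow>\<^sub>E ops"
    "\<And>S T. S \<in> ops \<Longrightarrow> T \<in> ops \<Longrightarrow> \<phi> (\<lambda>x\<in>l2. \<lambda>n. S x n + T x n) = (\<lambda>x\<in>l2. \<lambda>n. \<phi> S x n + \<phi> T x n)"
    "\<And>c T. T \<in> ops \<Longrightarrow> \<phi> (\<lambda>x\<in>l2. \<lambda>n. c * T x n) = (\<lambda>x\<in>l2. \<lambda>n. c * \<phi> T x n)"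
    "\<phi> (\<lambda>x\<in>l2. x) = (\<lambda>x\<in>l2. x)" "completely_positive l2_hilbert \<phi>"
    "\<And>g T. g \<in> carrier word_group \<Longrightarrow> T \<in> ops \<Longrightarrow>
      \<phi> (gamma_act word_group l2_hilbert word_rep g T) = gamma_act word_group l2_hilbert word_rep g (\<phi> T)"
    unfolding gamma_maps_def by auto
  interpret equivariant_map \<phi>
  proof
    fix T assume T: "T \<in> ops" and "op_positive T"
    then have "op_matrix_positive l2_hilbert 1 (\<lambda>i j. T)" by (simp only: op_positive_def op_matrix_positive_1)
    then have "op_matrix_positive l2_hilbert 1 (\<lambda>i j. \<phi> T)"
      using \<phi>(5)[unfolded completely_positive_def, rule_format, of 1 "\<lambda>i j. T"] T by simp
    then show "op_positive (\<phi> T)" by (simp only: op_positive_def op_matrix_positive_1)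
  next
    fix U T assume U: "U \<in> generators" and T: "T \<in> ops"
    have "to_nat_on word_ops U \<in> carrier word_group" using generators_word_ops[OF U] by (auto simp: word_group_simps)
    from \<phi>(6)[OF this T] show "\<phi> (compose l2 (compose l2 U T) U) = compose l2 (compose l2 U (\<phi> T)) U"
      by (simp only: gamma_act_generator[OF U])
  qed (use \<phi> in auto)
  have "\<phi> = (\<lambda>T\<in>ops. T)"
    by (rule PiE_ext[OF \<phi>(1)]) (auto simp: equivariant_map_eq)
  then show "\<phi> \<in> {\<lambda>T\<in>ops. T}" by simp
next
  fix \<phi> :: "((nat \<Rightarrow> complex) \<Rightarrow> nat \<Rightarrow> complex) \<Rightarrow> (nat \<Rightarrow> complex) \<Rightarrow> nat \<Rightarrow> complex"
  assume "\<phi> \<in> {\<lambda>T\<in>ops. T}"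
  then have \<phi>: "\<phi> = (\<lambda>T\<in>ops. T)" by simp
  have "completely_positive l2_hilbert \<phi>"
    unfolding completely_positive_def
  proof (intro allI impI)
    fix n a assume a: "\<forall>i<n. \<forall>j<n. a i j \<in> ops" and p: "op_matrix_positive l2_hilbert n a"
    have "(\<Sum>i<n. \<Sum>j<n. cinner l2_hilbert (\<phi> (a i j) (\<xi> j)) (\<xi> i)) = (\<Sum>i<n. \<Sum>j<n. cinner l2_hilbert (a i j (\<xi> j)) (\<xi> i))" for \<xi>
      using a by (intro sum.cong refl) (simp add: \<phi>)
    then show "op_matrix_positive l2_hilbert n (\<lambda>i j. \<phi> (a i j))" using p by (simp only: op_matrix_positive_def)
  qed
  moreover have "gamma_act word_group l2_hilbert word_rep g T \<in> ops" if "g \<in> carrier word_group" "T \<in> ops" for g T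
  proof -
    have "inv\<^bsub>word_group\<^esub> g \<in> carrier word_group" by (rule group.inv_closed[OF group_word_group that(1)])
    then have "word_rep g \<in> ops" "word_rep (inv\<^bsub>word_group\<^esub> g) \<in> ops"
      using that(1) word_rep_hom by (auto simp: hom_def unitary_group_def Pi_def)
    then show ?thesis using that(2) by (simp add: gamma_act_def op_compose)
  qed
  ultimately show "\<phi> \<in> gamma_maps word_group l2_hilbert word_rep"
    unfolding gamma_maps_def by (simp add: \<phi> op_plus op_smult op_one)
qed

lemma is_FH_boundary_word_group:
  "is_FH_boundary word_group l2_hilbert word_rep B \<longleftrightarrow> B = choi_effros l2_hilbert (\<lambda>T\<in>ops. T)"
  by (simp add: is_FH_boundary_def minimal_gamma_map_def gamma_maps_word_group gamma_map_le_def)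

lemma choi_effros_l2:
  defines "B \<equiv> choi_effros l2_hilbert (\<lambda>T\<in>ops. T)"
  shows "carrier B = ops" "\<And>S T. S \<in> ops \<Longrightarrow> T \<in> ops \<Longrightarrow> S \<otimes>\<^bsub>B\<^esub> T = compose l2 S T"
    "\<And>S T. S \<oplus>\<^bsub>B\<^esub> T = (\<lambda>x\<in>l2. \<lambda>n. S x n + T x n)" "\<And>c T. c \<odot>\<^bsub>B\<^esub> T = (\<lambda>x\<in>l2. \<lambda>n. c * T x n)"
    "\<zero>\<^bsub>B\<^esub> = (\<lambda>x\<in>l2. \<lambda>n. 0)" "adj B = op_adj l2_hilbert" "nrm B = op_norm l2_hilbert"
  unfolding B_def choi_effros_def by (simp_all add: op_compose)

section \<open>The GNS representation of a faithful positive functional\<close>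

text \<open>The real part of a faithful positive functional, together with a dense sequence.\<close>
locale faithful_functional =
  fixes f :: "'a::unital_cstar_algebra \<Rightarrow> real" and a :: "nat \<Rightarrow> 'a"
  assumes functional: "positive_real_functional f"
    and bounded: "\<bar>f x\<bar> \<le> 2 * norm x"
    and faithful: "x \<noteq> 0 \<Longrightarrow> 0 < f (x\<^sup>\<star> * x)"
    and dense: "closure (range a) = UNIV"
begin

text \<open>The complex-linear functional with real part \<open>f\<close>.\<close>
definition F :: "'a \<Rightarrow> complex" where
  "F x = Complex (f x) (- f (\<i> *\<^sub>C x))"

lemma linear_f: "linear f"
  using functional by (simp add: positive_real_functional_def)

lemma f_positive: "h \<in> positive_cone \<Longrightarrow> 0 \<le> f h"
  using functional by (simp add: positive_real_functional_def)

lemma f_imaginary: "h\<^sup>\<star> = h \<Longrightarrow> f (\<i> *\<^sub>C h) = 0"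
  using functional by (simp add: positive_real_functional_def)

lemma F_add: "F (x + y) = F x + F y"
  by (simp add: F_def scaleC_add_right linear_add[OF linear_f] complex_eq_iff)

lemma f_scaleC: "f (c *\<^sub>C x) = Re c * f x + Im c * f (\<i> *\<^sub>C x)"
proof -
  have "c *\<^sub>C x = Re c *\<^sub>R x + Im c *\<^sub>R (\<i> *\<^sub>C x)"
    unfolding scaleR_scaleC scaleC_scaleC scaleC_add_left[symmetric]
    by (rule arg_cong[of _ _ "\<lambda>c. c *\<^sub>C x"]) (simp add: complex_eq_iff)
  then show ?thesis by (simp add: linear_add[OF linear_f] linear_scale[OF linear_f])
qed

lemma F_scaleC: "F (c *\<^sub>C x) = c * F x"
  unfolding F_def scaleC_scaleC f_scaleC[of c] f_scaleC[of "\<i> * c"]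
  by (simp add: complex_eq_iff algebra_simps)

lemma f_star: "f (x\<^sup>\<star>) = f x"
proof -
  define h where "h = (- \<i>) *\<^sub>C (x - x\<^sup>\<star>)"
  have "h\<^sup>\<star> = \<i> *\<^sub>C (x\<^sup>\<star> - x)" by (simp add: h_def star_scaleC star_diff star_star)
  then have h: "h\<^sup>\<star> = h"
    by (metis h_def minus_diff_eq scaleC_minus_left scaleC_minus_right)
  have "\<i> *\<^sub>C h = x - x\<^sup>\<star>" by (simp add: h_def scaleC_scaleC scaleC_one)
  then show ?thesis using f_imaginary[OF h] by (simp add: linear_diff[OF linear_f])
qed

lemma F_star: "F (x\<^sup>\<star>) = cnj (F x)"
proof -
  have "f (\<i> *\<^sub>C x\<^sup>\<star>) = f (- ((\<i> *\<^sub>C x)\<^sup>\<star>))" by (simp add: star_scaleC scaleC_minus_left)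
  then show ?thesis by (simp add: F_def f_star linear_neg[OF linear_f] complex_eq_iff)
qed

text \<open>The GNS inner product and its quadratic form.\<close>
definition form :: "'a \<Rightarrow> 'a \<Rightarrow> complex" where
  "form x y = F (y\<^sup>\<star> * x)"

definition sqnorm :: "'a \<Rightarrow> real" where
  "sqnorm x = f (x\<^sup>\<star> * x)"

lemma form_add_left: "form (x + y) z = form x z + form y z"
  by (simp add: form_def distrib_left F_add)

lemma form_scale_left: "form (c *\<^sub>C x) z = c * form x z"
  by (simp add: form_def scaleC_mult_right F_scaleC)

lemma form_commute: "form y x = cnj (form x y)"
  by (simp add: form_def star_mult star_star flip: F_star)

lemma form_add_right: "form z (x + y) = form z x + form z y"
  by (simp add: form_def distrib_right F_add star_add)

lemma form_scale_right: "form z (c *\<^sub>C x) = cnj c * form z x"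
  by (simp add: form_def star_scaleC scaleC_mult_left F_scaleC)

lemma form_mult: "form (b * x) y = form x (b\<^sup>\<star> * y)"
  by (simp add: form_def star_mult star_star mult.assoc)

lemma form_zero: "form 0 z = 0" "form z 0 = 0"
  using form_scale_left[of 0 0 z] form_scale_right[of z 0 0] by simp_all

lemma form_diff_left: "form (x - y) z = form x z - form y z"
  using form_add_left[of "x - y" y z] by simp

lemma form_diff_right: "form z (x - y) = form z x - form z y"
  using form_add_right[of z "x - y" y] by simp

lemma form_sum_left: "form (\<Sum>k<(n::nat). c k *\<^sub>C u k) z = (\<Sum>k<n. c k * form (u k) z)"
  by (induction n) (simp_all add: form_zero form_add_left form_scale_left)

lemma form_sum_right: "form z (\<Sum>k<(n::nat). c k *\<^sub>C u k) = (\<Sum>k<n. cnj (c k) * form z (u k))"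
  by (induction n) (simp_all add: form_zero form_add_right form_scale_right)

lemma form_self: "form x x = of_real (sqnorm x)"
proof -
  have "(x\<^sup>\<star> * x)\<^sup>\<star> = x\<^sup>\<star> * x" by (simp add: star_mult star_star)
  then show ?thesis by (simp add: form_def F_def sqnorm_def f_imaginary complex_eq_iff)
qed

lemma sqnorm_nonneg: "0 \<le> sqnorm x"
  unfolding sqnorm_def by (rule f_positive[OF star_mult_self_positive])

lemma sqnorm_eq_0: "sqnorm x = 0 \<Longrightarrow> x = 0"
  unfolding sqnorm_def using faithful by force

lemma sqnorm_le: "sqnorm x \<le> 2 * (norm x)\<^sup>2"
  unfolding sqnorm_def using bounded[of "x\<^sup>\<star> * x"] by (simp add: cstar_identity)

lemma sqnorm_mult_le: "sqnorm (b * x) \<le> (norm b)\<^sup>2 * sqnorm x"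
proof -
  have "(norm b)\<^sup>2 *\<^sub>R 1 - b\<^sup>\<star> * b \<in> positive_cone"
    by (rule positive_upper(2)[OF star_mult_self_positive]) (simp add: cstar_identity)
  then obtain k where k: "k \<in> positive_cone" "k * k = (norm b)\<^sup>2 *\<^sub>R 1 - b\<^sup>\<star> * b"
    by (rule positive_sqrt)
  have "(k * x)\<^sup>\<star> * (k * x) = x\<^sup>\<star> * (k * k) * x"
    by (simp add: star_mult positive_selfadjoint[OF k(1)] mult.assoc)
  also have "\<dots> = (norm b)\<^sup>2 *\<^sub>R (x\<^sup>\<star> * x) - (b * x)\<^sup>\<star> * (b * x)"
    by (simp add: k(2) star_mult algebra_simps)
  finally have "0 \<le> f ((norm b)\<^sup>2 *\<^sub>R (x\<^sup>\<star> * x) - (b * x)\<^sup>\<star> * (b * x))"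
    using f_positive[OF star_mult_self_positive[of "k * x"]] by simp
  then show ?thesis by (simp add: sqnorm_def linear_diff[OF linear_f] linear_scale[OF linear_f])
qed

text \<open>Gram--Schmidt; a dependent vector has residual zero and, as \<open>1 / 0 = 0\<close>, is replaced by zero.\<close>
fun gs :: "nat \<Rightarrow> 'a" where
  "gs n = (let r = a n - (\<Sum>k<n. form (a n) (gs k) *\<^sub>C gs k) in of_real (1 / sqrt (sqnorm r)) *\<^sub>C r)"

declare gs.simps [simp del]

text \<open>The component of \<open>a n\<close> orthogonal to the preceding vectors, before normalization.\<close>
definition residual :: "nat \<Rightarrow> 'a" where
  "residual n = a n - (\<Sum>k<n. form (a n) (gs k) *\<^sub>C gs k)"

lemma gs_residual: "gs n = of_real (1 / sqrt (sqnorm (residual n))) *\<^sub>C residual n"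
  by (subst gs.simps) (simp add: residual_def Let_def)

text \<open>Each Gram--Schmidt vector is a unit vector or zero; multiplying by its square norm changes nothing.\<close>
lemma gs_norm: "form (gs n) (gs n) *\<^sub>C gs n = gs n" "form (gs n) (gs n) = 1 \<or> gs n = 0"
proof -
  show *: "form (gs n) (gs n) = 1 \<or> gs n = 0"
  proof (cases "sqnorm (residual n) = 0")
    case True
    then show ?thesis by (simp add: gs_residual)
  next
    case False
    define s where "s = sqnorm (residual n)"
    have s: "s > 0" using False sqnorm_nonneg[of "residual n"] by (simp add: s_def)
    have "form (gs n) (gs n) = of_real (1 / sqrt s) * (of_real (1 / sqrt s) * of_real s)"
      unfolding gs_residual form_scale_left form_scale_right unfolding form_self by (simp flip: s_def)
    also have "\<dots> = of_real (1 / sqrt s * (1 / sqrt s * s))" by (simp only: of_real_mult)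
    also have "1 / sqrt s * (1 / sqrt s * s) = 1" using s by (simp add: field_simps)
    finally show ?thesis by simp
  qed
  then show "form (gs n) (gs n) *\<^sub>C gs n = gs n" 
  proof
    assume "gs n = 0"
    then show ?thesis by (metis form_zero(1) scaleC_zero_left)
  qed (simp add: scaleC_one)
qed

lemma form_gs_self: "form x (gs n) * form (gs n) (gs n) = form x (gs n)"
  using gs_norm(2)[of n] by (auto simp: form_zero)

lemma gs_orthogonal_less: "j < n \<Longrightarrow> form (gs n) (gs j) = 0"
proof (induction n arbitrary: j rule: less_induct)
  case (less n)
  have orth: "form (gs k) (gs j) = 0" if "k < n" "k \<noteq> j" for k
  proof (cases "j < k")
    case True
    then show ?thesis using less.IH that by simp
  next
    case False
    then have "form (gs j) (gs k) = 0" using less.IH[OF less.prems, of k] that by simp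
    then show ?thesis using form_commute[of "gs k" "gs j"] by simp
  qed
  have "(\<Sum>k<n. form (a n) (gs k) * form (gs k) (gs j)) = (\<Sum>k<n. if k = j then form (a n) (gs j) else 0)"
    by (intro sum.cong refl) (auto simp: orth form_gs_self)
  also have "\<dots> = form (a n) (gs j)" using less.prems by simp
  finally have "form (residual n) (gs j) = 0"
    by (simp add: residual_def form_diff_left form_sum_left)
  then show ?case by (subst gs_residual) (simp add: form_scale_left)
qed

lemma gs_orthogonal: "j \<noteq> k \<Longrightarrow> form (gs j) (gs k) = 0"
  using gs_orthogonal_less[of j k] gs_orthogonal_less[of k j] form_commute[of "gs j" "gs k"]
  by (cases j k rule: linorder_cases) auto

lemma sum_form_gs: "j < n \<Longrightarrow> (\<Sum>k<n. c k * form (gs k) (gs j)) = c j * form (gs j) (gs j)"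
  by (subst sum.remove[of _ j]) (auto simp: gs_orthogonal intro!: sum.neutral)

text \<open>The orthogonal projection of \<open>x\<close> to the span of the first \<open>n\<close> Gram--Schmidt vectors.\<close>
definition partial :: "nat \<Rightarrow> 'a \<Rightarrow> 'a" where
  "partial n x = (\<Sum>k<n. form x (gs k) *\<^sub>C gs k)"

lemma sqnorm_partial: "sqnorm (x - partial n x) = sqnorm x - (\<Sum>k<n. (cmod (form x (gs k)))\<^sup>2)"
proof -
  have p: "form (partial n x) (gs j) = form x (gs j)" if "j < n" for j
    unfolding partial_def form_sum_left using sum_form_gs[OF that] by (simp add: form_gs_self)
  have "form (x - partial n x) (partial n x) = (\<Sum>k<n. cnj (form x (gs k)) * form (x - partial n x) (gs k))"
    by (subst (2) partial_def) (rule form_sum_right)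
  also have "\<dots> = 0" by (intro sum.neutral) (simp add: form_diff_left p)
  finally have "form (x - partial n x) (x - partial n x) = form x x - form (partial n x) x"
    by (simp add: form_diff_right form_diff_left)
  also have "form (partial n x) x = (\<Sum>k<n. form x (gs k) * form (gs k) x)"
    unfolding partial_def by (rule form_sum_left)
  also have "\<dots> = of_real (\<Sum>k<n. (cmod (form x (gs k)))\<^sup>2)"
    unfolding of_real_sum complex_norm_square by (intro sum.cong refl) (simp add: form_commute[of "gs _" x])
  finally have "complex_of_real (sqnorm (x - partial n x)) = of_real (sqnorm x - (\<Sum>k<n. (cmod (form x (gs k)))\<^sup>2))"
    by (simp only: form_self of_real_diff)
  then show ?thesis by (simp only: of_real_eq_iff)
qed

lemma bessel: "(\<Sum>k<n. (cmod (form x (gs k)))\<^sup>2) \<le> sqnorm x"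
  using sqnorm_partial[of x n] sqnorm_nonneg[of "x - partial n x"] by simp

lemma partial_basis_sum:
  assumes "x = (\<Sum>k<n. c k *\<^sub>C gs k)"
  shows "partial n x = x"
proof -
  have "form x (gs k) *\<^sub>C gs k = c k *\<^sub>C gs k" if "k < n" for k
  proof -
    have "form x (gs k) = c k * form (gs k) (gs k)"
      unfolding assms form_sum_left by (rule sum_form_gs[OF that])
    then show ?thesis using gs_norm(1)[of k] by (simp flip: scaleC_scaleC)
  qed
  then show ?thesis unfolding partial_def assms by (intro sum.cong) (auto simp flip: assms)
qed

lemma sequence_in_span:
  assumes "m < n"
  obtains c where "a m = (\<Sum>k<n. c k *\<^sub>C gs k)"
proof -
  have r: "residual m = of_real (sqrt (sqnorm (residual m))) *\<^sub>C gs m"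
  proof (cases "sqnorm (residual m) = 0")
    case True
    then show ?thesis using sqnorm_eq_0 by simp
  next
    case False
    then have "complex_of_real (sqrt (sqnorm (residual m))) * of_real (1 / sqrt (sqnorm (residual m))) = 1"
      by (simp flip: of_real_mult)
    then have "of_real (sqrt (sqnorm (residual m))) *\<^sub>C gs m = residual m"
      by (simp only: gs_residual scaleC_scaleC scaleC_one)
    then show ?thesis by (rule sym)
  qed
  define c where "c = (\<lambda>k. if k < m then form (a m) (gs k) else if k = m then of_real (sqrt (sqnorm (residual m))) else 0)"
  have "(\<Sum>k<n. c k *\<^sub>C gs k) = (\<Sum>k<Suc m. c k *\<^sub>C gs k)"
    using assms by (intro sum.mono_neutral_right) (auto simp: c_def)
  also have "\<dots> = (\<Sum>k<m. form (a m) (gs k) *\<^sub>C gs k) + residual m"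
    by (simp add: c_def flip: r)
  also have "\<dots> = a m" by (simp add: residual_def)
  finally show ?thesis using that by metis
qed

lemma partial_diff: "partial n (x - y) = partial n x - partial n y"
proof -
  have "form (x - y) (gs k) *\<^sub>C gs k = form x (gs k) *\<^sub>C gs k - form y (gs k) *\<^sub>C gs k" for k
    using scaleC_add_left[of "form (x - y) (gs k)" "form y (gs k)" "gs k"] by (simp add: form_diff_left)
  then show ?thesis by (simp add: partial_def sum_subtractf)
qed

lemma partial_tendsto: "(\<lambda>n. sqnorm (x - partial n x)) \<longlonglongrightarrow> 0"
proof (rule LIMSEQ_I)
  fix e :: real assume e: "e > 0"
  have "x \<in> closure (range a)" using dense by simp
  moreover have "sqrt (e / 2) > 0" using e by simp
  ultimately obtain m where m: "norm (x - a m) < sqrt (e / 2)"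
    unfolding closure_approachable by (metis dist_norm norm_minus_commute rangeE)
  have "sqnorm (x - partial n x) < e" if n: "n \<ge> Suc m" for n
  proof -
    obtain c where "a m = (\<Sum>k<n. c k *\<^sub>C gs k)" using sequence_in_span[of m n] n by auto
    then have "partial n (a m) = a m" by (rule partial_basis_sum)
    then have eq: "(x - a m) - partial n (x - a m) = x - partial n x" by (simp add: partial_diff)
    have "sqnorm (x - partial n x) \<le> sqnorm (x - a m)"
      using sqnorm_partial[of "x - a m" n] unfolding eq by (simp add: sum_nonneg)
    also have "\<dots> \<le> 2 * (norm (x - a m))\<^sup>2" by (rule sqnorm_le)
    also have "(norm (x - a m))\<^sup>2 < (sqrt (e / 2))\<^sup>2" using m by (intro power_strict_mono) auto
    finally show ?thesis using e by simp
  qed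
  then show "\<exists>no. \<forall>n\<ge>no. norm (sqnorm (x - partial n x) - 0) < e"
    using sqnorm_nonneg by (intro exI[of _ "Suc m"]) simp
qed

text \<open>The coordinates of \<open>x\<close> with respect to the Gram--Schmidt vectors, an isometry for the GNS inner
  product.\<close>
definition embed :: "'a \<Rightarrow> nat \<Rightarrow> complex" where
  "embed x = (\<lambda>n. form x (gs n))"

lemma embed_l2: "embed x \<in> l2"
  by (rule l2I(1)[of "sqrt (sqnorm x)"]) (simp_all add: embed_def bessel sqnorm_nonneg)

lemma l2norm_embed: "l2norm (embed x) = sqrt (sqnorm x)"
proof -
  have "(\<lambda>n. sqnorm x - sqnorm (x - partial n x)) \<longlonglongrightarrow> sqnorm x - 0"
    by (intro tendsto_intros partial_tendsto)
  then have "(\<lambda>n. (cmod (embed x n))\<^sup>2) sums sqnorm x"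
    unfolding sums_def by (simp add: sqnorm_partial embed_def)
  then show ?thesis by (simp add: l2norm_def sums_iff)
qed

lemma embed_add: "embed (x + y) = (\<lambda>n. embed x n + embed y n)"
  by (simp add: embed_def form_add_left)

lemma embed_scale: "embed (c *\<^sub>C x) = (\<lambda>n. c * embed x n)"
  by (simp add: embed_def form_scale_left)

lemma embed_sum: "embed (\<Sum>k<(n::nat). c k *\<^sub>C u k) = (\<lambda>i. \<Sum>k<n. c k * embed (u k) i)"
  by (simp add: embed_def form_sum_left)

text \<open>By polarization, \<open>embed\<close> preserves inner products.\<close>
lemma ip_embed: "ip (embed x) (embed y) = form x y"
proof -
  define D where "D = (\<lambda>x y. ip (embed x) (embed y) - form x y)"
  have d0: "D z z = 0" for z
    by (simp add: D_def ip_self embed_l2 l2norm_embed sqnorm_nonneg form_self)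
  have al: "D (u + v) w = D u w + D v w" for u v w
    by (simp add: D_def embed_add ip_add_left embed_l2 form_add_left)
  have ar: "D w (u + v) = D w u + D w v" for u v w
    by (simp add: D_def embed_add ip_add_right embed_l2 form_add_right)
  have sl: "D (c *\<^sub>C u) w = c * D u w" for c u w
    by (simp add: D_def embed_scale ip_scale_left embed_l2 form_scale_left algebra_simps)
  have sr: "D w (c *\<^sub>C u) = cnj c * D w u" for c u w
    by (simp add: D_def embed_scale ip_scale_right embed_l2 form_scale_right algebra_simps)
  have "D x y + D y x = 0" using d0[of "x + y", unfolded al ar] by (simp add: d0 add.commute)
  moreover have "- \<i> * D x y + \<i> * D y x = 0" using d0[of "x + \<i> *\<^sub>C y", unfolded al ar sl sr] by (simp add: d0)
  ultimately have "D x y = 0" by (auto simp: add_eq_0_iff)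
  then show ?thesis by (simp add: D_def)
qed

text \<open>The GNS representation, acting on the closure of the range of \<open>embed\<close> by left multiplication and on its
  orthogonal complement by zero. Defining it through the coordinates of the adjoint avoids extending
  by continuity.\<close>
definition rep :: "'a \<Rightarrow> (nat \<Rightarrow> complex) \<Rightarrow> nat \<Rightarrow> complex" where
  "rep b = (\<lambda>x\<in>l2. \<lambda>m. ip x (embed (b\<^sup>\<star> * gs m)))"

lemma rep_row_bound:
  "l2norm (\<lambda>n. \<Sum>m<M. c m * embed (b\<^sup>\<star> * gs m) n) \<le> norm b * sqrt (\<Sum>m<M. (cmod (c m))\<^sup>2)"
proof -
  define w where "w = (\<Sum>m<M. c m *\<^sub>C gs m)"
  have "b\<^sup>\<star> * w = (\<Sum>m<M. c m *\<^sub>C (b\<^sup>\<star> * gs m))" by (simp add: w_def sum_distrib_left scaleC_mult_right)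
  then have "(\<lambda>n. \<Sum>m<M. c m * embed (b\<^sup>\<star> * gs m) n) = embed (b\<^sup>\<star> * w)" by (simp add: embed_sum)
  then have "l2norm (\<lambda>n. \<Sum>m<M. c m * embed (b\<^sup>\<star> * gs m) n) = sqrt (sqnorm (b\<^sup>\<star> * w))" by (simp add: l2norm_embed)
  also have "\<dots> \<le> sqrt ((norm b)\<^sup>2 * sqnorm w)" using sqnorm_mult_le[of "b\<^sup>\<star>" w] by simp
  also have "\<dots> = norm b * sqrt (sqnorm w)" by (simp add: real_sqrt_mult)
  also have "sqnorm w \<le> (\<Sum>m<M. (cmod (c m))\<^sup>2)"
  proof -
    have "form w w = (\<Sum>m<M. cnj (c m) * form w (gs m))" unfolding w_def by (rule form_sum_right)
    also have "\<dots> = (\<Sum>m<M. of_real ((cmod (c m))\<^sup>2 * sqnorm (gs m)))"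
    proof (intro sum.cong refl)
      fix m assume "m \<in> {..<M}"
      then have "form w (gs m) = c m * form (gs m) (gs m)" unfolding w_def form_sum_left by (intro sum_form_gs) simp
      then show "cnj (c m) * form w (gs m) = of_real ((cmod (c m))\<^sup>2 * sqnorm (gs m))"
        unfolding of_real_mult complex_norm_square form_self[symmetric] by simp
    qed
    finally have "complex_of_real (sqnorm w) = of_real (\<Sum>m<M. (cmod (c m))\<^sup>2 * sqnorm (gs m))"
      by (simp only: form_self of_real_sum)
    then have "sqnorm w = (\<Sum>m<M. (cmod (c m))\<^sup>2 * sqnorm (gs m))" by (simp only: of_real_eq_iff)
    also have "\<dots> \<le> (\<Sum>m<M. (cmod (c m))\<^sup>2)"
    proof (intro sum_mono)
      fix m
      have "sqnorm (gs m) \<le> 1" using gs_norm(2)[of m] by (auto simp: form_self sqnorm_def linear_0[OF linear_f])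
      then show "(cmod (c m))\<^sup>2 * sqnorm (gs m) \<le> (cmod (c m))\<^sup>2" by (simp add: mult_left_le)
    qed
    finally show ?thesis .
  qed
  finally show ?thesis by (simp add: mult_left_mono)
qed

lemma rep_ops: "rep b \<in> ops"
  unfolding rep_def by (rule row_operator(1)[OF embed_l2 norm_ge_zero rep_row_bound])

lemma rep_apply: "x \<in> l2 \<Longrightarrow> rep b x = (\<lambda>m. ip x (embed (b\<^sup>\<star> * gs m)))"
  by (simp add: rep_def)

lemma rep_bound: "x \<in> l2 \<Longrightarrow> l2norm (rep b x) \<le> norm b * l2norm x"
  unfolding rep_apply by (rule row_operator(2)[OF embed_l2 norm_ge_zero rep_row_bound])

lemma rep_embed: "rep b (embed x) = embed (b * x)"
  by (simp add: rep_apply embed_l2 ip_embed) (simp add: embed_def form_mult)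

lemma rep_unit_vec: "rep b (unit_vec m) = embed (b * gs m)"
proof (rule ext)
  fix n
  have "rep b (unit_vec m) n = cnj (form (b\<^sup>\<star> * gs n) (gs m))"
    by (simp add: rep_apply unit_vec_l2 ip_unit_vec_left) (simp add: embed_def)
  also have "\<dots> = form (gs m) (b\<^sup>\<star> * gs n)" by (simp flip: form_commute)
  finally show "rep b (unit_vec m) n = embed (b * gs m) n" by (simp add: embed_def form_mult)
qed

lemma rep_adjoint:
  assumes x: "x \<in> l2" and y: "y \<in> l2"
  shows "ip (rep b x) y = ip x (rep (b\<^sup>\<star>) y)"
proof (rule adjoint_on_basis[OF rep_ops rep_ops y x])
  show "ip (rep b (unit_vec m)) y = ip (unit_vec m) (rep (b\<^sup>\<star>) y)" for m
    using ip_commute[OF y embed_l2] by (simp add: rep_unit_vec ip_unit_vec_left rep_apply y star_star)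
qed

lemma rep_mult: "rep (b * c) = compose l2 (rep b) (rep c)"
proof (rule op_ext[OF rep_ops op_compose[OF rep_ops rep_ops]])
  fix x assume x: "x \<in> l2"
  have "rep b (rep c x) m = rep (b * c) x m" for m
  proof -
    have "rep b (rep c x) m = ip (rep c x) (embed (b\<^sup>\<star> * gs m))"
      by (simp add: rep_apply op_in[OF rep_ops x])
    also have "\<dots> = ip x (embed (c\<^sup>\<star> * (b\<^sup>\<star> * gs m)))"
      by (simp add: rep_adjoint[OF x embed_l2] rep_embed)
    also have "\<dots> = rep (b * c) x m" by (simp add: rep_apply x star_mult mult.assoc)
    finally show ?thesis .
  qed
  then show "rep (b * c) x = compose l2 (rep b) (rep c) x" using x by (simp add: compose_def fun_eq_iff)
qed

lemma rep_add: "rep (b + c) = (\<lambda>x\<in>l2. \<lambda>n. rep b x n + rep c x n)"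
  unfolding rep_def by (intro restrict_ext) (simp add: star_add distrib_right embed_add ip_add_right embed_l2)

lemma rep_scale: "rep (z *\<^sub>C b) = (\<lambda>x\<in>l2. \<lambda>n. z * rep b x n)"
  unfolding rep_def by (intro restrict_ext) (simp add: star_scaleC scaleC_mult_left embed_scale ip_scale_right embed_l2)

lemma rep_star: "rep (b\<^sup>\<star>) = op_adj l2_hilbert (rep b)"
  by (rule op_adj_eq[OF rep_ops rep_adjoint, symmetric])

lemma rep_diff: "x \<in> l2 \<Longrightarrow> rep (b - c) x = (\<lambda>n. rep b x n - rep c x n)"
  using fun_cong[OF rep_add[of "b - c" c], of x] by simp

text \<open>The representation is bounded below: if \<open>rep b\<close> has norm at most \<open>C\<close>, the negative part of
  \<open>C\<^sup>2 - b\<^sup>\<star>b\<close> is annihilated by the functional, hence zero.\<close>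
lemma rep_lower_bound:
  assumes C: "\<And>x. x \<in> l2 \<Longrightarrow> l2norm (rep b x) \<le> C * l2norm x"
  shows "(norm b)\<^sup>2 \<le> 2 * C\<^sup>2"
proof -
  define h where "h = C\<^sup>2 *\<^sub>R 1 - b\<^sup>\<star> * b"
  have hs: "h\<^sup>\<star> = h" by (simp add: h_def star_diff star_scaleR star_mult star_star)
  have pos: "0 \<le> f (x\<^sup>\<star> * h * x)" for x
  proof -
    have "sqrt (sqnorm (b * x)) \<le> C * sqrt (sqnorm x)"
      using C[OF embed_l2, of x] by (simp add: rep_embed l2norm_embed)
    then have "(sqrt (sqnorm (b * x)))\<^sup>2 \<le> (C * sqrt (sqnorm x))\<^sup>2"
      using sqnorm_nonneg by (intro power_mono) auto
    then have "sqnorm (b * x) \<le> C\<^sup>2 * sqnorm x" by (simp add: power_mult_distrib sqnorm_nonneg)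
    moreover have "x\<^sup>\<star> * h * x = C\<^sup>2 *\<^sub>R (x\<^sup>\<star> * x) - (b * x)\<^sup>\<star> * (b * x)"
      by (simp add: h_def star_mult algebra_simps)
    ultimately show ?thesis by (simp add: sqnorm_def linear_diff[OF linear_f] linear_scale[OF linear_f])
  qed
  obtain w g where w: "w\<^sup>\<star> = w" "g\<^sup>\<star> = g" "w * h * w = - (g * g)" "g = 0 \<Longrightarrow> h \<in> positive_cone"
    using negative_part[OF hs] by metis
  have "0 \<le> - f (g * g)" using pos[of w] w by (simp add: linear_neg[OF linear_f])
  then have "g = 0" using faithful[of g] w(2) by force
  then have "h \<in> positive_cone" by (rule w(4))
  then have "norm (b\<^sup>\<star> * b) \<le> 2 * C\<^sup>2"
    unfolding h_def by (rule positive_norm_bound[OF star_mult_self_positive])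
  then show ?thesis by (simp add: cstar_identity)
qed

lemma inj_rep: "inj rep"
proof (rule injI)
  fix b c assume "rep b = rep c"
  then have "rep (b - c) x = (\<lambda>n. 0)" if "x \<in> l2" for x using rep_diff[OF that, of b c] by simp
  then have "(norm (b - c))\<^sup>2 \<le> 2 * 0\<^sup>2" by (intro rep_lower_bound) simp
  then show "b = c" by simp
qed

lemma rep_closed:
  assumes T: "T \<in> ops"
    and lim: "(\<lambda>n. op_norm l2_hilbert (\<lambda>x\<in>l2. \<lambda>k. rep (b n) x k - T x k)) \<longlonglongrightarrow> 0"
  shows "T \<in> range rep"
proof -
  define d where "d = (\<lambda>n. \<bar>op_norm l2_hilbert (\<lambda>x\<in>l2. \<lambda>k. rep (b n) x k - T x k)\<bar>)"
  have d: "d \<longlonglongrightarrow> 0" unfolding d_def using tendsto_rabs[OF lim] by simp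
  have dn: "l2norm (\<lambda>k. rep (b n) x k - T x k) \<le> d n * l2norm x" if x: "x \<in> l2" for n x
  proof -
    have "l2norm (\<lambda>k. rep (b n) x k - T x k) \<le> op_norm l2_hilbert (\<lambda>x\<in>l2. \<lambda>k. rep (b n) x k - T x k) * l2norm x"
      using op_norm_bound[OF op_minus[OF rep_ops T] x] x by simp
    also have "\<dots> \<le> d n * l2norm x"
      unfolding d_def using l2norm_nonneg[OF x] by (intro mult_right_mono) auto
    finally show ?thesis .
  qed
  have diff: "norm (b m - b n) \<le> 2 * (d m + d n)" for m n
  proof -
    have "l2norm (rep (b m - b n) x) \<le> (d m + d n) * l2norm x" if x: "x \<in> l2" for x
    proof -
      have "rep (b m - b n) x = (\<lambda>k. (rep (b m) x k - T x k) - (rep (b n) x k - T x k))"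
        by (simp add: rep_diff x)
      then have "l2norm (rep (b m - b n) x) \<le> l2norm (\<lambda>k. rep (b m) x k - T x k) + l2norm (\<lambda>k. rep (b n) x k - T x k)"
        using l2norm_diff[OF l2_diff[OF op_in[OF rep_ops x] op_in[OF T x]] l2_diff[OF op_in[OF rep_ops x] op_in[OF T x]]] by simp
      then show ?thesis using dn[OF x, of m] dn[OF x, of n] by (simp add: algebra_simps)
    qed
    then have "(norm (b m - b n))\<^sup>2 \<le> 2 * (d m + d n)\<^sup>2" by (rule rep_lower_bound)
    also have "\<dots> \<le> (2 * (d m + d n))\<^sup>2"
      unfolding power_mult_distrib by (rule mult_right_mono) simp_all
    finally show ?thesis by (rule power2_le_imp_le) (simp add: d_def)
  qed
  have "Cauchy b"
  proof (rule CauchyI)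
    fix e :: real assume "e > 0"
    then obtain N where N: "\<And>n. n \<ge> N \<Longrightarrow> d n < e / 4"
      using LIMSEQ_D[OF d, of "e / 4"] by (auto simp: d_def)
    have "norm (b m - b n) < e" if "m \<ge> N" "n \<ge> N" for m n
      using diff[of m n] N[OF that(1)] N[OF that(2)] by simp
    then show "\<exists>M. \<forall>m\<ge>M. \<forall>n\<ge>M. norm (b m - b n) < e" by blast
  qed
  then obtain l where l: "b \<longlonglongrightarrow> l" using Cauchy_convergent convergent_def by blast
  have "rep l = T"
  proof (rule op_ext[OF rep_ops T], rule ext)
    fix x k assume x: "x \<in> l2"
    have "cmod (rep l x k - T x k) \<le> (norm (l - b n) + d n) * l2norm x" for n
    proof -
      have "cmod (rep l x k - T x k) \<le> cmod (rep (l - b n) x k) + cmod (rep (b n) x k - T x k)"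
        using norm_triangle_ineq[of "rep (l - b n) x k" "rep (b n) x k - T x k"] by (simp add: rep_diff x)
      also have "\<dots> \<le> l2norm (rep (l - b n) x) + l2norm (\<lambda>k. rep (b n) x k - T x k)"
        using component_le_l2norm[OF op_in[OF rep_ops x]] component_le_l2norm[OF l2_diff[OF op_in[OF rep_ops x] op_in[OF T x]]]
        by (intro add_mono)
      also have "\<dots> \<le> (norm (l - b n) + d n) * l2norm x"
        using rep_bound[OF x, of "l - b n"] dn[OF x, of n] by (simp add: algebra_simps)
      finally show ?thesis .
    qed
    moreover have "(\<lambda>n. (norm (l - b n) + d n) * l2norm x) \<longlonglongrightarrow> (norm (l - l) + 0) * l2norm x"
      by (intro tendsto_intros l d)
    ultimately have "cmod (rep l x k - T x k) \<le> (norm (l - l) + 0) * l2norm x"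
      by (intro LIMSEQ_le_const) auto
    then show "rep l x k = T x k" by simp
  qed
  then show ?thesis by blast
qed

lemma range_rep_cstar_subalgebra:
  "cstar_subalgebra (range rep) (choi_effros l2_hilbert (\<lambda>T\<in>ops. T))"
proof -
  let ?B = "choi_effros l2_hilbert (\<lambda>T\<in>ops. T)"
  note B = choi_effros_l2
  have "rep 0 = (\<lambda>x\<in>l2. \<lambda>n. 0)" using rep_scale[of 0 0] by simp
  then have zero: "\<zero>\<^bsub>?B\<^esub> \<in> range rep" unfolding B(5) by (metis rangeI)
  have add: "rep b \<oplus>\<^bsub>?B\<^esub> rep c \<in> range rep" for b c unfolding B(3) by (metis rep_add rangeI)
  have mult: "rep b \<otimes>\<^bsub>?B\<^esub> rep c \<in> range rep" for b c
    unfolding B(2)[OF rep_ops rep_ops] by (metis rep_mult rangeI)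
  have smult: "z \<odot>\<^bsub>?B\<^esub> rep b \<in> range rep" for z b unfolding B(4) by (metis rep_scale rangeI)
  have adj: "adj ?B (rep b) \<in> range rep" for b unfolding B(6) by (metis rep_star rangeI)
  have closed: "L \<in> range rep"
    if L: "L \<in> carrier ?B" and X: "\<forall>n::nat. X n \<in> range rep" and lim: "(\<lambda>n. nrm ?B (X n \<ominus>\<^bsub>?B\<^esub> L)) \<longlonglongrightarrow> 0" for X L
  proof -
    define b where "b = (\<lambda>n. inv_into UNIV rep (X n))"
    have b: "X n = rep (b n)" for n using X by (simp add: b_def f_inv_into_f)
    have L': "L \<in> ops" using L by (simp only: B(1))
    show ?thesis
      by (rule rep_closed[OF L', of b]) (use lim in \<open>simp only: b B(7) ops_minus[OF B(1,3,5) rep_ops L']\<close>)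
  qed
  show ?thesis unfolding cstar_subalgebra_def
  proof (intro conjI ballI allI impI)
    show "range rep \<subseteq> carrier ?B" unfolding B(1) using rep_ops by blast
    fix S T z X L assume "S \<in> range rep"
    then obtain b where b: "S = rep b" by (rule rangeE)
    show "z \<odot>\<^bsub>?B\<^esub> S \<in> range rep" unfolding b by (rule smult)
    show "adj ?B S \<in> range rep" unfolding b by (rule adj)
    assume "T \<in> range rep"
    then obtain c where c: "T = rep c" by (rule rangeE)
    show "S \<oplus>\<^bsub>?B\<^esub> T \<in> range rep" unfolding b c by (rule add)
    show "S \<otimes>\<^bsub>?B\<^esub> T \<in> range rep" unfolding b c by (rule mult)
  next
    fix X L
    assume "L \<in> carrier ?B" "(\<forall>n::nat. X n \<in> range rep) \<and> (\<lambda>n. nrm ?B (X n \<ominus>\<^bsub>?B\<^esub> L)) \<longlonglongrightarrow> 0"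
    then show "L \<in> range rep" by (elim conjE) (rule closed)
  qed (rule zero)
qed

lemma rep_star_isomorphism:
  "star_isomorphism rep (range rep) (choi_effros l2_hilbert (\<lambda>T\<in>ops. T))"
  unfolding star_isomorphism_def choi_effros_l2(3,4,6)
  by (simp add: choi_effros_l2(2) rep_ops rep_add rep_scale rep_mult rep_star inj_rep inj_on_imp_bij_betw)

end

theorem theorem8p1:
  assumes "separable_space (euclidean :: 'a::unital_cstar_algebra topology)"
    and "purely_infinite TYPE('a)"
  shows "\<exists>(G :: nat monoid) (H :: (nat \<Rightarrow> complex) hilbert) \<pi>.
           group G \<and> countable (carrier G) \<and> hilbert_space H \<and> \<pi> \<in> hom G (unitary_group H) \<and>
           (\<exists>B. is_FH_boundary G H \<pi> B) \<and>
           (\<forall>B. is_FH_boundary G H \<pi> B \<longrightarrow>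
              (\<exists>C (f :: 'a \<Rightarrow> _). cstar_subalgebra C B \<and> star_isomorphism f C B))"
proof -
  obtain f :: "'a \<Rightarrow> real" where f: "positive_real_functional f" "\<And>x. \<bar>f x\<bar> \<le> 2 * norm x"
    "\<And>x. x \<noteq> 0 \<Longrightarrow> 0 < f (x\<^sup>\<star> * x)"
    using exists_faithful_functional[OF assms(1)] by metis
  obtain D :: "'a set" where D: "countable D" "closure D = UNIV"
    using assms(1) by (auto simp: separable_space_def)
  then have "D \<noteq> {}" by auto
  then have "range (from_nat_into D) = D" using D(1) by (rule range_from_nat_into)
  then interpret faithful_functional f "from_nat_into D"
    using f D(2) by unfold_locales simp_all
  show ?thesis
  proof (intro exI conjI allI impI)
    show "group word_group" by (rule group_word_group)
    show "countable (carrier word_group)" by (rule countable_subset[OF subset_UNIV]) simp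
    show "hilbert_space l2_hilbert" by (rule hilbert_space_l2)
    show "word_rep \<in> hom word_group (unitary_group l2_hilbert)" by (rule word_rep_hom)
    show "is_FH_boundary word_group l2_hilbert word_rep (choi_effros l2_hilbert (\<lambda>T\<in>ops. T))"
      by (simp add: is_FH_boundary_word_group)
    fix B assume "is_FH_boundary word_group l2_hilbert word_rep B"
    then have B: "B = choi_effros l2_hilbert (\<lambda>T\<in>ops. T)" by (simp add: is_FH_boundary_word_group)
    show "cstar_subalgebra (range rep) B" unfolding B by (rule range_rep_cstar_subalgebra)
    show "star_isomorphism rep (range rep) B" unfolding B by (rule rep_star_isomorphism)
  qed
qed

end
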